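(* For site percolation on $\mathbb{Z}^2$ at the critical value $p=p_c$, there is $\mathbb{P}_{p_c}$-almost surely no infinite cluster.
   Context: Site percolation on the nearest-neighbour square lattice $\mathbb{Z}^2$ with parameter $p\in[0,1]$: each site is independently occupied with probability $p$ and vacant otherwise; $\mathbb{P}_p$ is the corresponding product measure. Clusters are the connected components of the set of occupied sites. The critical value is $p_c=\sup\{p:\mathbb{P}_p[\text{the origin is contained in an infinite cluster}]=0\}$. *)

theory Defs
  imports "HOL-Probability.Probability"
begin

type_synonym site = "int \<times> int"

text \<open>A configuration assigns \<^const>\<open>True\<close> to the occupied and \<^const>\<open>False\<close> to the vacant sites.\<close>

type_synonym configuration = "site \<Rightarrow> bool"

definition nearest_neighbours :: "site \<Rightarrow> site \<Rightarrow> bool" where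
  "nearest_neighbours x y \<longleftrightarrow> \<bar>fst x - fst y\<bar> + \<bar>snd x - snd y\<bar> = 1"

definition percolation_measure :: "real \<Rightarrow> configuration measure" where
  "percolation_measure p = (\<Pi>\<^sub>M x\<in>UNIV. measure_pmf (bernoulli_pmf p))"

definition occupied_edges :: "configuration \<Rightarrow> (site \<times> site) set" where
  "occupied_edges \<omega> = {(x, y). nearest_neighbours x y \<and> \<omega> x \<and> \<omega> y}"

definition clusters :: "configuration \<Rightarrow> site set set" where
  "clusters \<omega> = (\<lambda>x. (occupied_edges \<omega>)\<^sup>* `` {x}) ` {x. \<omega> x}"

definition origin_percolates :: "configuration \<Rightarrow> bool" where
  "origin_percolates \<omega> \<longleftrightarrow> (\<exists>C\<in>clusters \<omega>. (0, 0) \<in> C \<and> infinite C)"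

text \<open>The set below is nonempty, as it contains 0, and it is bounded, so the supremum is a genuine
  one.  That the probability is that of a measurable event is the lemma
  \<open>origin_percolates_measurable\<close>.\<close>

definition p_c :: real where
  "p_c = Sup {p \<in> {0..1}. measure (percolation_measure p)
                {\<omega> \<in> space (percolation_measure p). origin_percolates \<omega>} = 0}"

lemma occupied_measurable:
  "Measurable.pred (percolation_measure p) (\<lambda>\<omega>. \<omega> x)"
proof -
  have "(\<lambda>\<omega>. \<omega> x) \<in> measurable (percolation_measure p) (measure_pmf (bernoulli_pmf p))"
    unfolding percolation_measure_def by (rule measurable_component_singleton) simp
  then show ?thesis by simp
qed

lemma connected_measurable:
  "Measurable.pred (percolation_measure p) (\<lambda>\<omega>. (x, y) \<in> (occupied_edges \<omega>)\<^sup>*)"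
proof -
  have "Measurable.pred (percolation_measure p) (\<lambda>\<omega>. (x, y) \<in> (occupied_edges \<omega>) ^^ n)" for n
  proof (induction n arbitrary: y)
    case 0
    show ?case by simp
  next
    case (Suc n)
    note [measurable] = Suc.IH occupied_measurable
    have "(\<lambda>\<omega>. (x, y) \<in> (occupied_edges \<omega>) ^^ Suc n) =
      (\<lambda>\<omega>. \<exists>z. (x, z) \<in> (occupied_edges \<omega>) ^^ n \<and> nearest_neighbours z y \<and> \<omega> z \<and> \<omega> y)"
      by (auto simp: occupied_edges_def fun_eq_iff relcomp_unfold)
    then show ?case by simp
  qed
  note [measurable] = this
  show ?thesis unfolding rtrancl_power by measurable
qed

lemma origin_percolates_measurable:
  "Measurable.pred (percolation_measure p) origin_percolates"
proof -
  note [measurable] = occupied_measurable connected_measurable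
  have "origin_percolates \<omega> \<longleftrightarrow> (\<exists>x. \<omega> x \<and> (x, (0, 0)) \<in> (occupied_edges \<omega>)\<^sup>* \<and>
      (\<forall>n::nat. \<exists>y. (n < to_nat y) \<and> (x, y) \<in> (occupied_edges \<omega>)\<^sup>*))" for \<omega>
  proof -
    have "infinite C \<longleftrightarrow> (\<forall>n. \<exists>y. n < to_nat y \<and> y \<in> C)" for C :: "site set"
    proof -
      have "infinite C \<longleftrightarrow> infinite (to_nat ` C)"
        by (simp add: finite_image_iff inj_on_def)
      also have "\<dots> \<longleftrightarrow> (\<forall>n. \<exists>y. n < to_nat y \<and> y \<in> C)"
        unfolding infinite_nat_iff_unbounded by blast
      finally show ?thesis .
    qed
    then show ?thesis by (auto simp: origin_percolates_def clusters_def)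
  qed
  then have eq: "origin_percolates = (\<lambda>\<omega>. \<exists>x. \<omega> x \<and> (x, (0, 0)) \<in> (occupied_edges \<omega>)\<^sup>* \<and>
      (\<forall>n::nat. \<exists>y. (n < to_nat y) \<and> (x, y) \<in> (occupied_edges \<omega>)\<^sup>*))" by (rule ext)
  show ?thesis unfolding eq by measurable
qed

end

theory Submission
  imports Defs
begin

text \<open>Suppose that there is an infinite cluster at \<open>p\<close>.  By Burton and Keane it is unique, so the arms
  that join a large box to the sides of a much larger one are with high probability all connected
  inside the larger box.  Splitting each side at a point \<open>\<alpha>\<close> where both parts are still likely to
  be reached, and comparing \<open>\<alpha>\<close> at two scales whose ratio is about \<open>3/2\<close>, one finds boxes whose clusters
  have to intersect for topological reasons; a chain of fourteen such steps crosses a 2:1 rectangle in the long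
  direction with probability at least 0.99.  This probability is a polynomial in \<open>p\<close>, and such a bound at a
  single scale forces an infinite cluster.  Hence the parameters with an infinite cluster form an
  open subset of \<open>[0, 1]\<close>, and \<open>p_c\<close>, a supremum of parameters without one, does not belong to it.\<close>

section \<open>Product measure\<close>

text \<open>Site percolation on the square lattice is not self-dual, so no crossing probability is
  known in advance; all connections have to come from the infinite cluster, and the argument uses
  occupied paths only. Symmetry and the square-root trick make arms to every side likely, but do not
  tell where they land, and arms of neighbouring boxes may pass each other. The height
  \<open>\<alpha>\<close> repairs this. At scale \<open>N\<close> a likely cluster reaches the
  window \<open>{0..\<alpha> N}\<close> on both sides; at scale \<open>M\<close> a likely cluster
  reaches above \<open>\<alpha> M\<close> and below \<open>- \<alpha> M\<close> on both sides. If
  \<open>\<alpha> N \<le> 2 * \<alpha> M\<close>, the window fits between these two ends and the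
  clusters must meet. Such scales exist because \<open>\<alpha> M \<le> M\<close> cannot more than
  double each time \<open>M\<close> grows by a factor near 3/2. The factor has to stay below 2 for
  this growth argument, and above 1 because a step of the chain advances by
  \<open>2 * (N - M)\<close>. The bound 0.99 comes from the doubling of rectangles: a failure
  probability \<open>q\<close> at scale \<open>L\<close> becomes at most 25 q^2 at scale
  \<open>2 * L\<close>, which is at most q / 4 once q is at most 1/100.\<close>

definition determined_by :: "'a set \<Rightarrow> ('a \<Rightarrow> bool) set \<Rightarrow> bool" where
  "determined_by J A \<longleftrightarrow> (\<forall>\<eta> \<eta>'. (\<forall>x\<in>J. \<eta> x = \<eta>' x) \<longrightarrow> \<eta> \<in> A \<longrightarrow> \<eta>' \<in> A)"

definition increasing :: "('a \<Rightarrow> bool) set \<Rightarrow> bool" where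
  "increasing A \<longleftrightarrow> (\<forall>\<eta> \<eta>'. \<eta> \<in> A \<longrightarrow> (\<forall>x. \<eta> x \<longrightarrow> \<eta>' x) \<longrightarrow> \<eta>' \<in> A)"

lemma determined_byD: "determined_by J A \<Longrightarrow> (\<And>x. x \<in> J \<Longrightarrow> \<eta> x = \<eta>' x) \<Longrightarrow> \<eta> \<in> A \<longleftrightarrow> \<eta>' \<in> A"
  unfolding determined_by_def by metis

lemma determined_by_mono: "determined_by J A \<Longrightarrow> J \<subseteq> K \<Longrightarrow> determined_by K A"
  unfolding determined_by_def by blast

lemma determined_by_Compl: "determined_by J A \<Longrightarrow> determined_by J (- A)"
  unfolding determined_by_def by (metis Compl_iff)

lemma determined_by_empty: "determined_by {} A \<Longrightarrow> A = {} \<or> A = UNIV"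
  unfolding determined_by_def by auto

text \<open>Fixing the state of one site leaves an event of the remaining sites. This is what drives
  the inductions over a finite set of sites below; they start from events of no site, which are
  \<open>{}\<close> or \<open>UNIV\<close>.\<close>

lemma determined_by_update:
  assumes "determined_by (insert x J) A"
  shows "determined_by J {\<eta>. \<eta>(x := b) \<in> A}"
  unfolding determined_by_def
proof (intro allI impI)
  fix \<eta> \<eta>' assume "\<forall>x\<in>J. \<eta> x = \<eta>' x" "\<eta> \<in> {\<eta>. \<eta>(x := b) \<in> A}"
  then show "\<eta>' \<in> {\<eta>. \<eta>(x := b) \<in> A}"
    using determined_byD[OF assms, of "\<eta>(x := b)" "\<eta>'(x := b)"] by (metis fun_upd_apply insertE mem_Collect_eq)
qed

lemma determined_by_UN: "(\<And>i. i \<in> I \<Longrightarrow> determined_by J (A i)) \<Longrightarrow> determined_by J (\<Union>i\<in>I. A i)"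
  unfolding determined_by_def by (metis UN_iff)

lemma increasing_update:
  assumes "increasing A"
  shows "increasing {\<eta>. \<eta>(x := b) \<in> A}"
  unfolding increasing_def
proof (intro allI impI)
  fix \<eta> \<eta>' assume "\<eta> \<in> {\<eta>. \<eta>(x := b) \<in> A}" "\<forall>x. \<eta> x \<longrightarrow> \<eta>' x"
  then show "\<eta>' \<in> {\<eta>. \<eta>(x := b) \<in> A}"
    using assms[unfolded increasing_def, rule_format, of "\<eta>(x := b)" "\<eta>'(x := b)"] by simp
qed

section \<open>Resampling of a single site\<close>

lemma space_percolation_measure [simp]: "space (percolation_measure p) = UNIV"
  by (simp add: percolation_measure_def space_PiM)

interpretation percolation: prob_space "percolation_measure p" for p
  unfolding percolation_measure_def by (intro prob_space_PiM) (simp add: measure_pmf.prob_space_axioms)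

lemma percolation_measure_resample:
  "distr (measure_pmf (bernoulli_pmf p) \<Otimes>\<^sub>M percolation_measure p) (percolation_measure p)
     (\<lambda>(b, \<eta>). \<eta>(x := b)) = percolation_measure p"
  using distr_pair_PiM_eq_PiM[of UNIV "\<lambda>_. measure_pmf (bernoulli_pmf p)" x]
  by (simp add: percolation_measure_def measure_pmf.prob_space_axioms)

lemma measurable_fun_upd_percolation:
  "(\<lambda>\<eta>. \<eta>(x := b)) \<in> measurable (percolation_measure p) (percolation_measure p)"
proof -
  have "(\<lambda>(b, \<eta>). \<eta>(x := b)) \<in> measurable (measure_pmf (bernoulli_pmf p) \<Otimes>\<^sub>M percolation_measure p) (percolation_measure p)"
    unfolding percolation_measure_def
    using measurable_compose[OF measurable_pair_swap' measurable_add_dim[of x UNIV "\<lambda>_. measure_pmf (bernoulli_pmf p)"]]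
    by (simp add: case_prod_beta')
  from measurable_compose[OF measurable_Pair1'[of b] this] show ?thesis by simp
qed

lemma sets_percolation_update:
  "A \<in> sets (percolation_measure p) \<Longrightarrow> {\<eta>. \<eta>(x := b) \<in> A} \<in> sets (percolation_measure p)"
  using measurable_sets[OF measurable_fun_upd_percolation[of x b p], of A] by (simp add: vimage_def)

text \<open>Overwriting the coordinate \<open>x\<close> by an independent Bernoulli variable
  preserves the product measure, and Fubini then gives total probability over the state of
  \<open>x\<close>. Continuity in \<open>p\<close>, independence, Harris' inequality and the cost of
  filling sites are all read off from this formula.\<close>

lemma prob_resample:
  assumes p: "0 \<le> p" "p \<le> 1" and A: "A \<in> sets (percolation_measure p)"
  shows "measure (percolation_measure p) A =
    p * measure (percolation_measure p) {\<eta>. \<eta>(x := True) \<in> A} +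
    (1 - p) * measure (percolation_measure p) {\<eta>. \<eta>(x := False) \<in> A}"
proof -
  let ?M = "percolation_measure p" and ?B = "measure_pmf (bernoulli_pmf p)"
  have m: "(\<lambda>(b, \<eta>). \<eta>(x := b)) \<in> measurable (?B \<Otimes>\<^sub>M ?M) ?M"
    unfolding percolation_measure_def
    using measurable_compose[OF measurable_pair_swap' measurable_add_dim[of x UNIV "\<lambda>_. measure_pmf (bernoulli_pmf p)"]]
    by (simp add: case_prod_beta')
  have "emeasure ?M A = emeasure (distr (?B \<Otimes>\<^sub>M ?M) ?M (\<lambda>(b, \<eta>). \<eta>(x := b))) A"
    by (simp add: percolation_measure_resample)
  also have "\<dots> = emeasure (?B \<Otimes>\<^sub>M ?M) ((\<lambda>(b, \<eta>). \<eta>(x := b)) -` A \<inter> space (?B \<Otimes>\<^sub>M ?M))"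
    by (rule emeasure_distr[OF m A])
  also have "\<dots> = (\<integral>\<^sup>+ b. emeasure ?M (Pair b -` ((\<lambda>(b, \<eta>). \<eta>(x := b)) -` A \<inter> space (?B \<Otimes>\<^sub>M ?M))) \<partial>?B)"
    by (rule percolation.emeasure_pair_measure_alt) (rule measurable_sets[OF m A])
  also have "\<dots> = (\<integral>\<^sup>+ b. emeasure ?M {\<eta>. \<eta>(x := b) \<in> A} \<partial>?B)"
    by (intro nn_integral_cong arg_cong[where f = "emeasure ?M"]) (auto simp: space_pair_measure)
  also have "\<dots> = emeasure ?M {\<eta>. \<eta>(x := True) \<in> A} * ennreal p + emeasure ?M {\<eta>. \<eta>(x := False) \<in> A} * ennreal (1 - p)"
    using p by (subst nn_integral_bernoulli_pmf) (auto simp: mult.commute)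
  finally show ?thesis
    using p unfolding percolation.emeasure_eq_measure
    by (simp add: ennreal_mult[symmetric] ennreal_plus[symmetric] measure_nonneg mult.commute del: ennreal_plus)
qed

lemma determined_by_sets:
  assumes "finite J" "determined_by J A"
  shows "A \<in> sets (percolation_measure p)"
  using assms
proof (induction J arbitrary: A rule: finite_induct)
  case empty
  then show ?case using determined_by_empty sets.top[of "percolation_measure p"] by auto
next
  case (insert x J)
  note [measurable] = occupied_measurable
  have "A = {\<eta>. \<eta> x} \<inter> {\<eta>. \<eta>(x := True) \<in> A} \<union> {\<eta>. \<not> \<eta> x} \<inter> {\<eta>. \<eta>(x := False) \<in> A}"
  proof (rule set_eqI)
    fix \<eta> show "\<eta> \<in> A \<longleftrightarrow> \<eta> \<in> {\<eta>. \<eta> x} \<inter> {\<eta>. \<eta>(x := True) \<in> A} \<union> {\<eta>. \<not> \<eta> x} \<inter> {\<eta>. \<eta>(x := False) \<in> A}"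
      by (cases "\<eta> x") (simp_all add: fun_upd_idem)
  qed
  moreover have "{\<eta>. \<eta>(x := b) \<in> A} \<in> sets (percolation_measure p)" for b
    using insert.IH[OF determined_by_update[OF insert.prems]] .
  moreover have "{\<eta>. \<eta> x} \<in> sets (percolation_measure p)" "{\<eta>. \<not> \<eta> x} \<in> sets (percolation_measure p)"
    using predE[OF occupied_measurable[where p = p and x = x]]
      predE[OF pred_intros_logic(2)[OF occupied_measurable[where p = p and x = x]]] by simp_all
  ultimately show ?case by (metis sets.Int sets.Un)
qed

text \<open>Unfolding the resampling formula site by site exhibits the probability as a polynomial
  on the interval where that formula is available.\<close>

lemma continuous_on_prob:
  assumes "finite J" "determined_by J A"
  shows "continuous_on {0..1} (\<lambda>p. measure (percolation_measure p) A)"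
  using assms
proof (induction J arbitrary: A rule: finite_induct)
  case empty
  then show ?case using determined_by_empty percolation.prob_space by fastforce
next
  case (insert x J)
  have "continuous_on {0..1} (\<lambda>p. p * measure (percolation_measure p) {\<eta>. \<eta>(x := True) \<in> A} +
    (1 - p) * measure (percolation_measure p) {\<eta>. \<eta>(x := False) \<in> A})"
    by (intro continuous_intros insert.IH determined_by_update insert.prems)
  moreover have "A \<in> sets (percolation_measure p)" for p
    using determined_by_sets[OF _ insert.prems] insert.hyps by simp
  ultimately show ?case
    by (subst continuous_on_cong[OF refl prob_resample[of _ A x]]) auto
qed

section \<open>Independence, positive correlation and filling at a fixed parameter\<close>

locale site_percolation =
  fixes p :: real
  assumes p_nonneg: "0 \<le> p" and p_le_1: "p \<le> 1"
begin

abbreviation "P \<equiv> measure (percolation_measure p)"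
abbreviation "events \<equiv> sets (percolation_measure p)"

lemma prob_Compl: "A \<in> events \<Longrightarrow> P (- A) = 1 - P A"
  using percolation.prob_compl[of A p] by (simp add: Compl_eq_Diff_UNIV)

lemma resample:
  "A \<in> events \<Longrightarrow> P A = p * P {\<eta>. \<eta>(x := True) \<in> A} + (1 - p) * P {\<eta>. \<eta>(x := False) \<in> A}"
  by (rule prob_resample[OF p_nonneg p_le_1])

lemma indep_determined:
  assumes "finite J" "determined_by J A" "determined_by K B" "J \<inter> K = {}" "B \<in> events"
  shows "P (A \<inter> B) = P A * P B"
  using assms
proof (induction J arbitrary: A rule: finite_induct)
  case empty
  then show ?case using determined_by_empty percolation.prob_space[of p] by fastforce
next
  case (insert x J)
  have A: "A \<in> events" using insert determined_by_sets[of "insert x J" A] by auto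
  have eq: "{\<eta>. \<eta>(x := b) \<in> A \<inter> B} = {\<eta>. \<eta>(x := b) \<in> A} \<inter> B" for b
  proof -
    have "\<eta>(x := b) \<in> B \<longleftrightarrow> \<eta> \<in> B" for \<eta>
      using insert.prems(3) by (intro determined_byD[OF insert.prems(2)]) auto
    then show ?thesis by auto
  qed
  have IH: "P ({\<eta>. \<eta>(x := b) \<in> A} \<inter> B) = P {\<eta>. \<eta>(x := b) \<in> A} * P B" for b
    using insert.prems by (intro insert.IH determined_by_update) auto
  have "P (A \<inter> B) = p * P {\<eta>. \<eta>(x := True) \<in> A \<inter> B} + (1 - p) * P {\<eta>. \<eta>(x := False) \<in> A \<inter> B}"
    by (rule resample) (use A insert.prems in auto)
  also have "\<dots> = P A * P B"
    unfolding eq IH resample[OF A, of x] by (simp add: algebra_simps)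
  finally show ?case .
qed

text \<open>Given the state of \<open>x\<close>, the induction hypothesis bounds the intersection
  from below. What remains is Chebyshev's inequality: two increasing functions of one Bernoulli
  variable are positively correlated.\<close>

lemma Harris:
  assumes "finite J" "determined_by J A" "determined_by J B" "increasing A" "increasing B"
  shows "P A * P B \<le> P (A \<inter> B)"
  using assms
proof (induction J arbitrary: A B rule: finite_induct)
  case empty
  then show ?case using determined_by_empty[of A] determined_by_empty[of B] percolation.prob_space[of p] by auto
next
  case (insert x J)
  have A: "A \<in> events" and B: "B \<in> events" and AB: "A \<inter> B \<in> events"
    using insert determined_by_sets[of "insert x J"] by auto
  define a where "a b = P {\<eta>. \<eta>(x := b) \<in> A}" for b
  define c where "c b = P {\<eta>. \<eta>(x := b) \<in> B}" for b
  have IH: "a b * c b \<le> P {\<eta>. \<eta>(x := b) \<in> A \<inter> B}" for b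
  proof -
    have "a b * c b \<le> P ({\<eta>. \<eta>(x := b) \<in> A} \<inter> {\<eta>. \<eta>(x := b) \<in> B})"
      unfolding a_def c_def using insert.prems
      by (intro insert.IH determined_by_update increasing_update) auto
    then show ?thesis by (simp add: Int_def)
  qed
  have mono: "P {\<eta>. \<eta>(x := False) \<in> C} \<le> P {\<eta>. \<eta>(x := True) \<in> C}" if "increasing C" "C \<in> events" for C
  proof (rule percolation.finite_measure_mono)
    show "{\<eta>. \<eta>(x := False) \<in> C} \<subseteq> {\<eta>. \<eta>(x := True) \<in> C}"
      using that(1) unfolding increasing_def by (smt (verit) Collect_mono fun_upd_apply)
  qed (rule sets_percolation_update[OF that(2)])
  have ac: "0 \<le> (a True - a False) * (c True - c False)"
    using mono[of A] mono[of B] insert.prems A B unfolding a_def c_def by (intro mult_nonneg_nonneg) auto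
  \<comment> \<open>The right-hand side is the covariance of the conditional probabilities
    \<open>a\<close> and \<open>c\<close> under the state of \<open>x\<close>.\<close>
  then have "0 \<le> p * (1 - p) * ((a True - a False) * (c True - c False))"
    using p_nonneg p_le_1 by (intro mult_nonneg_nonneg[OF _ ac] mult_nonneg_nonneg) auto
  then have "P A * P B \<le> p * (a True * c True) + (1 - p) * (a False * c False)"
    unfolding resample[OF A, of x] resample[OF B, of x] a_def[symmetric] c_def[symmetric]
    by (simp add: algebra_simps)
  also have "\<dots> \<le> P (A \<inter> B)"
    unfolding resample[OF AB, of x] using IH p_nonneg p_le_1 by (intro add_mono mult_left_mono) auto
  finally show ?case .
qed

text \<open>By Harris, \<open>(1 - P A) * (1 - P B)\<close> is at most the probability that both
  events fail, hence at most the square of \<open>e\<close>. If one factor exceeds \<open>e\<close>,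
  the other one is at most \<open>e\<close>.\<close>

lemma sqrt_trick:
  assumes J: "finite J" "determined_by J A" "determined_by J B" "increasing A" "increasing B"
    and e: "1 - e\<^sup>2 \<le> P (A \<union> B)" "0 \<le> e" and lt: "P A < 1 - e"
  shows "1 - e \<le> P B"
proof (rule ccontr)
  assume "\<not> ?thesis"
  then have "e * e < (1 - P A) * (1 - P B)" using lt e(2) by (intro mult_strict_mono) auto
  moreover have "A \<in> events" "B \<in> events" using J determined_by_sets by auto
  then have "P (A \<union> B) = P A + P B - P (A \<inter> B)"
    by (simp add: percolation.finite_measure_Union' percolation.finite_measure_Diff' Int_commute)
  ultimately show False using Harris[OF J] e(1) by (simp add: algebra_simps power2_eq_square)
qed

lemma fill_site: "A \<in> events \<Longrightarrow> p * P {\<eta>. \<eta>(x := True) \<in> A} \<le> P A"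
  using resample[of A x] p_le_1 by (simp add: measure_nonneg)

text \<open>Insertion tolerance: the sites of \<open>J\<close> are occupied anyway with probability
  \<open>p ^ card J\<close>, independently of all others. It is used backwards for
  \<open>0 < p\<close>: a null event remains null when a box is filled before testing it.\<close>

lemma fill_sets:
  assumes "finite J" "A \<in> events"
  shows "{\<eta>. (\<lambda>x. x \<in> J \<or> \<eta> x) \<in> A} \<in> events \<and> p ^ card J * P {\<eta>. (\<lambda>x. x \<in> J \<or> \<eta> x) \<in> A} \<le> P A"
  using assms
proof (induction J arbitrary: A rule: finite_induct)
  case empty
  then show ?case by simp
next
  case (insert x J)
  let ?A = "{\<eta>. \<eta>(x := True) \<in> A}"
  have A: "?A \<in> events" using insert.prems by (rule sets_percolation_update)
  have eq: "{\<eta>. (\<lambda>y. y \<in> insert x J \<or> \<eta> y) \<in> A} = {\<eta>. (\<lambda>y. y \<in> J \<or> \<eta> y) \<in> ?A}"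
  proof -
    have "(\<lambda>y. y \<in> insert x J \<or> \<eta> y) = (\<lambda>y. y \<in> J \<or> \<eta> y)(x := True)" for \<eta> by auto
    then show ?thesis by simp
  qed
  note IH = insert.IH[OF A]
  have "p ^ card (insert x J) * P {\<eta>. (\<lambda>y. y \<in> J \<or> \<eta> y) \<in> ?A} =
      p * (p ^ card J * P {\<eta>. (\<lambda>y. y \<in> J \<or> \<eta> y) \<in> ?A})" using insert.hyps by simp
  also have "\<dots> \<le> p * P ?A" using IH p_nonneg by (intro mult_left_mono) auto
  also have "\<dots> \<le> P A" by (rule fill_site[OF insert.prems])
  finally show ?case unfolding eq using IH by auto
qed

lemma reindex:
  assumes "bij f" "A \<in> events"
  shows "{\<eta>. \<eta> \<circ> f \<in> A} \<in> events" "P {\<eta>. \<eta> \<circ> f \<in> A} = P A"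
proof -
  have d: "distr (percolation_measure p) (percolation_measure p) (\<lambda>\<eta>. \<eta> \<circ> f) = percolation_measure p"
    using distr_PiM_reindex[of UNIV "\<lambda>_. measure_pmf (bernoulli_pmf p)" f UNIV] assms(1)
    by (simp add: percolation_measure_def measure_pmf.prob_space_axioms bij_is_inj comp_def restrict_def)
  have m: "(\<lambda>\<eta>. \<eta> \<circ> f) \<in> measurable (percolation_measure p) (percolation_measure p)"
    unfolding percolation_measure_def comp_def by (rule measurable_PiM_single') auto
  show "{\<eta>. \<eta> \<circ> f \<in> A} \<in> events" using measurable_sets[OF m assms(2)] by (simp add: vimage_def)
  show "P {\<eta>. \<eta> \<circ> f \<in> A} = P A"
    using measure_distr[OF m assms(2)] unfolding d by (simp add: vimage_def)
qed

text \<open>The events that can be approximated in measure by events of finitely many sites form a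
  sigma algebra: complementation does not change a symmetric difference, and a countable union is
  close to a finite one. It contains the single-site events, which generate everything.\<close>

lemma approximation:
  assumes "A \<in> events" "0 < e"
  shows "\<exists>J C. finite J \<and> determined_by J C \<and> P (sym_diff A C) < e"
proof -
  let ?G = "{{f \<in> \<Pi>\<^sub>E i\<in>UNIV. space (measure_pmf (bernoulli_pmf p)). f i \<in> A} |i A. i \<in> UNIV \<and> A \<in> sets (measure_pmf (bernoulli_pmf p))} :: configuration set set"
  have ev: "events = sigma_sets UNIV ?G"
    unfolding percolation_measure_def sets_PiM_single by (simp add: PiE_def)
  have "A \<in> sigma_sets UNIV ?G" using assms(1) ev by simp
  then have "A \<in> events \<and> (\<forall>e>0. \<exists>J C. finite J \<and> determined_by J C \<and> P (sym_diff A C) < e)"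
  proof (induction rule: sigma_sets.induct)
    case (Basic a)
    then obtain i B where a: "a = {f. f i \<in> B}" by (auto simp: PiE_def)
    have "determined_by {i} a" unfolding a determined_by_def by auto
    moreover have "a \<in> events" using ev Basic by auto
    ultimately show ?case by (auto intro!: exI[of _ "{i}"] exI[of _ a])
  next
    case Empty
    show ?case by (auto intro!: exI[of _ "{}"] simp: determined_by_def)
  next
    case (Compl a)
    have "sym_diff (UNIV - a) (- C) = sym_diff a C" for C by auto
    then show ?case using Compl.IH determined_by_Compl by (metis Compl_eq_Diff_UNIV sets.compl_sets space_percolation_measure)
  next
    case (Union a)
    have a: "a i \<in> events" for i using Union.IH by blast
    have U: "(\<Union>i. a i) \<in> events" using a by auto
    have "\<exists>J C. finite J \<and> determined_by J C \<and> P (sym_diff (\<Union>i. a i) C) < e" if "e > 0" for e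
    proof -
      have "(\<lambda>n. P (\<Union>i\<le>n. a i)) \<longlonglongrightarrow> P (\<Union>n. \<Union>i\<le>n. a i)"
        by (rule percolation.finite_Lim_measure_incseq) (use a in \<open>auto simp: incseq_def, blast intro: le_trans\<close>)
      moreover have "(\<Union>n. \<Union>i\<le>n. a i) = (\<Union>i. a i)" by auto
      ultimately have "\<forall>\<^sub>F n in sequentially. P (\<Union>i. a i) - e / 2 < P (\<Union>i\<le>n. a i)"
        using \<open>e > 0\<close> by (simp add: order_tendsto_iff)
      then obtain n where n: "P (\<Union>i. a i) - e / 2 < P (\<Union>i\<le>n. a i)"
        using eventually_happens trivial_limit_sequentially by blast
      \<comment> \<open>Half of \<open>e\<close> pays for the tail of the union, the other half for
        the \<open>n + 1\<close> approximations.\<close>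
      define d where "d = e / (2 * (real n + 1))"
      have "d > 0" using \<open>e > 0\<close> by (simp add: d_def)
      then obtain J C where JC: "\<And>i. finite (J i)" "\<And>i. determined_by (J i) (C i)" "\<And>i. P (sym_diff (a i) (C i)) < d"
      proof -
        have "\<forall>i. \<exists>J C. finite J \<and> determined_by J C \<and> P (sym_diff (a i) C) < d"
          using Union.IH \<open>d > 0\<close> by blast
        then show ?thesis using that by metis
      qed
      have C: "C i \<in> events" for i using JC determined_by_sets by blast
      let ?J = "\<Union>i\<le>n. J i" and ?C = "\<Union>i\<le>n. C i"
      have "P (sym_diff (\<Union>i. a i) ?C) \<le> P (((\<Union>i. a i) - (\<Union>i\<le>n. a i)) \<union> (\<Union>i\<le>n. sym_diff (a i) (C i)))"
        using a C by (intro percolation.finite_measure_mono) auto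
      also have "\<dots> \<le> P ((\<Union>i. a i) - (\<Union>i\<le>n. a i)) + P (\<Union>i\<le>n. sym_diff (a i) (C i))"
        using a C by (intro measure_Un_le) auto
      also have "P ((\<Union>i. a i) - (\<Union>i\<le>n. a i)) = P (\<Union>i. a i) - P (\<Union>i\<le>n. a i)"
        using a by (intro percolation.finite_measure_Diff) auto
      also have "P (\<Union>i\<le>n. sym_diff (a i) (C i)) \<le> (\<Sum>i\<le>n. P (sym_diff (a i) (C i)))"
        using a C by (intro percolation.finite_measure_subadditive_finite) auto
      also have "\<dots> \<le> (\<Sum>i\<le>n. d)" using JC(3) by (intro sum_mono) (simp add: less_imp_le)
      also have "\<dots> = e / 2" by (simp add: d_def field_simps)
      finally have "P (sym_diff (\<Union>i. a i) ?C) < e" using n by simp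
      moreover have "determined_by ?J ?C" using JC(2) by (intro determined_by_UN) (blast intro: determined_by_mono)
      moreover have "finite ?J" using JC(1) by simp
      ultimately show ?thesis by blast
    qed
    then show ?case using U by blast
  qed
  then show ?thesis using assms(2) by blast
qed

text \<open>Ergodicity by mixing: if \<open>C\<close> approximates \<open>A\<close> and depends on
  finitely many sites, then by invariance a far translate \<open>D\<close> of \<open>C\<close>
  approximates \<open>A\<close> too, and it is independent of \<open>C\<close>. So
  \<open>P A\<close> is close to \<open>P (C \<inter> D) = P C * P C\<close>, which is close to
  \<open>P A * P A\<close>.\<close>

lemma translation_invariant_0_1:
  assumes A: "A \<in> events" and inv: "\<And>v \<eta>. \<eta> \<in> A \<Longrightarrow> \<eta> \<circ> ((+) v) \<in> A"
  shows "P A = 0 \<or> P A = 1"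
proof -
  have inv': "\<eta> \<circ> ((+) v) \<in> A \<longleftrightarrow> \<eta> \<in> A" for v \<eta>
    using inv[of \<eta> v] inv[of "\<eta> \<circ> (+) v" "- v"] by (auto simp: comp_def)
  have "\<bar>P A - P A * P A\<bar> \<le> e" if "e > 0" for e
  proof -
    obtain J C where J: "finite J" and C: "determined_by J C" and PC: "P (sym_diff A C) < e / 4"
      using approximation[OF A, of "e / 4"] \<open>e > 0\<close> by auto
    have Cev: "C \<in> events" using J C determined_by_sets by blast
    obtain m where m: "\<And>x. x \<in> J \<Longrightarrow> \<bar>fst x\<bar> \<le> m"
    proof (cases "J = {}")
      case False
      show ?thesis using J False by (intro that[of "Max ((\<lambda>x. \<bar>fst x\<bar>) ` J)"]) auto
    qed (auto intro: that)
    \<comment> \<open>Longer than the horizontal extent of \<open>J\<close>, so that the translate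
      of \<open>J\<close> misses \<open>J\<close>.\<close>
    define v :: site where "v = (2 * \<bar>m\<bar> + 1, 0)"
    define D where "D = {\<eta>. \<eta> \<circ> ((+) v) \<in> C}"
    have bv: "bij ((+) v)" by simp
    have D: "D \<in> events" "P D = P C" unfolding D_def using reindex[OF bv Cev] by auto
    have detD: "determined_by ((+) v ` J) D"
      using C unfolding D_def determined_by_def by (auto simp: comp_def)
    have disj: "J \<inter> (+) v ` J = {}"
    proof -
      have "v + x \<notin> J" if "x \<in> J" for x
        using m[of x] m[of "v + x"] that by (auto simp: v_def)
      then show ?thesis by blast
    qed
    have CD: "P (C \<inter> D) = P C * P D" by (rule indep_determined[OF J C detD disj D(1)])
    have sd: "{\<eta>. \<eta> \<circ> ((+) v) \<in> sym_diff A C} = sym_diff A D" unfolding D_def using inv' by auto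
    have SD: "P (sym_diff A D) < e / 4" using reindex(2)[OF bv, of "sym_diff A C"] A Cev PC unfolding sd by auto
    have diff: "\<bar>P X - P Y\<bar> \<le> P (sym_diff X Y)" if "X \<in> events" "Y \<in> events" for X Y
    proof -
      have "P X \<le> P (Y \<union> sym_diff X Y)" "P Y \<le> P (X \<union> sym_diff X Y)"
        using that by (auto intro!: percolation.finite_measure_mono)
      moreover have "P (Y \<union> sym_diff X Y) \<le> P Y + P (sym_diff X Y)" "P (X \<union> sym_diff X Y) \<le> P X + P (sym_diff X Y)"
        using that by (auto intro!: measure_Un_le)
      ultimately show ?thesis by linarith
    qed
    have "P (sym_diff A (C \<inter> D)) \<le> P (sym_diff A C \<union> sym_diff A D)"
      using A Cev D by (intro percolation.finite_measure_mono) auto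
    also have "\<dots> \<le> P (sym_diff A C) + P (sym_diff A D)"
      using A Cev D by (intro measure_Un_le) auto
    finally have 1: "\<bar>P A - P C * P C\<bar> < e / 2" using diff[of A "C \<inter> D"] A Cev D PC SD CD by auto
    have "\<bar>P A - P C\<bar> \<le> e / 4" using diff[of A C] A Cev PC by auto
    moreover have "\<bar>P A + P C\<bar> \<le> 2" using percolation.prob_le_1[of p A] percolation.prob_le_1[of p C] measure_nonneg[of "percolation_measure p" A] measure_nonneg[of "percolation_measure p" C] by arith
    ultimately have "\<bar>P A - P C\<bar> * \<bar>P A + P C\<bar> \<le> e / 4 * 2" using \<open>e > 0\<close> by (intro mult_mono) auto
    then have "\<bar>P A * P A - P C * P C\<bar> \<le> e / 2" unfolding abs_mult[symmetric] by (simp add: algebra_simps)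
    then show ?thesis using 1 by linarith
  qed
  then have "\<bar>P A - P A * P A\<bar> \<le> 0" by (rule field_le_epsilon[of _ 0, simplified])
  then have "P A * (1 - P A) = 0" by (simp add: algebra_simps)
  then show ?thesis by simp
qed

end

section \<open>Connected lattice sets\<close>

text \<open>Connection inside an arbitrary set of sites, so that restricting paths to a box is just
  an intersection. Membership of \<open>x\<close> is demanded because the reflexive closure would
  join a vacant site to itself.\<close>

definition joined :: "site set \<Rightarrow> site \<Rightarrow> site \<Rightarrow> bool" where
  "joined S x y \<longleftrightarrow> x \<in> S \<and> (x, y) \<in> (occupied_edges (\<lambda>z. z \<in> S))\<^sup>*"

lemma nearest_neighbours_sym: "nearest_neighbours x y \<Longrightarrow> nearest_neighbours y x"
  by (auto simp: nearest_neighbours_def abs_minus_commute)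

lemma joined_refl: "x \<in> S \<Longrightarrow> joined S x x"
  by (simp add: joined_def)

lemma joined_step:
  assumes "joined S x y" "nearest_neighbours y z" "z \<in> S"
  shows "joined S x z"
proof -
  have "y \<in> S" using assms(1) unfolding joined_def
    by (auto elim: rtranclE simp: occupied_edges_def)
  then show ?thesis using assms unfolding joined_def
    by (auto intro: rtrancl_into_rtrancl simp: occupied_edges_def)
qed

lemma joined_induct [consumes 1, case_names refl step]:
  assumes "joined S x y" "x \<in> S \<Longrightarrow> Q x"
    and "\<And>y z. joined S x y \<Longrightarrow> Q y \<Longrightarrow> nearest_neighbours y z \<Longrightarrow> z \<in> S \<Longrightarrow> Q z"
  shows "Q y"
proof -
  have "x \<in> S" "(x, y) \<in> (occupied_edges (\<lambda>z. z \<in> S))\<^sup>*" using assms(1) by (auto simp: joined_def)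
  from this(2) show ?thesis
  proof (induction rule: rtrancl_induct)
    case (step y z)
    then show ?case using assms(3)[of y z] \<open>x \<in> S\<close> by (auto simp: joined_def occupied_edges_def)
  qed (rule assms(2)[OF \<open>x \<in> S\<close>])
qed

lemma joined_in: "joined S x y \<Longrightarrow> x \<in> S \<and> y \<in> S"
  by (induction rule: joined_induct) auto

lemma joined_trans: "joined S x y \<Longrightarrow> joined S y z \<Longrightarrow> joined S x z"
  by (auto simp: joined_def)

lemma joined_sym: "joined S x y \<Longrightarrow> joined S y x"
proof (induction rule: joined_induct)
  case (step y z)
  then have "joined S z y"
    by (meson joined_in joined_refl joined_step nearest_neighbours_sym)
  then show ?case using step joined_trans by blast
qed (rule joined_refl)

lemma joined_mono: "joined S x y \<Longrightarrow> S \<subseteq> T \<Longrightarrow> joined T x y"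
  by (induction rule: joined_induct) (blast intro: joined_step joined_refl)+

lemma joined_cluster: "joined S x y \<Longrightarrow> joined {z. joined S x z} x y"
  by (induction rule: joined_induct) (blast intro: joined_step joined_refl)+

lemma joined_image:
  assumes "\<And>x y. nearest_neighbours x y \<Longrightarrow> nearest_neighbours (f x) (f y)"
  shows "joined S x y \<Longrightarrow> joined (f ` S) (f x) (f y)"
  by (induction rule: joined_induct) (blast intro: joined_step joined_refl assms)+

lemma joined_exit:
  assumes "joined S x y" "x \<in> B"
  obtains "joined (S \<inter> B) x y" | u v where "joined (S \<inter> B) x u" "nearest_neighbours u v" "v \<in> S" "v \<notin> B"
proof -
  have "joined (S \<inter> B) x y \<or> (\<exists>u v. joined (S \<inter> B) x u \<and> nearest_neighbours u v \<and> v \<in> S \<and> v \<notin> B)"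
    using assms(1)
  proof (induction rule: joined_induct)
    case refl
    then show ?case using assms joined_in joined_refl by blast
  next
    case (step y z)
    then show ?case by (metis IntI joined_step)
  qed
  then show ?thesis using that by blast
qed

lemma nearest_neighbours_coordinates:
  assumes "nearest_neighbours x y"
  shows "\<bar>fst x - fst y\<bar> \<le> 1" "\<bar>- snd x - - snd y\<bar> \<le> 1"
  using assms by (auto simp: nearest_neighbours_def)

text \<open>A height that changes by at most 1 along an edge cannot skip the level \<open>a\<close>:
  walk back from \<open>v\<close> and stop just before the path drops below it. With
  \<open>g = fst\<close> this shortens a horizontal crossing, with the negative of
  \<open>snd\<close> it cuts off the upper part of a vertical one.\<close>

lemma joined_truncate:
  fixes g :: "site \<Rightarrow> int"
  assumes g: "\<And>x y. nearest_neighbours x y \<Longrightarrow> \<bar>g x - g y\<bar> \<le> 1"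
    and "joined S u v" "g u \<le> a" "a \<le> g v"
  shows "\<exists>u'. g u' = a \<and> joined (S \<inter> {z. a \<le> g z}) u' v"
proof (rule joined_exit[OF joined_sym[OF assms(2)], of "{z. a \<le> g z}"])
  assume "joined (S \<inter> {z. a \<le> g z}) v u"
  from joined_sym[OF this] joined_in[OF this] show ?thesis using assms(3) by (intro exI[of _ u]) auto
next
  fix s t assume s: "joined (S \<inter> {z. a \<le> g z}) v s" and "nearest_neighbours s t" "t \<in> S" "t \<notin> {z. a \<le> g z}"
  then have "g s = a" using joined_in[OF s] g[of s t] by auto
  then show ?thesis using joined_sym[OF s] by blast
qed (use assms in auto)

section \<open>Crossing paths in the plane\<close>

definition plane_point :: "site \<Rightarrow> real ^ 2" where
  "plane_point x = vector [of_int (fst x), of_int (snd x)]"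

lemma plane_point_nth [simp]: "plane_point x $ 1 = of_int (fst x)" "plane_point x $ 2 = of_int (snd x)"
  by (simp_all add: plane_point_def)

definition lattice_segment :: "site \<Rightarrow> site \<Rightarrow> (real ^ 2) set" where
  "lattice_segment s t = closed_segment (plane_point s) (plane_point t)"

lemma in_lattice_segment:
  assumes "z \<in> lattice_segment s t" "s = t \<or> nearest_neighbours s t"
  shows "(z $ 2 = of_int (snd s) \<and> snd s = snd t \<and> \<bar>fst s - fst t\<bar> \<le> 1 \<and>
      of_int (min (fst s) (fst t)) \<le> z $ 1 \<and> z $ 1 \<le> of_int (max (fst s) (fst t))) \<or>
    (z $ 1 = of_int (fst s) \<and> fst s = fst t \<and> \<bar>snd s - snd t\<bar> \<le> 1 \<and>
      of_int (min (snd s) (snd t)) \<le> z $ 2 \<and> z $ 2 \<le> of_int (max (snd s) (snd t)))"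
proof -
  obtain u where u: "0 \<le> u" "u \<le> 1" "z = (1 - u) *\<^sub>R plane_point s + u *\<^sub>R plane_point t"
    using assms(1) by (auto simp: lattice_segment_def in_segment)
  then have z: "z $ 1 = (1 - u) * of_int (fst s) + u * of_int (fst t)"
    "z $ 2 = (1 - u) * of_int (snd s) + u * of_int (snd t)" by simp_all
  have between: "of_int (min a b) \<le> (1 - u) * of_int a + u * of_int b \<and>
      (1 - u) * of_int a + u * of_int b \<le> (of_int (max a b) :: real)" for a b :: int
  proof -
    have "(1 - u) * of_int (min a b) + u * of_int (min a b) \<le> (1 - u) * of_int a + u * of_int b"
      "(1 - u) * of_int a + u * of_int b \<le> (1 - u) * of_int (max a b) + u * of_int (max a b)"
      using u by (intro add_mono mult_left_mono; simp)+
    then show ?thesis by (simp add: algebra_simps)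
  qed
  have same: "(1 - u) * of_int a + u * of_int a = (of_int a :: real)" for a by (simp add: algebra_simps)
  have "(snd s = snd t \<and> \<bar>fst s - fst t\<bar> \<le> 1) \<or> (fst s = fst t \<and> \<bar>snd s - snd t\<bar> \<le> 1)"
    using assms(2) unfolding nearest_neighbours_def by auto
  then show ?thesis
  proof
    assume "snd s = snd t \<and> \<bar>fst s - fst t\<bar> \<le> 1"
    then show ?thesis using between[of "fst s" "fst t"] same[of "snd t"] z by auto
  next
    assume "fst s = fst t \<and> \<bar>snd s - snd t\<bar> \<le> 1"
    then show ?thesis using between[of "snd s" "snd t"] same[of "fst t"] z by auto
  qed
qed

lemma lattice_segments_meet:
  assumes "z \<in> lattice_segment s s'" "s = s' \<or> nearest_neighbours s s'"
    and "z \<in> lattice_segment t t'" "t = t' \<or> nearest_neighbours t t'"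
  shows "{s, s'} \<inter> {t, t'} \<noteq> {}"
proof -
  have le: "m \<le> n" if "of_int m \<le> r" "r \<le> (of_int n :: real)" for m n :: int and r :: real
    using order_trans[OF that] by simp
  have ll: "min a a' \<le> max b b'" "min b b' \<le> max a a'"
    if "of_int (min a a') \<le> r" "r \<le> of_int (max a a')" "of_int (min b b') \<le> r" "r \<le> (of_int (max b b') :: real)"
    for a a' b b' :: int and r :: real
    using le[OF that(1) that(4)] le[OF that(3) that(2)] by auto
  have pt: "min a a' \<le> b" "b \<le> max a a'"
    if "of_int (min a a') \<le> r" "r \<le> of_int (max a a')" "r = (of_int b :: real)"
    for a a' b :: int and r :: real
    using le[OF that(1)] le[OF _ that(2)] that(3) by auto
  obtain s1 s2 s1' s2' t1 t2 t1' t2' where s: "s = (s1, s2)" "s' = (s1', s2')" "t = (t1, t2)" "t' = (t1', t2')"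
    by (metis surj_pair)
  show ?thesis
    using in_lattice_segment[OF assms(1,2)] in_lattice_segment[OF assms(3,4)]
  proof (elim disjE conjE, unfold s fst_conv snd_conv)
    assume "z $ 2 = of_int s2" "s2 = s2'" "\<bar>s1 - s1'\<bar> \<le> 1" "of_int (min s1 s1') \<le> z $ 1" "z $ 1 \<le> of_int (max s1 s1')"
      "z $ 2 = of_int t2" "t2 = t2'" "\<bar>t1 - t1'\<bar> \<le> 1" "of_int (min t1 t1') \<le> z $ 1" "z $ 1 \<le> of_int (max t1 t1')"
    then show "{(s1, s2), (s1', s2')} \<inter> {(t1, t2), (t1', t2')} \<noteq> {}"
      using ll[of s1 s1' "z $ 1" t1 t1'] by (auto simp: min_def max_def split: if_splits)
  next
    assume "z $ 1 = of_int s1" "s1 = s1'" "\<bar>s2 - s2'\<bar> \<le> 1" "of_int (min s2 s2') \<le> z $ 2" "z $ 2 \<le> of_int (max s2 s2')"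
      "z $ 1 = of_int t1" "t1 = t1'" "\<bar>t2 - t2'\<bar> \<le> 1" "of_int (min t2 t2') \<le> z $ 2" "z $ 2 \<le> of_int (max t2 t2')"
    then show "{(s1, s2), (s1', s2')} \<inter> {(t1, t2), (t1', t2')} \<noteq> {}"
      using ll[of s2 s2' "z $ 2" t2 t2'] by (auto simp: min_def max_def split: if_splits)
  next
    assume "z $ 2 = of_int s2" "s2 = s2'" "\<bar>s1 - s1'\<bar> \<le> 1" "of_int (min s1 s1') \<le> z $ 1" "z $ 1 \<le> of_int (max s1 s1')"
      "z $ 1 = of_int t1" "t1 = t1'" "\<bar>t2 - t2'\<bar> \<le> 1" "of_int (min t2 t2') \<le> z $ 2" "z $ 2 \<le> of_int (max t2 t2')"
    then have "min s1 s1' \<le> t1" "t1 \<le> max s1 s1'" "min t2 t2' \<le> s2" "s2 \<le> max t2 t2'"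
      using pt[of s1 s1' "z $ 1" t1] pt[of t2 t2' "z $ 2" s2] by simp_all
    with \<open>s2 = s2'\<close> \<open>t1 = t1'\<close> \<open>\<bar>s1 - s1'\<bar> \<le> 1\<close> \<open>\<bar>t2 - t2'\<bar> \<le> 1\<close>
    have "(t1 = s1 \<or> t1 = s1') \<and> (s2 = t2 \<or> s2 = t2')" by linarith
    with \<open>s2 = s2'\<close> \<open>t1 = t1'\<close> show "{(s1, s2), (s1', s2')} \<inter> {(t1, t2), (t1', t2')} \<noteq> {}" by auto
  next
    assume "z $ 1 = of_int s1" "s1 = s1'" "\<bar>s2 - s2'\<bar> \<le> 1" "of_int (min s2 s2') \<le> z $ 2" "z $ 2 \<le> of_int (max s2 s2')"
      "z $ 2 = of_int t2" "t2 = t2'" "\<bar>t1 - t1'\<bar> \<le> 1" "of_int (min t1 t1') \<le> z $ 1" "z $ 1 \<le> of_int (max t1 t1')"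
    then have "min s2 s2' \<le> t2" "t2 \<le> max s2 s2'" "min t1 t1' \<le> s1" "s1 \<le> max t1 t1'"
      using pt[of s2 s2' "z $ 2" t2] pt[of t1 t1' "z $ 1" s1] by simp_all
    with \<open>s1 = s1'\<close> \<open>t2 = t2'\<close> \<open>\<bar>s2 - s2'\<bar> \<le> 1\<close> \<open>\<bar>t1 - t1'\<bar> \<le> 1\<close>
    have "(t2 = s2 \<or> t2 = s2') \<and> (s1 = t1 \<or> s1 = t1')" by linarith
    with \<open>s1 = s1'\<close> \<open>t2 = t2'\<close> show "{(s1, s2), (s1', s2')} \<inter> {(t1, t2), (t1', t2')} \<noteq> {}" by auto
  qed
qed

definition lattice_drawing :: "site set \<Rightarrow> (real ^ 2) set" where
  "lattice_drawing S = (\<Union>s\<in>S. \<Union>t\<in>{t\<in>S. s = t \<or> nearest_neighbours s t}. lattice_segment s t)"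

lemma lattice_drawings_meet:
  "z \<in> lattice_drawing S \<Longrightarrow> z \<in> lattice_drawing T \<Longrightarrow> S \<inter> T \<noteq> {}"
  unfolding lattice_drawing_def using lattice_segments_meet by blast

lemma plane_point_in_drawing: "s \<in> S \<Longrightarrow> plane_point s \<in> lattice_drawing S"
  unfolding lattice_drawing_def lattice_segment_def by (metis (mono_tags, lifting) UN_I ends_in_segment(1) mem_Collect_eq)

lemma lattice_drawing_bounds:
  assumes "z \<in> lattice_drawing S"
  shows "(\<And>s. s \<in> S \<Longrightarrow> a \<le> fst s \<and> fst s \<le> b) \<Longrightarrow> of_int a \<le> z $ 1 \<and> z $ 1 \<le> of_int b"
    and "(\<And>s. s \<in> S \<Longrightarrow> a \<le> snd s \<and> snd s \<le> b) \<Longrightarrow> of_int a \<le> z $ 2 \<and> z $ 2 \<le> of_int b"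
proof -
  obtain s t where st: "s \<in> S" "t \<in> S" "s = t \<or> nearest_neighbours s t" "z \<in> lattice_segment s t"
    using assms by (auto simp: lattice_drawing_def)
  have le: "of_int a \<le> r \<and> r \<le> of_int b" if "of_int m \<le> r" "r \<le> of_int n" "a \<le> m" "n \<le> b" for m n :: int and r :: real
    using that by (meson of_int_le_iff order_trans)
  show "of_int a \<le> z $ 1 \<and> z $ 1 \<le> of_int b" if "\<And>s. s \<in> S \<Longrightarrow> a \<le> fst s \<and> fst s \<le> b"
    using in_lattice_segment[OF st(4,3)] that[OF st(1)] that[OF st(2)]
      le[of "min (fst s) (fst t)" "z $ 1" "max (fst s) (fst t)"] by auto
  show "of_int a \<le> z $ 2 \<and> z $ 2 \<le> of_int b" if "\<And>s. s \<in> S \<Longrightarrow> a \<le> snd s \<and> snd s \<le> b"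
    using in_lattice_segment[OF st(4,3)] that[OF st(1)] that[OF st(2)]
      le[of "min (snd s) (snd t)" "z $ 2" "max (snd s) (snd t)"] by auto
qed

lemma joined_path:
  assumes "joined S x y"
  shows "\<exists>g. path g \<and> pathstart g = plane_point x \<and> pathfinish g = plane_point y \<and> path_image g \<subseteq> lattice_drawing S"
  using assms
proof (induction rule: joined_induct)
  case refl
  show ?case
    using plane_point_in_drawing[OF refl]
    by (intro exI[of _ "linepath (plane_point x) (plane_point x)"])
      (auto simp del: linepath_refl simp: linepath_def path_def pathstart_def pathfinish_def path_image_def)
next
  case (step y z)
  then obtain g where "path g" "pathstart g = plane_point x" "pathfinish g = plane_point y" "path_image g \<subseteq> lattice_drawing S"
    by blast
  moreover have "closed_segment (plane_point y) (plane_point z) \<subseteq> lattice_drawing S"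
    using step joined_in unfolding lattice_drawing_def lattice_segment_def by blast
  ultimately show ?case
    by (intro exI[of _ "g +++ linepath (plane_point y) (plane_point z)"])
       (auto simp: path_image_join)
qed

text \<open>\<open>fashoda\<close> concerns curves that run from side to side of one common box.
  Both curves are therefore prolonged by straight segments to the boundary of a large box. The
  meeting point is confined to the rectangle \<open>{a..b}\<close> times \<open>{c..d}\<close>, and
  the added segments can touch it only in ends of the original curves, so the meeting point lies on
  both drawings.\<close>

lemma crossing:
  assumes S: "joined S u v" "\<And>s. s \<in> S \<Longrightarrow> c \<le> snd s \<and> snd s \<le> d" "fst u \<le> a" "b \<le> fst v"
    and T: "joined T u' v'" "\<And>t. t \<in> T \<Longrightarrow> a \<le> fst t \<and> fst t \<le> b" "snd u' \<le> c" "d \<le> snd v'"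
  shows "S \<inter> T \<noteq> {}"
proof -
  obtain f where f: "path f" "pathstart f = plane_point u" "pathfinish f = plane_point v" "path_image f \<subseteq> lattice_drawing S"
    using joined_path[OF S(1)] by blast
  obtain g where g: "path g" "pathstart g = plane_point u'" "pathfinish g = plane_point v'" "path_image g \<subseteq> lattice_drawing T"
    using joined_path[OF T(1)] by blast
  obtain r where r: "\<And>z. z \<in> path_image f \<union> path_image g \<Longrightarrow> norm z \<le> r"
    using bounded_path_image[OF f(1)] bounded_path_image[OF g(1)] by (meson bounded_Un bounded_iff)
  have rz: "- r \<le> z $ 1 \<and> z $ 1 \<le> r \<and> - r \<le> z $ 2 \<and> z $ 2 \<le> r" if "z \<in> path_image f \<union> path_image g" for z
    using r[OF that] component_le_norm_cart[of z 1] component_le_norm_cart[of z 2] by (simp add: abs_le_iff)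
  have ends: "plane_point u \<in> path_image f" "plane_point v \<in> path_image f" "plane_point u' \<in> path_image g" "plane_point v' \<in> path_image g"
    using f g by (metis pathstart_in_path_image pathfinish_in_path_image)+
  define pt :: "real \<Rightarrow> real \<Rightarrow> real^2" where "pt x y = vector [x, y]" for x y
  have pt [simp]: "pt x y $ 1 = x" "pt x y $ 2 = y" for x y by (simp_all add: pt_def)
  let ?f = "linepath (pt (- r) (snd u)) (plane_point u) +++ f +++ linepath (plane_point v) (pt r (snd v))"
  let ?g = "linepath (pt (fst u') (- r)) (plane_point u') +++ g +++ linepath (plane_point v') (pt (fst v') r)"
  have seg: "z \<in> closed_segment s t \<Longrightarrow> (min (s $ i) (t $ i) \<le> z $ i \<and> z $ i \<le> max (s $ i) (t $ i))" for z s t :: "real^2" and i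
  proof -
    assume "z \<in> closed_segment s t"
    then obtain k where k: "0 \<le> k" "k \<le> 1" "z = (1 - k) *\<^sub>R s + k *\<^sub>R t" by (auto simp: in_segment)
    have "(1 - k) * min (s $ i) (t $ i) + k * min (s $ i) (t $ i) \<le> (1 - k) * (s $ i) + k * (t $ i)"
      "(1 - k) * (s $ i) + k * (t $ i) \<le> (1 - k) * max (s $ i) (t $ i) + k * max (s $ i) (t $ i)"
      using k by (intro add_mono mult_left_mono; simp)+
    moreover have "(1 - k) * c + k * c = c" for c by (simp add: algebra_simps)
    ultimately show ?thesis using k(3) by simp
  qed
  have imf: "path_image ?f = closed_segment (pt (- r) (snd u)) (plane_point u) \<union> path_image f \<union> closed_segment (plane_point v) (pt r (snd v))"
    using f by (simp add: path_image_join Un_assoc)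
  have img: "path_image ?g = closed_segment (pt (fst u') (- r)) (plane_point u') \<union> path_image g \<union> closed_segment (plane_point v') (pt (fst v') r)"
    using g by (simp add: path_image_join Un_assoc)
  have box: "z \<in> cbox (pt (- r) (- r)) (pt r r) \<longleftrightarrow> - r \<le> z $ 1 \<and> z $ 1 \<le> r \<and> - r \<le> z $ 2 \<and> z $ 2 \<le> r" for z
    by (auto simp: mem_box_cart forall_2)
  have "path ?f" "path ?g" using f g by auto
  moreover have "path_image ?f \<subseteq> cbox (pt (- r) (- r)) (pt r r)"
    unfolding imf
  proof (intro Un_least subsetI; unfold box)
    fix z assume "z \<in> closed_segment (pt (- r) (snd u)) (plane_point u)"
    then show "- r \<le> z $ 1 \<and> z $ 1 \<le> r \<and> - r \<le> z $ 2 \<and> z $ 2 \<le> r"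
      using seg[of z _ _ 1] seg[of z _ _ 2] rz[of "plane_point u"] ends by fastforce
  next
    fix z assume "z \<in> closed_segment (plane_point v) (pt r (snd v))"
    then show "- r \<le> z $ 1 \<and> z $ 1 \<le> r \<and> - r \<le> z $ 2 \<and> z $ 2 \<le> r"
      using seg[of z _ _ 1] seg[of z _ _ 2] rz[of "plane_point v"] ends by fastforce
  qed (use rz in auto)
  moreover have "path_image ?g \<subseteq> cbox (pt (- r) (- r)) (pt r r)"
    unfolding img
  proof (intro Un_least subsetI; unfold box)
    fix z assume "z \<in> closed_segment (pt (fst u') (- r)) (plane_point u')"
    then show "- r \<le> z $ 1 \<and> z $ 1 \<le> r \<and> - r \<le> z $ 2 \<and> z $ 2 \<le> r"
      using seg[of z _ _ 1] seg[of z _ _ 2] rz[of "plane_point u'"] ends by fastforce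
  next
    fix z assume "z \<in> closed_segment (plane_point v') (pt (fst v') r)"
    then show "- r \<le> z $ 1 \<and> z $ 1 \<le> r \<and> - r \<le> z $ 2 \<and> z $ 2 \<le> r"
      using seg[of z _ _ 1] seg[of z _ _ 2] rz[of "plane_point v'"] ends by fastforce
  qed (use rz in auto)
  ultimately obtain z where z: "z \<in> path_image ?f" "z \<in> path_image ?g"
    by (rule fashoda) auto
  note uv = joined_in[OF S(1)] and uv' = joined_in[OF T(1)]
  \<comment> \<open>The added horizontal segments stay at the heights of \<open>u\<close> and
    \<open>v\<close>, so the prolonged curve does not leave the strip. The same holds for the
    vertical segments below.\<close>
  have z2: "of_int c \<le> z $ 2 \<and> z $ 2 \<le> of_int d"
    using z(1) unfolding imf
  proof (elim UnE)
    assume "z \<in> closed_segment (pt (- r) (snd u)) (plane_point u)"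
    then show ?thesis using seg[of z _ _ 2] S(2)[of u] uv by fastforce
  next
    assume "z \<in> closed_segment (plane_point v) (pt r (snd v))"
    then show ?thesis using seg[of z _ _ 2] S(2)[of v] uv by fastforce
  qed (use f(4) lattice_drawing_bounds(2)[of z S c d] S(2) in blast)
  have z1: "of_int a \<le> z $ 1 \<and> z $ 1 \<le> of_int b"
    using z(2) unfolding img
  proof (elim UnE)
    assume "z \<in> closed_segment (pt (fst u') (- r)) (plane_point u')"
    then show ?thesis using seg[of z _ _ 1] T(2)[of u'] uv' by fastforce
  next
    assume "z \<in> closed_segment (plane_point v') (pt (fst v') r)"
    then show ?thesis using seg[of z _ _ 1] T(2)[of v'] uv' by fastforce
  qed (use g(4) lattice_drawing_bounds(1)[of z T a b] T(2) in blast)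
  have eqI: "z = plane_point s" if "z $ 1 = of_int (fst s)" "z $ 2 = of_int (snd s)" for s
    using that by (simp add: vec_eq_iff forall_2)
  have "z \<in> lattice_drawing S"
    using z(1) unfolding imf
  proof (elim UnE)
    assume z: "z \<in> closed_segment (pt (- r) (snd u)) (plane_point u)"
    have "z $ 2 = of_int (snd u)" "z $ 1 \<le> of_int (fst u)"
      using seg[OF z, of 1] seg[OF z, of 2] rz[of "plane_point u"] ends by auto
    moreover have "of_int (fst u) \<le> z $ 1" using z1 S(3) by linarith
    ultimately have "z = plane_point u" by (intro eqI) auto
    then show ?thesis using plane_point_in_drawing uv by blast
  next
    assume z: "z \<in> closed_segment (plane_point v) (pt r (snd v))"
    have "z $ 2 = of_int (snd v)" "of_int (fst v) \<le> z $ 1"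
      using seg[OF z, of 1] seg[OF z, of 2] rz[of "plane_point v"] ends by auto
    moreover have "z $ 1 \<le> of_int (fst v)" using z1 S(4) by linarith
    ultimately have "z = plane_point v" by (intro eqI) auto
    then show ?thesis using plane_point_in_drawing uv by blast
  qed (use f(4) in blast)
  moreover have "z \<in> lattice_drawing T"
    using z(2) unfolding img
  proof (elim UnE)
    assume z: "z \<in> closed_segment (pt (fst u') (- r)) (plane_point u')"
    have "z $ 1 = of_int (fst u')" "z $ 2 \<le> of_int (snd u')"
      using seg[OF z, of 1] seg[OF z, of 2] rz[of "plane_point u'"] ends by auto
    moreover have "of_int (snd u') \<le> z $ 2" using z2 T(3) by linarith
    ultimately have "z = plane_point u'" by (intro eqI) auto
    then show ?thesis using plane_point_in_drawing uv' by blast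
  next
    assume z: "z \<in> closed_segment (plane_point v') (pt (fst v') r)"
    have "z $ 1 = of_int (fst v')" "of_int (snd v') \<le> z $ 2"
      using seg[OF z, of 1] seg[OF z, of 2] rz[of "plane_point v'"] ends by auto
    moreover have "z $ 2 \<le> of_int (snd v')" using z2 T(4) by linarith
    ultimately have "z = plane_point v'" by (intro eqI) auto
    then show ?thesis using plane_point_in_drawing uv' by blast
  qed (use g(4) in blast)
  ultimately show ?thesis by (rule lattice_drawings_meet)
qed

section \<open>Paths that meet at a side of a box\<close>

lemma joined_column:
  assumes "y1 \<le> y2" "\<And>y. y1 \<le> y \<Longrightarrow> y \<le> y2 \<Longrightarrow> (x, y) \<in> S"
  shows "joined S (x, y1) (x, y2)"
  using assms
proof (induction y2 rule: int_ge_induct)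
  case base
  then show ?case by (auto intro: joined_refl)
next
  case (step y)
  then have "joined S (x, y1) (x, y)" by auto
  then show ?case by (rule joined_step) (use step in \<open>auto simp: nearest_neighbours_def\<close>)
qed

text \<open>Reduces to \<open>crossing\<close> by leaving the half plane: \<open>H\<close> is continued one step beyond the line
  \<open>x = R\<close>, and \<open>X\<close> by two half-columns on \<open>x = R + 1\<close> that avoid \<open>(R + 1, w)\<close>.\<close>

lemma window_crossing:
  assumes X: "joined X (R, y1) (R, y2)" "\<And>s. s \<in> X \<Longrightarrow> L \<le> fst s \<and> fst s \<le> R"
    and H: "joined H u (R, w)" "fst u \<le> L" "\<And>s. s \<in> H \<Longrightarrow> fst s \<le> R" "\<And>s. s \<in> H \<Longrightarrow> c \<le> snd s \<and> snd s \<le> d"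
    and w: "y2 \<le> w" "w \<le> y1"
  shows "H \<inter> X \<noteq> {}"
proof (cases "w = y1 \<or> w = y2")
  case True
  then show ?thesis using joined_in[OF X(1)] joined_in[OF H(1)] by blast
next
  case False
  \<comment> \<open>\<open>max\<close> and \<open>min\<close> keep the half-columns nonempty when
    \<open>y1\<close> lies above \<open>d\<close> or \<open>y2\<close> below \<open>c\<close>. They
    avoid \<open>(R + 1, w)\<close> since \<open>w\<close> is now strictly between \<open>y2\<close>
    and \<open>y1\<close>.\<close>
  let ?up = "{(R + 1, y) |y. y1 \<le> y \<and> y \<le> max d y1}" and ?down = "{(R + 1, y) |y. min c y2 \<le> y \<and> y \<le> y2}"
  let ?T = "X \<union> ?up \<union> ?down" and ?S = "insert (R + 1, w) H"
  have "joined ?S u (R + 1, w)"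
    by (rule joined_step[OF joined_mono[OF H(1)]]) (auto simp: nearest_neighbours_def)
  moreover have "joined ?T (R + 1, min c y2) (R + 1, max d y1)"
  proof -
    have "joined ?T (R + 1, min c y2) (R + 1, y2)" "joined ?T (R + 1, y1) (R + 1, max d y1)"
      by (rule joined_column; auto)+
    moreover have "joined ?T (R, y2) (R, y1)" by (rule joined_mono[OF joined_sym[OF X(1)]]) auto
    moreover have "nearest_neighbours (R + 1, y2) (R, y2)" "nearest_neighbours (R, y1) (R + 1, y1)"
      by (auto simp: nearest_neighbours_def)
    ultimately show ?thesis by (meson joined_in joined_step joined_trans joined_refl)
  qed
  moreover have cd: "c \<le> w \<and> w \<le> d" using H(4)[of "(R, w)"] joined_in[OF H(1)] by simp
  moreover have "L \<le> R" using X(2)[of "(R, y1)"] joined_in[OF X(1)] by simp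
  ultimately have "?S \<inter> ?T \<noteq> {}"
    using H X by (intro crossing[of ?S u "(R + 1, w)" c d L "R + 1" ?T "(R + 1, min c y2)" "(R + 1, max d y1)"]) fastforce+
  then obtain s where "s \<in> ?S" "s \<in> ?T" by blast
  then show ?thesis using False w X(2) H(3) by fastforce
qed

section \<open>Clusters\<close>

definition cluster :: "site set \<Rightarrow> site \<Rightarrow> site set" where
  "cluster S x = {y. joined S x y}"

lemma cluster_subset: "cluster S x \<subseteq> S"
  by (rule subsetI) (simp add: cluster_def joined_in)

lemma joined_via_cluster: "joined S x y \<Longrightarrow> cluster S x \<subseteq> T \<Longrightarrow> joined T x y"
  unfolding cluster_def by (rule joined_mono[OF joined_cluster])

lemma disjoint_clusters: "\<not> joined S x y \<Longrightarrow> cluster S x \<inter> cluster S y = {}"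
  unfolding cluster_def by (metis (mono_tags, lifting) disjoint_iff joined_sym joined_trans mem_Collect_eq)

definition square :: "int \<Rightarrow> site set" where
  "square n = {-n..n} \<times> {-n..n}"

lemma mem_square: "x \<in> square n \<longleftrightarrow> \<bar>fst x\<bar> \<le> n \<and> \<bar>snd x\<bar> \<le> n"
  by (cases x) (auto simp: square_def abs_le_iff)

lemma finite_square [simp]: "finite (square n)"
  by (simp add: square_def)

lemma square_mono: "m \<le> n \<Longrightarrow> square m \<subseteq> square n"
  by (auto simp: square_def)

lemma finite_subset_square:
  assumes "finite K"
  obtains n where "K \<subseteq> square n" "0 \<le> n"
proof
  let ?n = "\<Sum>x\<in>K. \<bar>fst x\<bar> + \<bar>snd x\<bar>"
  have "\<bar>fst x\<bar> + \<bar>snd x\<bar> \<le> ?n" if "x \<in> K" for x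
    by (rule member_le_sum) (use that assms in auto)
  then show "K \<subseteq> square ?n" by (force simp: mem_square)
  show "0 \<le> ?n" by (intro sum_nonneg) auto
qed

lemma square_joined:
  assumes "x \<in> square n" "y \<in> square n"
  shows "joined (square n) x y"
proof -
  have to_axis: "joined (square n) (a, b) (a, 0)" if "(a, b) \<in> square n" for a b
  proof (cases "b \<le> 0")
    case True
    then show ?thesis using that by (intro joined_column) (auto simp: square_def)
  next
    case False
    then show ?thesis using that by (intro joined_sym[OF joined_column]) (auto simp: square_def)
  qed
  have swap: "prod.swap ` square n = square n" by (auto simp: square_def)
  have nn_swap: "nearest_neighbours (prod.swap x) (prod.swap y)" if "nearest_neighbours x y" for x y
    using that by (simp add: nearest_neighbours_def)
  have "joined (square n) (a, 0) (0, 0)" if "(a, 0) \<in> square n" for a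
  proof -
    have "joined (square n) (0, a) (0, 0)" using to_axis[of 0 a] that by (auto simp: square_def)
    from joined_image[of prod.swap, OF nn_swap this] show ?thesis by (simp add: swap)
  qed
  then have "joined (square n) (a, b) (0, 0)" if "(a, b) \<in> square n" for a b
    using to_axis[OF that] joined_trans joined_in by blast
  then show ?thesis using assms joined_trans joined_sym by (metis surj_pair)
qed

definition sphere_sites :: "int \<Rightarrow> site set" where
  "sphere_sites n = square n - square (n - 1)"

lemma joined_sphere:
  assumes "joined S x y" "x \<in> square n" "y \<notin> square (n - 1)"
  shows "\<exists>v\<in>sphere_sites n. joined (S \<inter> square n) x v"
proof (cases "x \<in> square (n - 1)")
  case False
  then show ?thesis using assms joined_in[OF assms(1)] joined_refl[of x "S \<inter> square n"]
    by (intro bexI[of _ x]) (simp_all add: sphere_sites_def)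
next
  case True
  show ?thesis
  proof (rule joined_exit[OF assms(1) True])
    assume "joined (S \<inter> square (n - 1)) x y"
    then show ?thesis using joined_in assms(3) by blast
  next
    fix u v assume u: "joined (S \<inter> square (n - 1)) x u" "nearest_neighbours u v" "v \<in> S" "v \<notin> square (n - 1)"
    then have "v \<in> square n" using joined_in[OF u(1)] u(2) by (simp add: mem_square nearest_neighbours_def) linarith
    then have "joined (S \<inter> square n) x v" using u square_mono[of "n - 1" n] by (intro joined_step[OF joined_mono[OF u(1)]]) auto
    then show ?thesis using \<open>v \<in> square n\<close> u(4) by (auto simp: sphere_sites_def)
  qed
qed

lemma infinite_cluster_reaches_sphere:
  assumes "infinite (cluster S x)" "x \<in> square n"
  shows "\<exists>v\<in>sphere_sites n. joined (S \<inter> square n) x v"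
proof -
  have "\<not> cluster S x \<subseteq> square (n - 1)" using assms(1) finite_subset finite_square by blast
  then obtain y where "joined S x y" "y \<notin> square (n - 1)" unfolding cluster_def by blast
  then show ?thesis using joined_sphere assms(2) by blast
qed

section \<open>Lattice symmetries\<close>

definition lattice_automorphism :: "(site \<Rightarrow> site) \<Rightarrow> bool" where
  "lattice_automorphism f \<longleftrightarrow> bij f \<and> (\<forall>x y. nearest_neighbours (f x) (f y) \<longleftrightarrow> nearest_neighbours x y)"

lemma joined_vimage:
  assumes "lattice_automorphism f"
  shows "joined (f -` S) x y \<longleftrightarrow> joined S (f x) (f y)"
proof
  have f: "bij f" "\<And>x y. nearest_neighbours (f x) (f y) \<longleftrightarrow> nearest_neighbours x y"
    using assms by (auto simp: lattice_automorphism_def)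
  show "joined (f -` S) x y \<Longrightarrow> joined S (f x) (f y)"
    using joined_image[of f "f -` S" x y] f by (simp add: bij_is_surj surj_image_vimage_eq)
  have g: "inv f (f x) = x" "f (inv f x) = x" for x using f(1) by (simp_all add: bij_is_inj bij_is_surj surj_f_inv_f)
  have "nearest_neighbours (inv f x) (inv f y)" if "nearest_neighbours x y" for x y
    using f(2)[of "inv f x" "inv f y"] that by (simp add: g)
  from joined_image[of "inv f" S "f x" "f y", OF this]
  show "joined S (f x) (f y) \<Longrightarrow> joined (f -` S) x y"
    using f(1) by (simp add: g bij_vimage_eq_inv_image)
qed

lemma cluster_vimage:
  assumes "lattice_automorphism f"
  shows "cluster (f -` S) x = f -` cluster S (f x)"
  using joined_vimage[OF assms] by (auto simp: cluster_def)

lemma infinite_cluster_vimage: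
  assumes "lattice_automorphism f"
  shows "infinite (cluster (f -` S) x) \<longleftrightarrow> infinite (cluster S (f x))"
  unfolding cluster_vimage[OF assms]
  using assms by (simp add: lattice_automorphism_def finite_vimage_iff)

lemma lattice_automorphism_translation: "lattice_automorphism ((+) v)"
  by (auto simp: lattice_automorphism_def nearest_neighbours_def)

lemma Collect_comp: "Collect (\<eta> \<circ> f) = f -` Collect \<eta>"
  by auto

section \<open>Encounter sets\<close>

text \<open>The trifurcation of Burton and Keane with a set of sites in the role of the trifurcation
  site. Taking a whole box for \<open>K\<close> avoids routing three disjoint paths through the box
  to a single site.\<close>

definition encounter :: "site set \<Rightarrow> site set \<Rightarrow> bool" where
  "encounter K S \<longleftrightarrow> (\<exists>u1 u2 u3. (\<forall>u\<in>{u1, u2, u3}. infinite (cluster (S - K) u) \<and> (\<exists>k\<in>K. nearest_neighbours k u)) \<and>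
     \<not> joined (S - K) u1 u2 \<and> \<not> joined (S - K) u1 u3 \<and> \<not> joined (S - K) u2 u3)"

lemma infinite_cluster_in: "infinite (cluster S u) \<Longrightarrow> u \<in> S"
  unfolding cluster_def joined_def by (metis (mono_tags, lifting) finite.emptyI Collect_empty_eq)

text \<open>The cluster is covered by \<open>K\<close> and the components of \<open>S - K\<close> at
  the finitely many neighbours of \<open>K\<close>, so one of these components is infinite.\<close>

lemma infinite_cluster_removal:
  assumes "infinite (cluster S x)" "x \<in> K" "finite K"
  shows "\<exists>u. joined S x u \<and> infinite (cluster (S - K) u) \<and> (\<exists>k\<in>K. nearest_neighbours k u)"
proof (rule ccontr)
  assume *: "\<not> ?thesis"
  define U where "U = {u. joined S x u \<and> (\<exists>k\<in>K. nearest_neighbours k u)}"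
  have "U \<subseteq> (\<Union>k\<in>K. {fst k - 1..fst k + 1} \<times> {snd k - 1..snd k + 1})"
    unfolding U_def nearest_neighbours_def by force
  then have "finite U" using assms(3) finite_subset by blast
  have "cluster S x \<subseteq> K \<union> (\<Union>u\<in>U. cluster (S - K) u)"
  proof
    fix y assume "y \<in> cluster S x"
    then have y: "joined S y x" by (simp add: cluster_def joined_sym)
    show "y \<in> K \<union> (\<Union>u\<in>U. cluster (S - K) u)"
    proof (cases "y \<in> K")
      case False
      then have "y \<in> - K" by simp
      from y this show ?thesis
      proof (rule joined_exit)
        assume "joined (S \<inter> - K) y x"
        then show ?thesis using joined_in assms(2) by blast
      next
        fix u v assume u: "joined (S \<inter> - K) y u" "nearest_neighbours u v" "v \<in> S" "v \<notin> - K"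
        have "joined S x u"
          using joined_sym[OF y] joined_mono[OF u(1), of S] joined_trans by blast
        moreover have "joined (S - K) u y" using joined_sym[OF u(1)] by (simp add: Diff_eq)
        ultimately show ?thesis using u nearest_neighbours_sym unfolding U_def cluster_def by blast
      qed
    qed simp
  qed
  moreover have "finite (cluster (S - K) u)" if "u \<in> U" for u using * that unfolding U_def by blast
  ultimately show False using assms \<open>finite U\<close> finite_subset by blast
qed

text \<open>The nested case of laminarity. The component of \<open>u\<close> contains
  \<open>K'\<close> but not the root, so the root is connected to \<open>K\<close> without touching
  \<open>K'\<close>. A component of \<open>S - K'\<close> that misses the root therefore misses all
  of \<open>K\<close>; it survives in \<open>S - K\<close>, and being attached to \<open>K'\<close>
  it lies in the component of \<open>u\<close>.\<close>

lemma encounter_sides: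
  fixes S :: "site set" and r r' :: site
  assumes K: "K \<subseteq> S" "K' \<subseteq> S" "K \<inter> K' = {}"
    and conn: "\<And>a b. a \<in> K \<Longrightarrow> b \<in> K \<Longrightarrow> joined K a b" "\<And>a b. a \<in> K' \<Longrightarrow> b \<in> K' \<Longrightarrow> joined K' a b"
    and r: "\<And>k. k \<in> K \<Longrightarrow> joined S k r" "r \<notin> K" "\<And>k k'. k \<in> K \<Longrightarrow> k' \<in> K' \<Longrightarrow> joined S k k' \<Longrightarrow> r' = r"
    and u: "u \<in> S - K" "k \<in> K" "nearest_neighbours k u" "\<not> joined (S - K) u r"
    and w: "w \<in> S - K'" "k' \<in> K'" "nearest_neighbours k' w" "\<not> joined (S - K') w r'"
    and k': "joined (S - K) u k'"
  shows "cluster (S - K') w \<subseteq> cluster (S - K) u"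
proof -
  have KK: "joined S k k'"
  proof -
    have "joined S k u" using K u by (intro joined_step[OF joined_refl]) auto
    moreover have "joined S u k'" by (rule joined_mono[OF k']) auto
    ultimately show ?thesis by (rule joined_trans)
  qed
  have r': "r' = r" using r(3)[OF u(2) w(2) KK] .
  have uK': "joined (S - K) u c" if "c \<in> K'" for c
    using joined_trans[OF k' joined_mono[OF conn(2)[OF w(2) that]]] K by blast
  obtain b where b: "joined (S - K) r b" "\<exists>a\<in>K. nearest_neighbours b a"
  proof -
    have "joined S r k" using r(1)[OF u(2)] by (rule joined_sym)
    moreover have "r \<in> - K" using r(2) by simp
    ultimately show ?thesis
    proof (rule joined_exit)
      assume "joined (S \<inter> - K) r k"
      then show ?thesis using joined_in u(2) by blast
    next
      fix a b assume "joined (S \<inter> - K) r a" "nearest_neighbours a b" "b \<in> S" "b \<notin> - K"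
      then show ?thesis using that[of a] by (auto simp: Diff_eq)
    qed
  qed
  then obtain a where a: "a \<in> K" "nearest_neighbours b a" by blast
  have rK: "joined (S - K') r a"
  proof -
    have "cluster (S - K) r \<subseteq> S - K'"
    proof
      fix c assume "c \<in> cluster (S - K) r"
      then have c: "joined (S - K) r c" by (simp add: cluster_def)
      have "c \<notin> K'" using uK'[of c] c u(4) joined_trans joined_sym by blast
      then show "c \<in> S - K'" using joined_in[OF c] by blast
    qed
    then have "joined (S - K') r b"
      using joined_mono[OF joined_cluster[OF b(1)]] by (simp add: cluster_def)
    then show ?thesis using joined_step a K by blast
  qed
  have avoid: "cluster (S - K') w \<inter> K = {}"
  proof (rule ccontr)
    assume "\<not> ?thesis"
    then obtain c where c: "joined (S - K') w c" "c \<in> K" by (auto simp: cluster_def)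
    have "joined (S - K') c a" by (rule joined_mono[OF conn(1)[OF c(2) a(1)]]) (use K in blast)
    then have "joined (S - K') w r" using c(1) rK joined_trans joined_sym by blast
    then show False using w(4) r' by simp
  qed
  have "w \<notin> K" using avoid joined_refl[OF w(1)] by (auto simp: cluster_def)
  then have uw: "joined (S - K) u w" using w(1) by (intro joined_step[OF uK'[OF w(2)] w(3)]) auto
  show ?thesis
  proof
    fix c assume "c \<in> cluster (S - K') w"
    then have "joined (S - K') w c" by (simp add: cluster_def)
    moreover have "cluster (S - K') w \<subseteq> S - K" using avoid cluster_subset[of "S - K'" w] by blast
    ultimately have "joined (S - K) w c" by (rule joined_via_cluster)
    then show "c \<in> cluster (S - K) u" using joined_trans[OF uw] by (simp add: cluster_def)
  qed
qed

text \<open>The disjoint case of laminarity: a common site would put \<open>w\<close> into the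
  component of \<open>u\<close>, and then also the neighbour of \<open>w\<close> in
  \<open>K'\<close>.\<close>

lemma encounter_disjoint:
  fixes S :: "site set"
  assumes K: "K \<subseteq> S" "K' \<subseteq> S" "K \<inter> K' = {}"
    and conn: "\<And>a b. a \<in> K' \<Longrightarrow> b \<in> K' \<Longrightarrow> joined K' a b"
    and w: "w \<in> S - K'" "k' \<in> K'" "nearest_neighbours k' w"
    and n: "cluster (S - K) u \<inter> K' = {}" "cluster (S - K') w \<inter> K = {}"
  shows "cluster (S - K) u \<inter> cluster (S - K') w = {}"
proof (rule ccontr)
  assume "\<not> ?thesis"
  then obtain c where c: "joined (S - K) u c" "joined (S - K') w c" by (auto simp: cluster_def)
  have "cluster (S - K') w \<subseteq> S - K" using n(2) cluster_subset[of "S - K'" w] by blast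
  with c(2) have "joined (S - K) w c" by (rule joined_via_cluster)
  then have "joined (S - K) u w" using c(1) joined_trans joined_sym by blast
  then have "joined (S - K) u k'" using w nearest_neighbours_sym K by (intro joined_step[of _ u w k']) auto
  then show False using n(1) w(2) by (auto simp: cluster_def)
qed

text \<open>The minima of \<open>a'\<close> and \<open>b'\<close> differ and are at least
  \<open>Min a\<close>, so the larger one exceeds \<open>Min a\<close>; it lies in \<open>a\<close>,
  so it is not \<open>Min b\<close> either. The smaller minimum would not do, as it may coincide
  with \<open>Min a\<close>.\<close>

lemma max_Min_neq:
  fixes a b a' b' :: "nat set"
  assumes "finite a" "finite b" "finite a'" "finite b'" "a \<noteq> {}" "b \<noteq> {}" "a' \<noteq> {}" "b' \<noteq> {}"
    and "a \<inter> b = {}" "a' \<inter> b' = {}" "a' \<union> b' \<subseteq> a"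
  shows "max (Min a) (Min b) \<noteq> max (Min a') (Min b')"
proof -
  have "Min a' \<noteq> Min b'" using Min_in[of a'] Min_in[of b'] assms by (metis disjoint_iff)
  moreover have "Min a \<le> Min a'" "Min a \<le> Min b'" using assms by (auto intro!: Min_antimono)
  ultimately have 1: "Min a < max (Min a') (Min b')" by auto
  have "Min a' \<in> a" "Min b' \<in> a" using Min_in[of a'] Min_in[of b'] assms by blast+
  then have "max (Min a') (Min b') \<in> a" by (simp add: max_def)
  then have "max (Min a') (Min b') \<noteq> Min b" using Min_in[of b] assms by (metis disjoint_iff)
  then show ?thesis using 1 by (auto simp: max_def split: if_splits)
qed

text \<open>Fix a root in \<open>Y\<close> for every cluster of \<open>S\<close>.  Removing an encounter set \<open>K\<close> leaves two
  infinite components that miss the root, and over all \<open>K\<close> these components form a laminar family.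
  Sending \<open>K\<close> to the larger of the minima of their traces on \<open>Y\<close> is therefore injective.\<close>

lemma card_encounters_le:
  fixes S Y :: "site set" and F :: "site set set"
  assumes Y: "finite Y" and F: "\<And>K K'. K \<in> F \<Longrightarrow> K' \<in> F \<Longrightarrow> K \<noteq> K' \<Longrightarrow> K \<inter> K' = {}"
    and K: "\<And>K. K \<in> F \<Longrightarrow> K \<subseteq> S \<and> encounter K S \<and> K \<inter> Y = {}"
    and conn: "\<And>K a b. K \<in> F \<Longrightarrow> a \<in> K \<Longrightarrow> b \<in> K \<Longrightarrow> joined K a b"
    and reach: "\<And>K u k. K \<in> F \<Longrightarrow> k \<in> K \<Longrightarrow> nearest_neighbours k u \<Longrightarrow> infinite (cluster (S - K) u) \<Longrightarrow> cluster (S - K) u \<inter> Y \<noteq> {}"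
  shows "card F \<le> card Y"
proof -
  \<comment> \<open>The choice depends on \<open>x\<close> only through its cluster, so joined sites
    have the same root.\<close>
  define root where "root x = (SOME y. y \<in> Y \<and> joined S x y)" for x
  have root_eq: "root x = root y" if "joined S x y" for x y
  proof -
    have "joined S x z \<longleftrightarrow> joined S y z" for z using that joined_trans joined_sym by blast
    then show ?thesis by (simp add: root_def)
  qed
  have root: "root x \<in> Y \<and> joined S x (root x)" if "y \<in> Y" "joined S x y" for x y
    unfolding root_def by (rule someI[of _ y]) (use that in auto)
  define good where "good K r u \<longleftrightarrow> u \<in> S - K \<and> (\<exists>k\<in>K. nearest_neighbours k u) \<and>
      cluster (S - K) u \<inter> Y \<noteq> {} \<and> \<not> joined (S - K) u r" for K r u
  have ex: "\<exists>k u v. k \<in> K \<and> (\<forall>c\<in>K. joined S c (root k)) \<and> root k \<in> Y \<and> good K (root k) u \<and> good K (root k) v \<and> \<not> joined (S - K) u v"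
    if KF: "K \<in> F" for K
  proof -
    obtain u1 u2 u3 where u: "\<And>u. u \<in> {u1, u2, u3} \<Longrightarrow> infinite (cluster (S - K) u) \<and> (\<exists>k\<in>K. nearest_neighbours k u)"
      "\<not> joined (S - K) u1 u2" "\<not> joined (S - K) u1 u3" "\<not> joined (S - K) u2 u3"
      using K[OF KF] unfolding encounter_def by metis
    obtain k where k: "k \<in> K" "nearest_neighbours k u1" using u(1) by blast
    obtain y where y: "y \<in> Y" "joined (S - K) u1 y" using reach[OF KF k] u(1) by (auto simp: cluster_def)
    have "u1 \<in> S" "k \<in> S" using infinite_cluster_in[of "S - K" u1] u(1) K[OF KF] k by auto
    then have "joined S k u1" using k joined_refl joined_step by blast
    then have "joined S k y" using joined_mono[OF y(2), of S] joined_trans by blast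
    note r = root[OF y(1) this]
    have rk: "joined S c (root k)" if "c \<in> K" for c
      using joined_trans[OF joined_mono[OF conn[OF KF that k(1)]]] K[OF KF] r by blast
    have g: "good K (root k) u" if "u \<in> {u1, u2, u3}" "\<not> joined (S - K) u (root k)" for u
      using u(1)[OF that(1)] that(2) reach[OF KF] infinite_cluster_in[of "S - K" u] unfolding good_def by blast
    \<comment> \<open>The root lies in at most one of the three components, so two good ones
      remain.\<close>
    have "\<not> (joined (S - K) v (root k) \<and> joined (S - K) w (root k))" if "\<not> joined (S - K) v w" for v w
      using that joined_trans joined_sym by blast
    then have "\<exists>u v. good K (root k) u \<and> good K (root k) v \<and> \<not> joined (S - K) u v"
      using g u(2-4) by (metis insertI1 insertI2)
    then show ?thesis using k rk r by blast
  qed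
  then obtain k u v where kuv: "\<And>K. K \<in> F \<Longrightarrow> k K \<in> K \<and> (\<forall>c\<in>K. joined S c (root (k K))) \<and> root (k K) \<in> Y \<and>
      good K (root (k K)) (u K) \<and> good K (root (k K)) (v K) \<and> \<not> joined (S - K) (u K) (v K)"
    by metis
  \<comment> \<open>\<open>to_nat\<close> merely supplies a linear order of the sites in which to
    take minima.\<close>
  define A where "A K = to_nat ` (cluster (S - K) (u K) \<inter> Y)" for K
  define B where "B K = to_nat ` (cluster (S - K) (v K) \<inter> Y)" for K
  define \<phi> where "\<phi> K = max (Min (A K)) (Min (B K))" for K
  have fin: "finite (A K)" "finite (B K)" for K using Y by (auto simp: A_def B_def)
  have ne: "A K \<noteq> {}" "B K \<noteq> {}" if "K \<in> F" for K using kuv[OF that] by (auto simp: good_def A_def B_def)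
  have disj_image: "to_nat ` (C \<inter> Y) \<inter> to_nat ` (D \<inter> Y) = {}" if "C \<inter> D = {}" for C D :: "site set"
    using that by (auto simp: inj_eq[OF inj_to_nat])
  have AB: "A K \<inter> B K = {}" if "K \<in> F" for K
    unfolding A_def B_def
  proof (rule disj_image)
    show "cluster (S - K) (u K) \<inter> cluster (S - K) (v K) = {}"
      using kuv[OF that] disjoint_clusters by blast
  qed
  \<comment> \<open>If a component of \<open>K\<close> meets \<open>K'\<close>, it contains both
    chosen components of \<open>K'\<close>, and \<open>max_Min_neq\<close> separates the
    values.\<close>
  have inside: "\<phi> K \<noteq> \<phi> K'"
    if KF: "K \<in> F" "K' \<in> F" "K \<noteq> K'" and meet: "cluster (S - K) x \<inter> K' \<noteq> {}" and x: "x = u K \<or> x = v K" for K K' x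
  proof -
    obtain c where c: "c \<in> K'" "joined (S - K) x c" using meet by (auto simp: cluster_def)
    have sub: "cluster (S - K') w \<subseteq> cluster (S - K) x" if w: "w = u K' \<or> w = v K'" for w
    proof -
      obtain a where a: "a \<in> K" "nearest_neighbours a x" using x kuv[OF KF(1)] by (auto simp: good_def)
      obtain b where b: "b \<in> K'" "nearest_neighbours b w" using w kuv[OF KF(2)] by (auto simp: good_def)
      have "joined (S - K) x b"
        using joined_trans[OF c(2) joined_mono[OF conn[OF KF(2) c(1) b(1)]]] K[OF KF(2)] F[OF KF] by blast
      show ?thesis
      proof (rule encounter_sides[where r = "root (k K)" and r' = "root (k K')" and k = a and k' = b])
        fix s t assume st: "s \<in> K" "t \<in> K'" "joined S s t"
        have "joined S (k K) s" "joined S t (k K')"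
          using joined_mono[OF conn[OF KF(1)]] joined_mono[OF conn[OF KF(2)]] st kuv[OF KF(1)] kuv[OF KF(2)] K[OF KF(1)] K[OF KF(2)] by blast+
        then show "root (k K') = root (k K)" using st(3) root_eq joined_trans by metis
      next
        show "root (k K) \<notin> K" using kuv[OF KF(1)] K[OF KF(1)] by blast
      qed (use a b x w kuv[OF KF(1)] kuv[OF KF(2)] K[OF KF(1)] K[OF KF(2)] F[OF KF] conn KF \<open>joined (S - K) x b\<close> in \<open>auto simp: good_def\<close>)
    qed
    have "A K' \<union> B K' \<subseteq> to_nat ` (cluster (S - K) x \<inter> Y)"
      unfolding A_def B_def using sub[of "u K'"] sub[of "v K'"] by blast
    then have "A K' \<union> B K' \<subseteq> A K \<or> A K' \<union> B K' \<subseteq> B K" using x by (auto simp: A_def B_def)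
    then show ?thesis
      using max_Min_neq[of "A K" "B K" "A K'" "B K'"] max_Min_neq[of "B K" "A K" "A K'" "B K'"]
        fin ne AB KF unfolding \<phi>_def by (metis Int_commute max.commute)
  qed
  have in_AB: "\<phi> K \<in> A K \<union> B K" if "K \<in> F" for K
    using Min_in[OF fin(1) ne(1)[OF that]] Min_in[OF fin(2) ne(2)[OF that]] by (auto simp: \<phi>_def max_def)
  have "inj_on \<phi> F"
  proof (rule inj_onI, rule ccontr)
    fix K K' assume KF: "K \<in> F" "K' \<in> F" and eq: "\<phi> K = \<phi> K'" and neq: "K \<noteq> K'"
    \<comment> \<open>By \<open>inside\<close>, equal values exclude the nested case, so the
      components are disjoint, whereas the common value would lie in the traces of both
      pairs.\<close>
    have "cluster (S - K) x \<inter> cluster (S - K') w = {}"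
      if x: "x = u K \<or> x = v K" and w: "w = u K' \<or> w = v K'" for x w
    proof -
      obtain b where b: "b \<in> K'" "nearest_neighbours b w" "w \<in> S - K'" using w kuv[OF KF(2)] by (auto simp: good_def)
      show ?thesis
      proof (rule encounter_disjoint[OF _ _ F[OF KF neq] conn[OF KF(2)] b(3,1,2)])
        show "cluster (S - K) x \<inter> K' = {}" using inside[OF KF neq _ x] eq by blast
        show "cluster (S - K') w \<inter> K = {}" using inside[OF KF(2,1) _ _ w] neq eq by metis
      qed (use K KF in auto)
    qed
    then have "(A K \<union> B K) \<inter> (A K' \<union> B K') = {}"
      unfolding A_def B_def Int_Un_distrib Int_Un_distrib2 by (simp add: disj_image)
    then show False using in_AB[OF KF(1)] in_AB[OF KF(2)] eq by (auto simp: disjoint_iff)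
  qed
  moreover have "\<phi> ` F \<subseteq> to_nat ` Y" using in_AB by (auto simp: A_def B_def)
  ultimately have "card F \<le> card (to_nat ` Y)" using Y by (intro card_inj_on_le) auto
  then show ?thesis using card_image_le[OF Y, of to_nat] by simp
qed

section \<open>Uniqueness of the infinite cluster\<close>

declare split_paired_All [simp del] split_paired_Ex [simp del]

lemma card_sphere_sites_le: "0 \<le> n \<Longrightarrow> card (sphere_sites n) \<le> 4 * nat (2 * n + 1)"
proof -
  assume n: "0 \<le> n"
  let ?s = "[{n} \<times> {-n..n}, {-n} \<times> {-n..n}, {-n..n} \<times> {n}, {-n..n} \<times> {-n}]"
  have "sphere_sites n \<subseteq> \<Union> (set ?s)" by (auto simp: sphere_sites_def square_def)
  then have "card (sphere_sites n) \<le> card (\<Union> (set ?s))" by (intro card_mono) auto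
  also have "\<dots> \<le> (\<Sum>s\<leftarrow>?s. card s)"
  proof -
    have "card (\<Union> (set xs)) \<le> (\<Sum>s\<leftarrow>xs. card s)" if "\<forall>s\<in>set xs. finite s" for xs :: "site set list"
      using that by (induction xs) (auto intro: order_trans[OF card_Un_le])
    from this[of ?s] show ?thesis by simp
  qed
  also have "\<dots> = 4 * nat (2 * n + 1)" by (simp add: card_cartesian_product)
  finally show ?thesis .
qed

lemma encounter_image:
  assumes f: "lattice_automorphism f" and "encounter K (f -` S)"
  shows "encounter (f ` K) S"
proof -
  have "inj f" using f by (simp add: lattice_automorphism_def bij_is_inj)
  then have eq: "f -` S - K = f -` (S - f ` K)" by (simp add: vimage_Diff inj_vimage_image_eq)
  have nn: "nearest_neighbours (f x) (f y) \<longleftrightarrow> nearest_neighbours x y" for x y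
    using f by (simp add: lattice_automorphism_def)
  obtain u1 u2 u3 where u: "\<forall>u\<in>{u1, u2, u3}. infinite (cluster (S - f ` K) (f u)) \<and> (\<exists>k\<in>K. nearest_neighbours k u)"
     "\<not> joined (S - f ` K) (f u1) (f u2)" "\<not> joined (S - f ` K) (f u1) (f u3)" "\<not> joined (S - f ` K) (f u2) (f u3)"
    using assms(2) unfolding encounter_def eq joined_vimage[OF f] infinite_cluster_vimage[OF f] by metis
  have "\<forall>u\<in>{f u1, f u2, f u3}. infinite (cluster (S - f ` K) u) \<and> (\<exists>k\<in>f ` K. nearest_neighbours k u)"
    using u(1) nn by simp
  then show ?thesis unfolding encounter_def using u(2-) by blast
qed

definition infinite_site :: "configuration \<Rightarrow> site \<Rightarrow> bool" where
  "infinite_site \<eta> x \<longleftrightarrow> infinite (cluster (Collect \<eta>) x)"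

definition three_clusters :: "configuration set" where
  "three_clusters = {\<eta>. \<exists>x y z. infinite_site \<eta> x \<and> infinite_site \<eta> y \<and> infinite_site \<eta> z \<and>
     \<not> joined (Collect \<eta>) x y \<and> \<not> joined (Collect \<eta>) x z \<and> \<not> joined (Collect \<eta>) y z}"

definition unique_cluster :: "configuration set" where
  "unique_cluster = {\<eta>. \<forall>x y. infinite_site \<eta> x \<longrightarrow> infinite_site \<eta> y \<longrightarrow> joined (Collect \<eta>) x y}"

lemma infinite_site_translation:
  "infinite_site (\<eta> \<circ> (+) v) x \<longleftrightarrow> infinite_site \<eta> (v + x)"
  unfolding infinite_site_def Collect_comp infinite_cluster_vimage[OF lattice_automorphism_translation] ..

lemma infinite_site_set_iff: "infinite (C :: site set) \<longleftrightarrow> (\<forall>n. \<exists>y. n < to_nat y \<and> y \<in> C)"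
proof -
  have "infinite C \<longleftrightarrow> infinite (to_nat ` C)"
    by (simp add: finite_image_iff inj_on_def)
  also have "\<dots> \<longleftrightarrow> (\<forall>n. \<exists>y. n < to_nat y \<and> y \<in> C)"
    unfolding infinite_nat_iff_unbounded by blast
  finally show ?thesis .
qed

context site_percolation
begin

lemma null_UN:
  assumes "\<And>n :: nat. E n \<in> events" "\<And>n. P (E n) = 0"
  shows "P (\<Union>n. E n) = 0"
proof -
  have "E n \<in> null_sets (percolation_measure p)" for n
    using assms by (simp add: null_sets_def percolation.emeasure_eq_measure)
  then have "(\<Union>n. E n) \<in> null_sets (percolation_measure p)" by (rule null_sets_UN)
  then show ?thesis by (simp add: null_sets_def measure_def)
qed

section \<open>Measurability of connections, clusters and encounters\<close>

lemma event_Collect: "Measurable.pred (percolation_measure p) Q \<Longrightarrow> {\<eta>. Q \<eta>} \<in> events"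
  by (drule predE) simp

lemma joined_measurable [measurable]:
  "Measurable.pred (percolation_measure p) (\<lambda>\<eta>. joined (Collect \<eta> \<inter> B) x y)"
proof -
  note [measurable] = connected_measurable occupied_measurable
  have m: "(\<lambda>\<eta> z. \<eta> z \<and> z \<in> B) \<in> measurable (percolation_measure p) (percolation_measure p)"
    unfolding percolation_measure_def
  proof (rule measurable_PiM_single')
    show "(\<lambda>\<eta>. \<eta> z \<and> z \<in> B) \<in> measurable (\<Pi>\<^sub>M x\<in>UNIV. measure_pmf (bernoulli_pmf p)) (measure_pmf (bernoulli_pmf p))" for z
      using occupied_measurable[where p = p and x = z] unfolding percolation_measure_def by simp
  qed simp
  have "Measurable.pred (percolation_measure p) (\<lambda>\<eta>. \<eta> x \<and> (x, y) \<in> (occupied_edges \<eta>)\<^sup>*)" by measurable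
  from measurable_compose[OF m this] show ?thesis by (simp add: joined_def)
qed

lemma joined_measurable_UNIV [measurable]:
  "Measurable.pred (percolation_measure p) (\<lambda>\<eta>. joined (Collect \<eta>) x y)"
  using joined_measurable[of UNIV] by simp

lemma infinite_cluster_measurable [measurable]:
  "Measurable.pred (percolation_measure p) (\<lambda>\<eta>. infinite (cluster (Collect \<eta> \<inter> B) x))"
  unfolding infinite_site_set_iff cluster_def mem_Collect_eq by measurable

lemma infinite_cluster_measurable_UNIV [measurable]:
  "Measurable.pred (percolation_measure p) (\<lambda>\<eta>. infinite (cluster (Collect \<eta>) x))"
  using infinite_cluster_measurable[of UNIV] by simp

lemma encounter_measurable [measurable]:
  "Measurable.pred (percolation_measure p) (\<lambda>\<eta>. encounter K (Collect \<eta>))"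
proof -
  have eq: "encounter K S \<longleftrightarrow> (\<exists>u1 u2 u3. (infinite (cluster (S \<inter> - K) u1) \<and> (\<exists>k\<in>K. nearest_neighbours k u1)) \<and>
    (infinite (cluster (S \<inter> - K) u2) \<and> (\<exists>k\<in>K. nearest_neighbours k u2)) \<and> (infinite (cluster (S \<inter> - K) u3) \<and> (\<exists>k\<in>K. nearest_neighbours k u3)) \<and>
     \<not> joined (S \<inter> - K) u1 u2 \<and> \<not> joined (S \<inter> - K) u1 u3 \<and> \<not> joined (S \<inter> - K) u2 u3)" for S
    unfolding encounter_def Diff_eq by simp
  show ?thesis unfolding eq by measurable
qed

lemma filled_encounter_event: "{\<eta>. K \<subseteq> Collect \<eta> \<and> encounter K (Collect \<eta>)} \<in> events"
proof (rule event_Collect)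
  have "Measurable.pred (percolation_measure p) (\<lambda>\<eta>. \<forall>x. x \<in> K \<longrightarrow> \<eta> x)"
    using occupied_measurable by measurable
  then have [measurable]: "Measurable.pred (percolation_measure p) (\<lambda>\<eta>. K \<subseteq> Collect \<eta>)"
    by (simp add: subset_eq Ball_def)
  show "Measurable.pred (percolation_measure p) (\<lambda>\<eta>. K \<subseteq> Collect \<eta> \<and> encounter K (Collect \<eta>))"
    by measurable
qed

text \<open>Tile a large box by translates of \<open>square n\<close>. The occupied encounter boxes
  among them are at most as many as the sites of the surrounding sphere, which grows linearly in
  \<open>m\<close>, while their expected number is \<open>P ?T\<close> times the quadratic number of
  tiles.\<close>

lemma no_encounter_square:
  fixes n :: int
  assumes n: "0 \<le> n"
  shows "P {\<eta>. square n \<subseteq> Collect \<eta> \<and> encounter (square n) (Collect \<eta>)} = 0"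
proof -
  let ?T = "{\<eta>. square n \<subseteq> Collect \<eta> \<and> encounter (square n) (Collect \<eta>)}"
  note T = filled_encounter_event[of "square n"]
  \<comment> \<open>The spacing is the side length of \<open>square n\<close>, so the translates are
    disjoint.\<close>
  define v :: "site \<Rightarrow> site" where "v z = ((2 * n + 1) * fst z, (2 * n + 1) * snd z)" for z
  define K where "K z = (+) (v z) ` square n" for z
  define E where "E z = {\<eta>. \<eta> \<circ> (+) (v z) \<in> ?T}" for z
  have bv: "bij ((+) (v z))" for z by simp
  have E: "E z \<in> events" "P (E z) = P ?T" for z
    unfolding E_def using reindex[OF bv T] by blast+
  have memK: "x \<in> K z \<longleftrightarrow> \<bar>fst x - (2 * n + 1) * fst z\<bar> \<le> n \<and> \<bar>snd x - (2 * n + 1) * snd z\<bar> \<le> n" for x z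
  proof -
    have "x \<in> K z \<longleftrightarrow> x - v z \<in> square n" unfolding K_def by (force simp: image_iff intro!: bexI[of _ "x - v z"])
    then show ?thesis by (simp add: v_def mem_square)
  qed
  have cell: "a = b" if "\<bar>x - (2 * n + 1) * a\<bar> \<le> n" "\<bar>x - (2 * n + 1) * b\<bar> \<le> n" for a b x :: int
  proof (rule ccontr)
    assume "a \<noteq> b"
    then have "2 * n + 1 \<le> (2 * n + 1) * \<bar>a - b\<bar>" using n by simp
    also have "\<dots> = \<bar>(2 * n + 1) * a - (2 * n + 1) * b\<bar>"
      using n by (simp add: abs_mult right_diff_distrib[symmetric])
    finally show False using that by linarith
  qed
  have disjK: "z = z'" if "x \<in> K z" "x \<in> K z'" for x z z'
    using that cell[of "fst x" "fst z" "fst z'"] cell[of "snd x" "snd z" "snd z'"] unfolding memK by (simp add: prod_eq_iff)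
  have centre: "v z \<in> K z" for z using n by (simp add: memK v_def)
  have connK: "joined (K z) a b" if ab: "a \<in> K z" "b \<in> K z" for a b z
  proof -
    obtain a' b' where "a' \<in> square n" "b' \<in> square n" "a = v z + a'" "b = v z + b'" using ab by (auto simp: K_def)
    then show ?thesis
      using joined_image[of "(+) (v z)", OF _ square_joined] unfolding K_def by (auto simp: nearest_neighbours_def)
  qed
  have count: "(\<Sum>z\<in>square m. indicator (E z) \<eta>) \<le> real (4 * nat (2 * ((2 * n + 1) * m + n + 1) + 1))"
    if m: "0 \<le> m" for m \<eta>
  proof -
    define r where "r = (2 * n + 1) * m + n"
    have r: "0 \<le> r" using n m by (simp add: r_def)
    have Kr: "K z \<subseteq> square r" if "z \<in> square m" for z
    proof
      fix x assume x: "x \<in> K z"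
      have *: "\<bar>(2 * n + 1) * a\<bar> \<le> (2 * n + 1) * m" if "\<bar>a\<bar> \<le> m" for a
        using that n by (simp add: abs_mult mult_left_mono)
      show "x \<in> square r"
        using x *[of "fst z"] *[of "snd z"] that unfolding memK mem_square r_def by linarith
    qed
    define Z where "Z = {z \<in> square m. \<eta> \<in> E z}"
    have Z: "K z \<subseteq> Collect \<eta>" "encounter (K z) (Collect \<eta>)" "z \<in> square m" if "z \<in> Z" for z
    proof -
      have \<eta>: "\<eta> \<circ> (+) (v z) \<in> ?T" using that by (simp add: Z_def E_def)
      then show "K z \<subseteq> Collect \<eta>" by (auto simp: K_def)
      show "encounter (K z) (Collect \<eta>)"
        unfolding K_def using \<eta> by (intro encounter_image[OF lattice_automorphism_translation]) (simp add: Collect_comp)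
    qed (use that in \<open>simp add: Z_def\<close>)
    have fin: "finite Z" by (simp add: Z_def)
    \<comment> \<open>All tiles lie in \<open>square r\<close>, so the sphere of radius
      \<open>r + 1\<close> avoids them, and every infinite component attached to a tile has to cross
      it.\<close>
    have "card (K ` Z) \<le> card (sphere_sites (r + 1))"
    proof (rule card_encounters_le[where S = "Collect \<eta>"])
      fix A B assume "A \<in> K ` Z" "B \<in> K ` Z" "A \<noteq> B"
      then show "A \<inter> B = {}" using disjK by blast
    next
      fix A assume "A \<in> K ` Z"
      then show "A \<subseteq> Collect \<eta> \<and> encounter A (Collect \<eta>) \<and> A \<inter> sphere_sites (r + 1) = {}"
        using Z Kr by (fastforce simp: sphere_sites_def)
    next
      fix A u k assume A: "A \<in> K ` Z" "k \<in> A" "nearest_neighbours k u" "infinite (cluster (Collect \<eta> - A) u)"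
      then have "k \<in> square r" using Z Kr by blast
      then have "u \<in> square (r + 1)" using A(3) by (simp add: mem_square nearest_neighbours_def) linarith
      from infinite_cluster_reaches_sphere[OF A(4) this] obtain w
        where "w \<in> sphere_sites (r + 1)" "joined ((Collect \<eta> - A) \<inter> square (r + 1)) u w" by blast
      then show "cluster (Collect \<eta> - A) u \<inter> sphere_sites (r + 1) \<noteq> {}"
        using joined_mono[of "(Collect \<eta> - A) \<inter> square (r + 1)" u w "Collect \<eta> - A"] unfolding cluster_def by blast
    qed (use connK in \<open>auto simp: sphere_sites_def\<close>)
    moreover have "inj_on K Z" using disjK centre by (metis inj_onI)
    ultimately have "card Z \<le> 4 * nat (2 * (r + 1) + 1)"
      using card_sphere_sites_le[of "r + 1"] r by (simp add: card_image)
    moreover have "(\<Sum>z\<in>square m. indicator (E z) \<eta>) = real (card Z)"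
      by (simp add: Z_def indicator_def Int_def)
    ultimately show ?thesis by (simp add: r_def add.assoc)
  qed
  \<comment> \<open>The expected count compared with its deterministic bound, after cancelling one
    factor \<open>2 * real m + 1\<close>; the right-hand side no longer depends on
    \<open>m\<close>.\<close>
  have bound: "P ?T * (2 * real m + 1) \<le> 16 * n + 20" for m :: nat
  proof -
    let ?b = "real (4 * nat (2 * ((2 * n + 1) * int m + n + 1) + 1))"
    have "P ?T * (2 * real m + 1)\<^sup>2 = (\<Sum>z\<in>square (int m). P (E z))"
      unfolding E(2) by (simp add: square_def card_cartesian_product power2_eq_square nat_add_distrib nat_mult_distrib algebra_simps)
    also have "\<dots> = (\<integral>\<eta>. (\<Sum>z\<in>square (int m). indicator (E z) \<eta>) \<partial>percolation_measure p)"
      using E by (subst Bochner_Integration.integral_sum) (auto simp: percolation.emeasure_eq_measure)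
    also have "\<dots> \<le> (\<integral>\<eta>. ?b \<partial>percolation_measure p)"
      using E count[of "int m"] by (intro integral_mono) (auto simp: percolation.emeasure_eq_measure)
    also have "\<dots> = ?b" using percolation.prob_space by simp
    also have "?b = 8 * (2 * n + 1) * real m + 8 * n + 12" using n by (simp add: algebra_simps)
    also have "\<dots> \<le> (16 * n + 20) * (2 * real m + 1)" using n by (simp add: algebra_simps)
    finally have "P ?T * (2 * real m + 1) * (2 * real m + 1) \<le> (16 * n + 20) * (2 * real m + 1)"
      by (simp add: power2_eq_square mult.assoc)
    then show ?thesis by (rule mult_right_le_imp_le) simp
  qed
  show ?thesis
  proof (rule ccontr)
    assume "\<not> ?thesis"
    then have pos: "P ?T > 0" using measure_nonneg[of "percolation_measure p" ?T] by linarith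
    obtain m :: nat where "(16 * n + 20) / P ?T < real m" using reals_Archimedean2 by blast
    then have "16 * n + 20 < P ?T * real m" using pos by (simp add: field_simps)
    also have "\<dots> \<le> P ?T * (2 * real m + 1)" using pos by (intro mult_left_mono) auto
    finally show False using bound[of m] by simp
  qed
qed

lemma infinite_site_measurable [measurable]:
  "Measurable.pred (percolation_measure p) (\<lambda>\<eta>. infinite_site \<eta> x)"
  unfolding infinite_site_def by measurable

lemma three_clusters_event: "three_clusters \<in> events"
  unfolding three_clusters_def by (rule event_Collect) measurable

text \<open>A box that meets three infinite clusters is an encounter set, except that it need not be
  occupied. Filling it costs only the positive factor \<open>p ^ card ?K\<close>.\<close>

lemma three_clusters_null:
  assumes "0 < p"
  shows "P three_clusters = 0"
proof -
  define E where "E n = {\<eta>. encounter (square (int n)) (Collect \<eta>)}" for n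
  have E: "E n \<in> events" for n unfolding E_def by (rule event_Collect) measurable
  have E0: "P (E n) = 0" for n
  proof -
    let ?K = "square (int n)"
    let ?T = "{\<eta>. ?K \<subseteq> Collect \<eta> \<and> encounter ?K (Collect \<eta>)}"
    note T = filled_encounter_event[of ?K]
    \<comment> \<open>An encounter at \<open>?K\<close> concerns only the sites outside
      \<open>?K\<close>, so filling \<open>?K\<close> does not affect it.\<close>
    have "Collect (\<lambda>x. x \<in> ?K \<or> \<eta> x) - ?K = Collect \<eta> - ?K" for \<eta> by auto
    then have "encounter ?K (Collect (\<lambda>x. x \<in> ?K \<or> \<eta> x)) \<longleftrightarrow> encounter ?K (Collect \<eta>)" for \<eta>
      by (simp only: encounter_def)
    then have "{\<eta>. (\<lambda>x. x \<in> ?K \<or> \<eta> x) \<in> ?T} = E n" by (auto simp: E_def)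
    moreover have "p ^ card ?K * P {\<eta>. (\<lambda>x. x \<in> ?K \<or> \<eta> x) \<in> ?T} \<le> P ?T"
      using fill_sets[OF finite_square T] by blast
    ultimately have "p ^ card ?K * P (E n) \<le> 0" using no_encounter_square[of "int n"] by simp
    then show ?thesis using zero_less_power[OF assms, of "card ?K"] measure_nonneg[of "percolation_measure p" "E n"] by (auto simp: mult_le_0_iff)
  qed
  have "three_clusters \<subseteq> (\<Union>n. E n)"
  proof
    fix \<eta> assume "\<eta> \<in> three_clusters"
    then obtain x y z where xyz: "infinite_site \<eta> x" "infinite_site \<eta> y" "infinite_site \<eta> z"
      "\<not> joined (Collect \<eta>) x y" "\<not> joined (Collect \<eta>) x z" "\<not> joined (Collect \<eta>) y z"
      unfolding three_clusters_def by blast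
    obtain m where m: "{x, y, z} \<subseteq> square m" "0 \<le> m" using finite_subset_square[of "{x, y, z}"] by auto
    let ?S = "Collect \<eta>" and ?K = "square m"
    have removal: "\<exists>a. joined ?S w a \<and> infinite (cluster (?S - ?K) a) \<and> (\<exists>k\<in>?K. nearest_neighbours k a)"
      if "infinite_site \<eta> w" "w \<in> {x, y, z}" for w
      by (rule infinite_cluster_removal[OF that(1)[unfolded infinite_site_def] _ finite_square])
         (use m(1) that(2) in blast)
    obtain a b c where abc: "joined ?S x a \<and> infinite (cluster (?S - ?K) a) \<and> (\<exists>k\<in>?K. nearest_neighbours k a)"
       "joined ?S y b \<and> infinite (cluster (?S - ?K) b) \<and> (\<exists>k\<in>?K. nearest_neighbours k b)"
       "joined ?S z c \<and> infinite (cluster (?S - ?K) c) \<and> (\<exists>k\<in>?K. nearest_neighbours k c)"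
      using removal[OF xyz(1)] removal[OF xyz(2)] removal[OF xyz(3)] by blast
    have "\<not> joined (?S - ?K) s t" if "joined ?S u s" "joined ?S w t" "\<not> joined ?S u w" for s t u w
    proof
      assume "joined (?S - ?K) s t"
      then have "joined ?S s t" by (rule joined_mono) blast
      then have "joined ?S u t" using that(1) joined_trans by blast
      then show False using that(2,3) joined_trans joined_sym by blast
    qed
    note sep = this
    have "\<not> joined (?S - ?K) a b" "\<not> joined (?S - ?K) a c" "\<not> joined (?S - ?K) b c"
      using sep[of x a y b] sep[of x a z c] sep[of y b z c] abc xyz(4-6) by simp_all
    with abc have "encounter ?K ?S" unfolding encounter_def
      by (intro exI[of _ a] exI[of _ b] exI[of _ c]) simp
    then show "\<eta> \<in> (\<Union>n. E n)" using m(2) by (auto simp: E_def intro!: exI[of _ "nat m"])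
  qed
  moreover have "P (\<Union>n. E n) = 0"
    by (rule null_UN[OF E E0])
  ultimately show ?thesis
    using percolation.finite_measure_mono[of three_clusters "\<Union>n. E n" p] E measure_nonneg[of "percolation_measure p" three_clusters]
    by auto
qed

lemma unique_cluster_event: "unique_cluster \<in> events"
  unfolding unique_cluster_def by (rule event_Collect) measurable

text \<open>If there were two infinite clusters, then by ergodicity almost surely so; but filling a box
  that meets both, which costs only a positive factor in probability, leaves just one.\<close>

theorem uniqueness:
  assumes "0 < p"
  shows "P unique_cluster = 1"
proof (rule ccontr)
  assume ne: "P unique_cluster \<noteq> 1"
  have "\<eta> \<circ> (+) v \<in> unique_cluster" if "\<eta> \<in> unique_cluster" for \<eta> v
    using that unfolding unique_cluster_def mem_Collect_eq infinite_site_translation Collect_comp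
      joined_vimage[OF lattice_automorphism_translation] by blast
  from translation_invariant_0_1[OF unique_cluster_event this] ne
  have U0: "P unique_cluster = 0" by blast
  \<comment> \<open>Without a third infinite cluster, every infinite cluster meets the box. After
    filling, an infinite cluster that missed the box would have been infinite before and different
    from those of \<open>x\<close> and \<open>y\<close>.\<close>
  define V where "V n = {\<eta>. \<exists>x y. x \<in> square (int n) \<and> y \<in> square (int n) \<and> infinite_site \<eta> x \<and> infinite_site \<eta> y \<and> \<not> joined (Collect \<eta>) x y} - three_clusters" for n
  have V: "V n \<in> events" for n
    unfolding V_def by (intro sets.Diff three_clusters_event event_Collect) measurable
  have V0: "P (V n) = 0" for n
  proof -
    let ?K = "square (int n)"
    have "V n \<subseteq> {\<eta>. (\<lambda>x. x \<in> ?K \<or> \<eta> x) \<in> unique_cluster}"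
    proof
      fix \<eta> assume "\<eta> \<in> V n"
      then obtain x y where xy: "x \<in> ?K" "y \<in> ?K" "infinite_site \<eta> x" "infinite_site \<eta> y" "\<not> joined (Collect \<eta>) x y"
        and n3: "\<eta> \<notin> three_clusters" unfolding V_def by blast
      define S where "S = Collect \<eta> \<union> ?K"
      have "\<exists>k\<in>?K. joined S a k" if a: "infinite (cluster S a)" for a
      proof (rule ccontr)
        assume no: "\<not> ?thesis"
        then have "cluster S a \<subseteq> Collect \<eta>" using cluster_subset[of S a] by (auto simp: S_def cluster_def)
        then have "cluster S a \<subseteq> cluster (Collect \<eta>) a"
          using joined_via_cluster[of S a _ "Collect \<eta>"] unfolding cluster_def by blast
        then have "infinite_site \<eta> a" using a finite_subset unfolding infinite_site_def by blast
        moreover have "\<not> joined (Collect \<eta>) b a" if "b \<in> ?K" for b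
        proof
          assume "joined (Collect \<eta>) b a"
          then have "joined S a b" using joined_sym joined_mono[of "Collect \<eta>" a b S] by (auto simp: S_def)
          then show False using no that by blast
        qed
        ultimately have "\<eta> \<in> three_clusters" unfolding three_clusters_def using xy by blast
        then show False using n3 by blast
      qed
      then have "joined S a b" if ab: "infinite (cluster S a)" "infinite (cluster S b)" for a b
      proof -
        obtain k l where k: "k \<in> ?K" "joined S a k" and l: "l \<in> ?K" "joined S b l"
          using \<open>\<And>a. infinite (cluster S a) \<Longrightarrow> \<exists>k\<in>?K. joined S a k\<close> ab by blast
        have "joined S k l" by (rule joined_mono[OF square_joined[OF k(1) l(1)]]) (simp add: S_def)
        then show ?thesis using joined_trans[OF k(2)] joined_trans joined_sym[OF l(2)] by blast
      qed
      moreover have "S = Collect (\<lambda>x. x \<in> ?K \<or> \<eta> x)" by (auto simp: S_def)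
      ultimately show "\<eta> \<in> {\<eta>. (\<lambda>x. x \<in> ?K \<or> \<eta> x) \<in> unique_cluster}"
        unfolding unique_cluster_def infinite_site_def by simp
    qed
    then have "P (V n) \<le> P {\<eta>. (\<lambda>x. x \<in> ?K \<or> \<eta> x) \<in> unique_cluster}"
      using fill_sets[OF finite_square unique_cluster_event] by (intro percolation.finite_measure_mono) auto
    then have "p ^ card ?K * P (V n) \<le> p ^ card ?K * P {\<eta>. (\<lambda>x. x \<in> ?K \<or> \<eta> x) \<in> unique_cluster}"
      using p_nonneg by (intro mult_left_mono) auto
    also have "\<dots> \<le> 0" using fill_sets[OF finite_square unique_cluster_event] U0 by simp
    finally show ?thesis using zero_less_power[OF assms, of "card ?K"] measure_nonneg[of "percolation_measure p" "V n"] by (auto simp: mult_le_0_iff)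
  qed
  have V_null: "P (\<Union>n. V n) = 0"
    by (rule null_UN[OF V V0])
  have "UNIV \<subseteq> unique_cluster \<union> three_clusters \<union> (\<Union>n. V n)"
  proof
    fix \<eta> :: configuration
    show "\<eta> \<in> unique_cluster \<union> three_clusters \<union> (\<Union>n. V n)"
    proof (cases "\<eta> \<in> unique_cluster \<or> \<eta> \<in> three_clusters")
      case False
      then obtain x y where xy: "infinite_site \<eta> x" "infinite_site \<eta> y" "\<not> joined (Collect \<eta>) x y" unfolding unique_cluster_def by blast
      obtain m where "{x, y} \<subseteq> square m" "0 \<le> m" using finite_subset_square[of "{x, y}"] by auto
      then have "\<eta> \<in> V (nat m)" using xy False unfolding V_def by auto
      then show ?thesis by blast
    qed blast
  qed
  then have "P UNIV \<le> P (unique_cluster \<union> three_clusters \<union> (\<Union>n. V n))"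
    using V unique_cluster_event three_clusters_event by (intro percolation.finite_measure_mono) auto
  also have "\<dots> \<le> P unique_cluster + P three_clusters + P (\<Union>n. V n)"
    using V unique_cluster_event three_clusters_event
    by (intro order_trans[OF measure_Un_le] add_right_mono measure_Un_le) auto
  finally show False using U0 V_null three_clusters_null[OF assms] percolation.prob_space[of p] by simp
qed

end

section \<open>Arms of a box\<close>

lemma determined_by_restriction: "determined_by B {\<eta>. Q (Collect \<eta> \<inter> B)}"
proof -
  have "Collect \<eta> \<inter> B = Collect \<eta>' \<inter> B" if "\<forall>x\<in>B. \<eta> x = \<eta>' x" for \<eta> \<eta>' using that by auto
  then show ?thesis unfolding determined_by_def mem_Collect_eq by metis
qed

lemma increasing_restriction:
  assumes "\<And>S T. S \<subseteq> T \<Longrightarrow> Q S \<Longrightarrow> Q T"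
  shows "increasing {\<eta>. Q (Collect \<eta> \<inter> B)}"
proof -
  have "Collect \<eta> \<inter> B \<subseteq> Collect \<eta>' \<inter> B" if "\<forall>x. \<eta> x \<longrightarrow> \<eta>' x" for \<eta> \<eta>' using that by auto
  then show ?thesis unfolding increasing_def mem_Collect_eq using assms by meson
qed

section \<open>Reflections, arms and local uniqueness\<close>

definition reflect_x :: "site \<Rightarrow> site" where "reflect_x z = (- fst z, snd z)"
definition reflect_y :: "site \<Rightarrow> site" where "reflect_y z = (fst z, - snd z)"

lemma reflect_involution [simp]: "reflect_x (reflect_x z) = z" "reflect_y (reflect_y z) = z"
  by (simp_all add: reflect_x_def reflect_y_def)

lemma lattice_automorphism_involution:
  assumes "\<And>z. f (f z) = z" "\<And>x y. nearest_neighbours x y \<Longrightarrow> nearest_neighbours (f x) (f y)"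
  shows "lattice_automorphism f"
  unfolding lattice_automorphism_def using assms by (metis involuntory_imp_bij)

lemma lattice_automorphisms:
  "lattice_automorphism reflect_x" "lattice_automorphism reflect_y" "lattice_automorphism prod.swap"
  by (rule lattice_automorphism_involution; simp add: nearest_neighbours_def reflect_x_def reflect_y_def; linarith)+

lemma window_crossing_left:
  assumes X: "joined X (L, y1) (L, y2)" "\<And>s. s \<in> X \<Longrightarrow> L \<le> fst s \<and> fst s \<le> R"
    and H: "joined H u (L, w)" "R \<le> fst u" "\<And>s. s \<in> H \<Longrightarrow> L \<le> fst s" "\<And>s. s \<in> H \<Longrightarrow> c \<le> snd s \<and> snd s \<le> d"
    and w: "y2 \<le> w" "w \<le> y1"
  shows "H \<inter> X \<noteq> {}"
proof -
  have nn: "nearest_neighbours (reflect_x x) (reflect_x y)" if "nearest_neighbours x y" for x y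
    using that lattice_automorphisms(1) by (simp add: lattice_automorphism_def)
  have "reflect_x ` H \<inter> reflect_x ` X \<noteq> {}"
  proof (rule window_crossing[where R = "- L" and L = "- R" and u = "reflect_x u" and w = w and c = c and d = d])
    show "joined (reflect_x ` X) (- L, y1) (- L, y2)" "joined (reflect_x ` H) (reflect_x u) (- L, w)"
      using joined_image[of reflect_x, OF nn X(1)] joined_image[of reflect_x, OF nn H(1)] by (simp_all add: reflect_x_def)
  qed (use X H w in \<open>auto simp: reflect_x_def\<close>)
  moreover have "inj reflect_x" using lattice_automorphisms(1) by (simp add: lattice_automorphism_def bij_is_inj)
  ultimately show ?thesis by (simp add: image_Int[symmetric])
qed

definition arm :: "int \<Rightarrow> site set \<Rightarrow> site set \<Rightarrow> bool" where
  "arm n T S \<longleftrightarrow> (\<exists>x\<in>square n. \<exists>y\<in>T. joined S x y)"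

definition arm_event :: "int \<Rightarrow> int \<Rightarrow> site set \<Rightarrow> configuration set" where
  "arm_event n N T = {\<eta>. arm n T (Collect \<eta> \<inter> square N)}"

lemma arm_event_determined: "determined_by (square N) (arm_event n N T)"
  unfolding arm_event_def by (rule determined_by_restriction)

lemma arm_event_increasing: "increasing (arm_event n N T)"
  unfolding arm_event_def by (rule increasing_restriction) (auto simp: arm_def intro: joined_mono)

lemma arm_event_Un: "arm_event n N (T \<union> T') = arm_event n N T \<union> arm_event n N T'"
  by (auto simp: arm_event_def arm_def)

lemma arm_event_mono: "T \<subseteq> T' \<Longrightarrow> arm_event n N T \<subseteq> arm_event n N T'"
  by (auto simp: arm_event_def arm_def)

definition locally_unique :: "int \<Rightarrow> int \<Rightarrow> configuration set" where
  "locally_unique n N = {\<eta>. \<forall>x\<in>square n. \<forall>y\<in>square n. \<forall>u\<in>sphere_sites N. \<forall>v\<in>sphere_sites N.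
     joined (Collect \<eta> \<inter> square N) x u \<longrightarrow> joined (Collect \<eta> \<inter> square N) y v \<longrightarrow> joined (Collect \<eta> \<inter> square N) x y}"

lemma joined_in_square: "joined S x y \<Longrightarrow> \<exists>n::nat. joined (S \<inter> square (int n)) x y"
proof (induction rule: joined_induct)
  case refl
  obtain m where "{x} \<subseteq> square m" "0 \<le> m" using finite_subset_square[of "{x}"] by auto
  then show ?case using refl by (intro exI[of _ "nat m"]) (auto intro: joined_refl)
next
  case (step y z)
  then obtain n where n: "joined (S \<inter> square (int n)) x y" by blast
  obtain m where m: "{z} \<subseteq> square m" "0 \<le> m" using finite_subset_square[of "{z}"] by auto
  let ?k = "max n (nat m)"
  have "square (int n) \<subseteq> square (int ?k)" "square m \<subseteq> square (int ?k)" by (rule square_mono; simp)+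
  then have "joined (S \<inter> square (int ?k)) x z"
    by (intro joined_step[OF joined_mono[OF n]]) (use m step in auto)
  then show ?case by blast
qed

lemma reflect_square [simp]:
  "reflect_x z \<in> square m \<longleftrightarrow> z \<in> square m" "reflect_y z \<in> square m \<longleftrightarrow> z \<in> square m" "prod.swap z \<in> square m \<longleftrightarrow> z \<in> square m"
  by (auto simp: reflect_x_def reflect_y_def mem_square)

context site_percolation
begin

lemma arm_event_in_events [simp]: "arm_event n N T \<in> events"
  using determined_by_sets[OF finite_square arm_event_determined] .

lemma arm_event_symmetric:
  assumes f: "lattice_automorphism f" and sq: "\<And>m z. f z \<in> square m \<longleftrightarrow> z \<in> square m"
  shows "P (arm_event n N (f ` T)) = P (arm_event n N T)"
proof -
  have bij: "bij f" using f by (simp add: lattice_automorphism_def)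
  have im: "f ` square n = square n"
  proof
    show "square n \<subseteq> f ` square n"
    proof
      fix z assume "z \<in> square n"
      moreover obtain w where "z = f w" using bij_is_surj[OF bij] by blast
      ultimately show "z \<in> f ` square n" using sq by blast
    qed
  qed (use sq in blast)
  have "f -` Collect \<eta> \<inter> square N = f -` (Collect \<eta> \<inter> square N)" for \<eta>
    by (rule set_eqI) (simp add: sq)
  moreover have "arm n (f ` T) U \<longleftrightarrow> arm n T (f -` U)" for U
  proof -
    have "arm n (f ` T) U \<longleftrightarrow> (\<exists>x\<in>f ` square n. \<exists>y\<in>f ` T. joined U x y)" by (simp only: arm_def im)
    then show ?thesis by (simp add: arm_def joined_vimage[OF f])
  qed
  ultimately have "arm n T (Collect (\<eta> \<circ> f) \<inter> square N) \<longleftrightarrow> arm n (f ` T) (Collect \<eta> \<inter> square N)" for \<eta>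
    by (simp only: Collect_comp)
  then have "{\<eta>. \<eta> \<circ> f \<in> arm_event n N T} = arm_event n N (f ` T)" by (simp add: arm_event_def)
  then show ?thesis using reindex(2)[OF bij, of "arm_event n N T"] by simp
qed

text \<open>The two halves are equally likely, so the square-root trick applies to each: halving the
  target replaces the error by its square root.\<close>

lemma arm_event_halve:
  assumes f: "lattice_automorphism f" and sq: "\<And>m z. f z \<in> square m \<longleftrightarrow> z \<in> square m"
    and e: "0 \<le> e" "1 - e\<^sup>2 \<le> P (arm_event n N (T \<union> f ` T))"
  shows "1 - e \<le> P (arm_event n N T)"
proof (rule ccontr)
  assume less: "\<not> ?thesis"
  then have "P (arm_event n N T) < 1 - e" by simp
  from sqrt_trick[OF finite_square arm_event_determined arm_event_determined arm_event_increasing arm_event_increasing, OF _ e(1) this]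
  show False using e(2) arm_event_symmetric[OF f sq] less unfolding arm_event_Un by metis
qed

text \<open>The exponent 16 pays for four square roots: the diagonal swap leaves the vertical sides,
  \<open>reflect_x\<close> leaves the right side, \<open>reflect_y\<close> its upper half, and the
  last one splits that half at \<open>\<alpha>\<close>.\<close>

lemma arm_window:
  assumes N: "0 \<le> N" and e: "0 < e" "e < 1" and full: "1 - e ^ 16 \<le> P (arm_event n N (sphere_sites N))"
  shows "\<exists>\<alpha>. 0 \<le> \<alpha> \<and> \<alpha> \<le> N \<and> 1 - e \<le> P (arm_event n N ({N} \<times> {0..\<alpha>})) \<and> 1 - e \<le> P (arm_event n N ({N} \<times> {\<alpha>..N}))"
proof -
  let ?right = "{N} \<times> {-N..N}" and ?upper = "{N} \<times> {0..N}"
  let ?sides = "?right \<union> reflect_x ` ?right"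
  have vertical: "z \<in> ?sides" if "\<bar>fst z\<bar> = N" "\<bar>snd z\<bar> \<le> N" for z
  proof (cases "fst z = N")
    case True
    then have "z \<in> ?right" using that by (simp add: mem_Times_iff abs_le_iff)
    then show ?thesis by blast
  next
    case False
    then have "reflect_x z \<in> ?right" using that by (simp add: reflect_x_def mem_Times_iff) linarith
    from imageI[OF this, of reflect_x] show ?thesis by simp
  qed
  have "sphere_sites N \<subseteq> ?sides \<union> prod.swap ` ?sides"
  proof
    fix z assume "z \<in> sphere_sites N"
    then have "\<bar>fst z\<bar> = N \<and> \<bar>snd z\<bar> \<le> N \<or> \<bar>snd z\<bar> = N \<and> \<bar>fst z\<bar> \<le> N"
      by (simp add: sphere_sites_def mem_square) linarith
    then show "z \<in> ?sides \<union> prod.swap ` ?sides"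
    proof
      assume "\<bar>snd z\<bar> = N \<and> \<bar>fst z\<bar> \<le> N"
      from imageI[OF vertical[of "prod.swap z"], of prod.swap] this show ?thesis by simp
    qed (use vertical in blast)
  qed
  then have "P (arm_event n N (sphere_sites N)) \<le> P (arm_event n N (?sides \<union> prod.swap ` ?sides))"
    by (intro percolation.finite_measure_mono arm_event_mono) auto
  then have "1 - (e ^ 8)\<^sup>2 \<le> P (arm_event n N (?sides \<union> prod.swap ` ?sides))" using full by (simp add: power_mult[symmetric])
  from arm_event_halve[OF lattice_automorphisms(3) _ _ this]
  have "1 - (e ^ 4)\<^sup>2 \<le> P (arm_event n N ?sides)" using e by (simp add: power_mult[symmetric])
  from arm_event_halve[OF lattice_automorphisms(1) _ _ this]
  have "1 - (e\<^sup>2)\<^sup>2 \<le> P (arm_event n N ?right)" using e by (simp add: power_mult[symmetric])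
  moreover have "?right \<subseteq> ?upper \<union> reflect_y ` ?upper"
  proof
    fix z assume "z \<in> ?right"
    then show "z \<in> ?upper \<union> reflect_y ` ?upper"
      by (cases "0 \<le> snd z") (auto simp: reflect_y_def image_iff intro!: bexI[of _ "- snd z"])
  qed
  then have "P (arm_event n N ?right) \<le> P (arm_event n N (?upper \<union> reflect_y ` ?upper))"
    by (intro percolation.finite_measure_mono arm_event_mono) auto
  ultimately have "1 - (e\<^sup>2)\<^sup>2 \<le> P (arm_event n N (?upper \<union> reflect_y ` ?upper))" by simp
  from arm_event_halve[OF lattice_automorphisms(2) _ _ this]
  have upper: "1 - e\<^sup>2 \<le> P (arm_event n N ?upper)" using e by simp
  have "e\<^sup>2 \<le> e" using e by (simp add: power2_eq_square mult_left_le)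
  define good where "good k \<longleftrightarrow> 1 - e \<le> P (arm_event n N ({N} \<times> {0..int k}))" for k
  have "good (nat N)" using upper \<open>e\<^sup>2 \<le> e\<close> N by (simp add: good_def)
  \<comment> \<open>By minimality the next shorter lower window is not likely, so the square-root
    trick makes its complement, the window from \<open>k\<close> upwards, likely.\<close>
  define k where "k = (LEAST k. good k)"
  have k: "good k" "k \<le> nat N" "\<And>j. j < k \<Longrightarrow> \<not> good j"
    unfolding k_def using \<open>good (nat N)\<close> by (auto intro: LeastI Least_le dest: not_less_Least)
  have "1 - e \<le> P (arm_event n N ({N} \<times> {int k..N}))"
  \<comment> \<open>For \<open>k = 0\<close> there is no shorter window, but then the upper window
    is all of \<open>?upper\<close>.\<close>
  proof (cases "k = 0")
    case True
    then show ?thesis using upper \<open>e\<^sup>2 \<le> e\<close> by simp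
  next
    case False
    have "?upper = {N} \<times> {0..int (k - 1)} \<union> {N} \<times> {int k..N}" using False k(2) N by auto
    then have "1 - e\<^sup>2 \<le> P (arm_event n N ({N} \<times> {0..int (k - 1)}) \<union> arm_event n N ({N} \<times> {int k..N}))"
      using upper by (simp add: arm_event_Un)
    from sqrt_trick[OF finite_square arm_event_determined arm_event_determined arm_event_increasing arm_event_increasing this]
    show ?thesis using k(3)[of "k - 1"] False e by (simp add: good_def)
  qed
  then show ?thesis using k N by (intro exI[of _ "int k"]) (auto simp: good_def)
qed

lemma locally_unique_in_events [simp]: "locally_unique n N \<in> events"
  unfolding locally_unique_def
  using determined_by_sets[OF finite_square determined_by_restriction[of "square N" "\<lambda>S. \<forall>x\<in>square n. \<forall>y\<in>square n. \<forall>u\<in>sphere_sites N. \<forall>v\<in>sphere_sites N.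
     joined S x u \<longrightarrow> joined S y v \<longrightarrow> joined S x y"]] .

text \<open>Failure is monotone: two sites that reach the sphere of \<open>square N\<close> without
  being joined in \<open>square N\<close> behave in the same way in every smaller box containing
  \<open>square n\<close>. Failure at all scales then yields two distinct infinite clusters, a null
  event by uniqueness.\<close>

lemma locally_unique_tendsto:
  assumes "0 < p" "0 < e" "0 \<le> n"
  shows "\<exists>N0. \<forall>N\<ge>N0. 1 - e \<le> P (locally_unique n N)"
proof -
  define bad where "bad \<eta> N x y \<longleftrightarrow> (\<exists>u\<in>sphere_sites N. \<exists>v\<in>sphere_sites N.
     joined (Collect \<eta> \<inter> square N) x u \<and> joined (Collect \<eta> \<inter> square N) y v \<and> \<not> joined (Collect \<eta> \<inter> square N) x y)" for \<eta> N x y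
  have compl: "- locally_unique n N = {\<eta>. \<exists>x\<in>square n. \<exists>y\<in>square n. bad \<eta> N x y}" for N
    unfolding locally_unique_def bad_def by blast
  have dec: "bad \<eta> M x y" if b: "bad \<eta> N x y" and xy: "x \<in> square n" "y \<in> square n" and NM: "n \<le> M" "M \<le> N" for \<eta> N M x y
  proof (cases "M = N")
    case False
    obtain u v where uv: "u \<in> sphere_sites N" "v \<in> sphere_sites N" "joined (Collect \<eta> \<inter> square N) x u" "joined (Collect \<eta> \<inter> square N) y v"
        "\<not> joined (Collect \<eta> \<inter> square N) x y" using b unfolding bad_def by blast
    have sub: "square n \<subseteq> square M" "square M \<subseteq> square N" "square (M - 1) \<subseteq> square (N - 1)" using NM by (auto intro!: square_mono)
    have out: "w \<notin> square (M - 1)" if "w \<in> sphere_sites N" for w using that sub by (auto simp: sphere_sites_def)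
    have S: "(Collect \<eta> \<inter> square N) \<inter> square M = Collect \<eta> \<inter> square M" using sub by blast
    have "\<exists>u\<in>sphere_sites M. joined (Collect \<eta> \<inter> square M) x u" "\<exists>v\<in>sphere_sites M. joined (Collect \<eta> \<inter> square M) y v"
      using joined_sphere[OF uv(3) _ out[OF uv(1)]] joined_sphere[OF uv(4) _ out[OF uv(2)]] xy sub unfolding S by blast+
    moreover have "\<not> joined (Collect \<eta> \<inter> square M) x y"
      using uv(5) joined_mono[of "Collect \<eta> \<inter> square M" x y "Collect \<eta> \<inter> square N"] sub by blast
    ultimately show ?thesis unfolding bad_def by blast
  qed (use b in simp)
  define D where "D k = - locally_unique n (n + int k)" for k
  have D: "D k \<in> events" for k unfolding D_def using sets.compl_sets[OF locally_unique_in_events[of n "n + int k"]] by (simp add: Compl_eq_Diff_UNIV)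
  have decseq: "decseq D"
    unfolding decseq_def D_def compl
  proof (intro allI impI subsetI CollectI)
    fix k l \<eta> assume kl: "k \<le> l" and "\<eta> \<in> {\<eta>. \<exists>x\<in>square n. \<exists>y\<in>square n. bad \<eta> (n + int l) x y}"
    then obtain x y where "x \<in> square n" "y \<in> square n" "bad \<eta> (n + int l) x y" by blast
    then show "\<exists>x\<in>square n. \<exists>y\<in>square n. bad \<eta> (n + int k) x y"
      using dec[of \<eta> "n + int l" x y "n + int k"] kl by auto
  qed
  have "(\<Inter>k. D k) \<subseteq> - unique_cluster"
  proof
    fix \<eta> assume "\<eta> \<in> (\<Inter>k. D k)"
    then have ex: "\<exists>x\<in>square n. \<exists>y\<in>square n. bad \<eta> (n + int k) x y" for k unfolding D_def compl by blast
    \<comment> \<open>There are finitely many pairs, and a pair that stops being bad at one scale is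
      never bad again; so one pair is bad at all scales.\<close>
    have "\<exists>x\<in>square n. \<exists>y\<in>square n. \<forall>k. bad \<eta> (n + int k) x y"
    proof (rule ccontr)
      assume "\<not> ?thesis"
      then have "\<forall>z\<in>square n \<times> square n. \<exists>k. \<not> bad \<eta> (n + int k) (fst z) (snd z)" by auto
      then obtain \<kappa> where \<kappa>: "\<And>z. z \<in> square n \<times> square n \<Longrightarrow> \<not> bad \<eta> (n + int (\<kappa> z)) (fst z) (snd z)" by metis
      let ?m = "Max (\<kappa> ` (square n \<times> square n))"
      obtain x y where xy: "x \<in> square n" "y \<in> square n" "bad \<eta> (n + int ?m) x y" using ex by blast
      have "\<kappa> (x, y) \<le> ?m" using xy by (intro Max_ge) auto
      then have "bad \<eta> (n + int (\<kappa> (x, y))) x y" using dec[OF xy(3,1,2)] by simp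
      then show False using \<kappa>[of "(x, y)"] xy by simp
    qed
    then obtain x y where xy: "x \<in> square n" "y \<in> square n" and b: "\<And>k. bad \<eta> (n + int k) x y" by blast
    have inf: "infinite_site \<eta> w" if w: "\<And>k. \<exists>u\<in>sphere_sites (n + int k). joined (Collect \<eta> \<inter> square (n + int k)) w u" for w
      unfolding infinite_site_def
    proof
      assume "finite (cluster (Collect \<eta>) w)"
      then obtain m where m: "cluster (Collect \<eta>) w \<subseteq> square m" "0 \<le> m" by (rule finite_subset_square)
      obtain u where u: "u \<in> sphere_sites (n + int (nat (m + 1)))" "joined (Collect \<eta> \<inter> square (n + int (nat (m + 1)))) w u" using w by blast
      have "joined (Collect \<eta>) w u" using joined_mono[OF u(2)] by blast
      then have "u \<in> square m" using m by (auto simp: cluster_def)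
      moreover have "square m \<subseteq> square (n + int (nat (m + 1)) - 1)" using assms m(2) by (intro square_mono) auto
      ultimately show False using u(1) by (auto simp: sphere_sites_def)
    qed
    have "infinite_site \<eta> x" "infinite_site \<eta> y" by (rule inf; use b in \<open>auto simp: bad_def\<close>)+
    moreover have "\<not> joined (Collect \<eta>) x y"
    proof
      assume "joined (Collect \<eta>) x y"
      then obtain k where k: "joined (Collect \<eta> \<inter> square (int k)) x y" using joined_in_square by blast
      have "square (int k) \<subseteq> square (n + int k)" using assms by (intro square_mono) auto
      then have "joined (Collect \<eta> \<inter> square (n + int k)) x y" by (intro joined_mono[OF k]) auto
      then show False using b[of k] by (auto simp: bad_def)
    qed
    ultimately show "\<eta> \<in> - unique_cluster" unfolding unique_cluster_def by blast
  qed
  then have "P (\<Inter>k. D k) \<le> P (- unique_cluster)"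
    using unique_cluster_event sets.compl_sets[OF unique_cluster_event] by (intro percolation.finite_measure_mono) (auto simp: Compl_eq_Diff_UNIV)
  also have "\<dots> = 0"
    using percolation.prob_compl[OF unique_cluster_event] uniqueness[OF assms(1)] by (simp add: Compl_eq_Diff_UNIV)
  finally have "P (\<Inter>k. D k) = 0" using measure_nonneg[of "percolation_measure p" "\<Inter>k. D k"] by linarith
  moreover have "(\<lambda>k. P (D k)) \<longlonglongrightarrow> P (\<Inter>k. D k)"
    by (rule percolation.finite_Lim_measure_decseq) (use D decseq in auto)
  ultimately have "\<forall>\<^sub>F k in sequentially. P (D k) < e" using assms(2) by (simp add: order_tendsto_iff)
  then obtain k0 where k0: "\<And>k. k \<ge> k0 \<Longrightarrow> P (D k) < e" by (auto simp: eventually_sequentially)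
  have "1 - e \<le> P (locally_unique n N)" if "N \<ge> n + int k0" for N
  proof -
    have "P (D (nat (N - n))) < e" using that by (intro k0) auto
    then show ?thesis using percolation.prob_compl[OF locally_unique_in_events[of n N]] that
      by (simp add: D_def Compl_eq_Diff_UNIV)
  qed
  then show ?thesis by blast
qed

end

section \<open>Long crossings of rectangles\<close>

definition window_link :: "int \<Rightarrow> int \<Rightarrow> int \<Rightarrow> site set \<Rightarrow> bool" where
  "window_link \<alpha> n N S \<longleftrightarrow> (\<exists>x\<in>square n. \<exists>a\<in>{0..\<alpha>}. \<exists>b\<in>{0..\<alpha>}. joined S x (N, a) \<and> joined S x (- N, b))"

text \<open>The outer bounds on the ends are left to \<open>S\<close>, which is going to lie in
  \<open>square N\<close>. Having both ends on one side in the same cluster lets it block every path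
  that arrives at that side between them.\<close>

definition corner_link :: "int \<Rightarrow> int \<Rightarrow> int \<Rightarrow> site set \<Rightarrow> bool" where
  "corner_link \<alpha> n N S \<longleftrightarrow> (\<exists>x\<in>square n. \<exists>a\<ge>\<alpha>. \<exists>a'\<le>- \<alpha>. \<exists>b\<ge>\<alpha>. \<exists>b'\<le>- \<alpha>.
     joined S x (N, a) \<and> joined S x (N, a') \<and> joined S x (- N, b) \<and> joined S x (- N, b'))"

definition window_event :: "int \<Rightarrow> int \<Rightarrow> int \<Rightarrow> configuration set" where
  "window_event \<alpha> n N = {\<eta>. window_link \<alpha> n N (Collect \<eta> \<inter> square N)}"

definition corner_event :: "int \<Rightarrow> int \<Rightarrow> int \<Rightarrow> configuration set" where
  "corner_event \<alpha> n N = {\<eta>. corner_link \<alpha> n N (Collect \<eta> \<inter> square N)}"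

definition translated_square :: "site \<Rightarrow> int \<Rightarrow> site set" where
  "translated_square c n = {x. \<bar>fst x - fst c\<bar> \<le> n \<and> \<bar>snd x - snd c\<bar> \<le> n}"

lemma joined_translated_square:
  "joined (Collect (\<eta> \<circ> (+) c) \<inter> square N) x y \<longleftrightarrow> joined (Collect \<eta> \<inter> translated_square c N) (c + x) (c + y)"
proof -
  have "Collect (\<eta> \<circ> (+) c) \<inter> square N = (+) c -` (Collect \<eta> \<inter> translated_square c N)"
    by (auto simp: mem_square translated_square_def)
  then show ?thesis by (simp only: joined_vimage[OF lattice_automorphism_translation])
qed

lemma joined_cluster2: "joined S x y \<Longrightarrow> joined S x z \<Longrightarrow> joined (cluster S x) y z"
  using joined_trans[OF joined_sym[OF joined_via_cluster[OF _ order_refl]] joined_via_cluster[OF _ order_refl]] .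

lemma joined_cluster_meet:
  assumes "cluster S x \<inter> cluster T y \<noteq> {}" "S \<subseteq> U" "T \<subseteq> U"
  shows "joined U x y"
proof -
  obtain s where s: "joined S x s" "joined T y s" using assms(1) by (auto simp: cluster_def)
  show ?thesis using joined_trans[OF joined_mono[OF s(1) assms(2)] joined_sym[OF joined_mono[OF s(2) assms(3)]]] .
qed

text \<open>A corner link at the smaller scale \<open>M\<close> is placed so that its corners on either side lie above and
  below the windows, of size \<open>\<alpha> \<le> 2 \<alpha>'\<close>, of the two neighbouring window links at scale \<open>N\<close>, whose
  squares end on the same vertical lines.\<close>

lemma chain_of_links:
  fixes N M \<alpha> \<alpha>' n :: int and k :: nat and \<eta> :: configuration
  defines "D \<equiv> 2 * (N - M)" and "\<beta> \<equiv> \<alpha> div 2"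
  assumes MN: "0 \<le> M" "M \<le> N" "N \<le> 2 * M" and \<alpha>: "0 \<le> \<alpha>" "\<alpha> \<le> N" "\<alpha> \<le> 2 * \<alpha>'"
    and Z: "\<And>i. i \<le> k \<Longrightarrow> \<eta> \<circ> (+) (int i * D, 0) \<in> window_event \<alpha> n N"
    and X: "\<And>i. i < k \<Longrightarrow> \<eta> \<circ> (+) (int i * D + N - M, \<beta>) \<in> corner_event \<alpha>' n M"
  shows "\<exists>a b. joined (Collect \<eta> \<inter> {- N..int k * D + N} \<times> {- N..2 * N}) (- N, a) (int k * D + N, b)"
proof -
  let ?S = "Collect \<eta> \<inter> {- N..int k * D + N} \<times> {- N..2 * N}"
  let ?Z = "\<lambda>i. Collect \<eta> \<inter> translated_square (int i * D, 0) N"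
  let ?X = "\<lambda>i. Collect \<eta> \<inter> translated_square (int i * D + N - M, \<beta>) M"
  \<comment> \<open>The spacing \<open>D\<close> is chosen so that \<open>?X i\<close> shares its
    right side with that of \<open>?Z i\<close> and its left side with that of
    \<open>?Z (Suc i)\<close>.\<close>
  have D: "0 \<le> D" using MN by (simp add: D_def)
  \<comment> \<open>Centring the corner link at half the window gives
    \<open>\<beta> + \<alpha>' \<ge> \<alpha>\<close> and
    \<open>\<beta> - \<alpha>' \<le> 0\<close>, also for odd \<open>\<alpha>\<close>: the window
    \<open>{0..\<alpha>}\<close> lies between the corner ends.\<close>
  have \<beta>: "0 \<le> \<beta>" "2 * \<beta> \<le> \<alpha>" "\<alpha> \<le> 2 * \<beta> + 1" using \<alpha> by (auto simp: \<beta>_def)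
  have iD: "int i * D \<le> int k * D" if "i \<le> k" for i using that D by (simp add: mult_right_mono)
  have iD0: "0 \<le> int i * D" for i using D by simp
  have "\<exists>x a b. 0 \<le> a \<and> a \<le> \<alpha> \<and> joined (?Z i) x (int i * D + N, a) \<and> 0 \<le> b \<and> b \<le> \<alpha> \<and> joined (?Z i) x (int i * D - N, b)" if "i \<le> k" for i
    using Z[OF that] unfolding window_event_def window_link_def mem_Collect_eq joined_translated_square
    by (fastforce simp: algebra_simps)
  then obtain x a b where x: "\<And>i. i \<le> k \<Longrightarrow> 0 \<le> a i \<and> a i \<le> \<alpha> \<and> joined (?Z i) (x i) (int i * D + N, a i) \<and> 0 \<le> b i \<and> b i \<le> \<alpha> \<and> joined (?Z i) (x i) (int i * D - N, b i)"
    by metis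
  have "\<exists>w a a' b b'. a \<ge> \<beta> + \<alpha>' \<and> a' \<le> \<beta> - \<alpha>' \<and> b \<ge> \<beta> + \<alpha>' \<and> b' \<le> \<beta> - \<alpha>' \<and>
     joined (?X i) w (int i * D + N, a) \<and> joined (?X i) w (int i * D + N, a') \<and>
     joined (?X i) w (int i * D + N - 2 * M, b) \<and> joined (?X i) w (int i * D + N - 2 * M, b')" if i: "i < k" for i
  proof -
    let ?c = "(int i * D + N - M, \<beta>)"
    obtain w a a' b b' where "\<alpha>' \<le> a" "a' \<le> - \<alpha>'" "\<alpha>' \<le> b" "b' \<le> - \<alpha>'"
      "joined (?X i) (?c + w) (?c + (M, a))" "joined (?X i) (?c + w) (?c + (M, a'))"
      "joined (?X i) (?c + w) (?c + (- M, b))" "joined (?X i) (?c + w) (?c + (- M, b'))"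
      using X[OF i] unfolding corner_event_def corner_link_def mem_Collect_eq joined_translated_square by blast
    then show ?thesis
      by (intro exI[of _ "?c + w"] exI[of _ "\<beta> + a"] exI[of _ "\<beta> + a'"] exI[of _ "\<beta> + b"] exI[of _ "\<beta> + b'"]) (simp add: algebra_simps)
  qed
  then obtain w c c' d d' where w: "\<And>i. i < k \<Longrightarrow> c i \<ge> \<beta> + \<alpha>' \<and> c' i \<le> \<beta> - \<alpha>' \<and> d i \<ge> \<beta> + \<alpha>' \<and> d' i \<le> \<beta> - \<alpha>' \<and>
     joined (?X i) (w i) (int i * D + N, c i) \<and> joined (?X i) (w i) (int i * D + N, c' i) \<and>
     joined (?X i) (w i) (int i * D + N - 2 * M, d i) \<and> joined (?X i) (w i) (int i * D + N - 2 * M, d' i)"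
    by metis
  have ZS: "?Z i \<subseteq> ?S" if "i \<le> k" for i
  proof
    fix s assume "s \<in> ?Z i"
    then show "s \<in> ?S" using iD[OF that] iD0[of i] MN by (auto simp: translated_square_def mem_Times_iff abs_le_iff)
  qed
  \<comment> \<open>The raised squares decide the height of the strip: \<open>\<beta> + M\<close> is
    at most \<open>N div 2 + N\<close>, and \<open>\<beta> - M\<close> is at least
    \<open>- N\<close>.\<close>
  have XS: "?X i \<subseteq> ?S" if "i < k" for i
  proof
    fix s assume s: "s \<in> ?X i"
    have "int i * D + D \<le> int k * D" using iD[of "Suc i"] that by (simp add: algebra_simps)
    then have "int i * D + N \<le> int k * D + N" using D by simp
    then show "s \<in> ?S" using s iD0[of i] MN \<beta> \<alpha> by (auto simp: translated_square_def mem_Times_iff abs_le_iff)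
  qed
  \<comment> \<open>The window cluster of \<open>?Z i\<close> comes from left of
    \<open>?X i\<close>, as \<open>M \<le> N\<close>, and ends on the common right side between the
    two corner ends.\<close>
  have xw: "joined ?S (x i) (w i)" if i: "i < k" for i
  proof (rule joined_cluster_meet[OF _ ZS XS])
    note xi = x[of i] and wi = w[OF i]
    have i': "i \<le> k" using i by simp
    show "cluster (?Z i) (x i) \<inter> cluster (?X i) (w i) \<noteq> {}"
    proof (rule window_crossing[where R = "int i * D + N" and L = "int i * D + N - 2 * M" and w = "a i" and c = "- N" and d = N])
      show "joined (cluster (?X i) (w i)) (int i * D + N, c i) (int i * D + N, c' i)"
        using wi joined_cluster2 by blast
      show "joined (cluster (?Z i) (x i)) (int i * D - N, b i) (int i * D + N, a i)"
        using xi[OF i'] joined_cluster2 by blast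
      show "int i * D + N - 2 * M \<le> fst s \<and> fst s \<le> int i * D + N" if "s \<in> cluster (?X i) (w i)" for s
        using subsetD[OF cluster_subset that] by (simp add: translated_square_def abs_le_iff)
      show "fst s \<le> int i * D + N" "- N \<le> snd s \<and> snd s \<le> N" if "s \<in> cluster (?Z i) (x i)" for s
        using subsetD[OF cluster_subset that] by (simp_all add: translated_square_def abs_le_iff)
      show "c' i \<le> a i" "a i \<le> c i" "fst (int i * D - N, b i) \<le> int i * D + N - 2 * M"
        using xi[OF i'] wi \<alpha> \<beta> MN by auto
    qed
  qed (use i in auto)
  have wx: "joined ?S (x (Suc i)) (w i)" if i: "i < k" for i
  proof (rule joined_cluster_meet[OF _ ZS XS])
    note xi = x[of "Suc i"] and wi = w[OF i]
    have i': "Suc i \<le> k" using i by simp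
    have left: "int (Suc i) * D - N = int i * D + N - 2 * M" by (simp add: D_def algebra_simps)
    show "cluster (?Z (Suc i)) (x (Suc i)) \<inter> cluster (?X i) (w i) \<noteq> {}"
    proof (rule window_crossing_left[where L = "int i * D + N - 2 * M" and R = "int i * D + N" and w = "b (Suc i)" and c = "- N" and d = N])
      show "joined (cluster (?X i) (w i)) (int i * D + N - 2 * M, d i) (int i * D + N - 2 * M, d' i)"
        using wi joined_cluster2 by blast
      show "joined (cluster (?Z (Suc i)) (x (Suc i))) (int (Suc i) * D + N, a (Suc i)) (int i * D + N - 2 * M, b (Suc i))"
        using xi[OF i'] joined_cluster2 unfolding left by blast
      show "int i * D + N - 2 * M \<le> fst s \<and> fst s \<le> int i * D + N" if "s \<in> cluster (?X i) (w i)" for s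
        using subsetD[OF cluster_subset that] by (simp add: translated_square_def abs_le_iff)
      show "int i * D + N - 2 * M \<le> fst s" "- N \<le> snd s \<and> snd s \<le> N" if "s \<in> cluster (?Z (Suc i)) (x (Suc i))" for s
        using subsetD[OF cluster_subset that] left[symmetric] by (simp_all add: translated_square_def abs_le_iff)
      show "d' i \<le> b (Suc i)" "b (Suc i) \<le> d i" "int i * D + N \<le> fst (int (Suc i) * D + N, a (Suc i))"
        using xi[OF i'] wi \<alpha> \<beta> MN D by (auto simp: algebra_simps)
    qed
  qed (use i in auto)
  have "j \<le> k \<Longrightarrow> joined ?S (x 0) (x j)" for j
  proof (induction j)
    case 0
    have "x 0 \<in> ?Z 0" using x[of 0] joined_in by blast
    then show ?case using ZS[of 0] by (intro joined_refl) auto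
  next
    case (Suc j)
    then have "joined ?S (x 0) (x j)" "j < k" by auto
    then show ?case using xw[of j] wx[of j] joined_trans joined_sym by meson
  qed
  then have "joined ?S (x 0) (x k)" by simp
  moreover have "joined ?S (x 0) (- N, b 0)" using x[of 0] joined_mono[OF _ ZS[of 0]] by auto
  moreover have "joined ?S (x k) (int k * D + N, a k)" using x[of k] joined_mono[OF _ ZS[of k]] by auto
  ultimately show ?thesis using joined_trans joined_sym by meson
qed

text \<open>\<open>L\<close> rows but \<open>2 * L + 1\<close> columns: two strips of
  \<open>L\<close> rows fill exactly the rows of the doubled rectangle without overlap, and a
  crossing overshoots a rectangle of thickness \<open>2 * L\<close> by one column.\<close>

definition hcrossing :: "int \<Rightarrow> int \<Rightarrow> int \<Rightarrow> configuration set" where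
  "hcrossing x0 y0 L = {\<eta>. \<exists>a b. joined (Collect \<eta> \<inter> {x0..x0 + 2 * L} \<times> {y0..y0 + L - 1}) (x0, a) (x0 + 2 * L, b)}"

definition vcrossing :: "int \<Rightarrow> int \<Rightarrow> int \<Rightarrow> configuration set" where
  "vcrossing x0 y0 L = {\<eta>. \<exists>a b. joined (Collect \<eta> \<inter> {x0..x0 + L - 1} \<times> {y0..y0 + 2 * L}) (a, y0) (b, y0 + 2 * L)}"

lemma hcrossing_determined: "determined_by ({x0..x0 + 2 * L} \<times> {y0..y0 + L - 1}) (hcrossing x0 y0 L)"
  unfolding hcrossing_def by (rule determined_by_restriction)

lemma vcrossing_determined: "determined_by ({x0..x0 + L - 1} \<times> {y0..y0 + 2 * L}) (vcrossing x0 y0 L)"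
  unfolding vcrossing_def by (rule determined_by_restriction)

text \<open>If \<open>\<alpha> (3 M / 2) > 2 \<alpha> M\<close> held at all scales, then \<open>\<alpha>\<close> would grow faster than its bound \<open>\<alpha> M \<le> M\<close> allows.\<close>

lemma slow_scale:
  fixes \<alpha> :: "int \<Rightarrow> int"
  assumes "\<And>N. N \<ge> N0 \<Longrightarrow> 0 \<le> \<alpha> N \<and> \<alpha> N \<le> N"
  shows "\<exists>M\<ge>N0. 2 \<le> M \<and> \<alpha> (3 * M div 2) \<le> 2 * \<alpha> M"
proof (rule ccontr)
  assume "\<not> ?thesis"
  \<comment> \<open>Strictness over the integers yields the extra 1, without which
    \<open>\<alpha>\<close> could stay 0 forever; with it, \<open>k\<close> iterations give at least
    \<open>2 ^ k - 1\<close>.\<close>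
  then have grow: "2 * \<alpha> M + 1 \<le> \<alpha> (3 * M div 2)" if "M \<ge> N0" "2 \<le> M" for M using that by force
  define m where "m k = ((\<lambda>M. 3 * M div 2) ^^ k) (max N0 2)" for k
  have m_Suc: "m (Suc k) = 3 * m k div 2" for k by (simp add: m_def)
  have m_ge: "m k \<ge> N0 \<and> m k \<ge> 2" for k
  proof (induction k)
    case 0
    show ?case by (simp add: m_def)
  next
    case (Suc k)
    then have "m k \<le> 3 * m k div 2" by presburger
    then show ?case using Suc unfolding m_Suc by linarith
  qed
  have "2 ^ k - 1 \<le> \<alpha> (m k)" for k
  proof (induction k)
    case 0
    then show ?case using assms m_ge[of 0] by auto
  next
    case (Suc k)
    then show ?case using grow[of "m k"] m_ge[of k] by (simp add: m_Suc)
  qed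
  then have "real_of_int (2 ^ k - 1) \<le> \<alpha> (m k)" for k by (simp only: of_int_le_iff)
  moreover have "real_of_int (\<alpha> (m k)) \<le> m k" for k using assms m_ge[of k] by simp
  moreover have "real_of_int (m k) \<le> (3 / 2) ^ k * m 0" for k
  proof (induction k)
    case (Suc k)
    have "real_of_int (m (Suc k)) \<le> 3 / 2 * m k" by (simp add: m_Suc)
    also have "\<dots> \<le> 3 / 2 * ((3 / 2) ^ k * m 0)" using Suc by (intro mult_left_mono) auto
    finally show ?case by simp
  qed simp
  ultimately have "real_of_int (2 ^ k - 1) \<le> (3 / 2) ^ k * m 0" for k
    by (meson of_int_le_iff order_trans)
  then have upper: "(2::real) ^ k - 1 \<le> (3 / 2) ^ k * m 0" for k by simp
  \<comment> \<open>4/3 is the quotient of the growth rates 2 and 3/2.\<close>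
  obtain k where k: "real_of_int (m 0) + 1 < (4 / 3) ^ k" using real_arch_pow[of "4 / 3"] by auto
  have "(3 / 2) ^ k * (real_of_int (m 0) + 1) < (3 / 2) ^ k * (4 / 3) ^ k"
    using k by (intro mult_strict_left_mono) auto
  also have "\<dots> = (2::real) ^ k" by (simp add: power_mult_distrib[symmetric])
  finally have "(3 / 2) ^ k * real_of_int (m 0) + (3 / 2) ^ k < 2 ^ k" by (simp add: algebra_simps)
  moreover have "(1::real) \<le> (3 / 2) ^ k" by simp
  ultimately show False using upper[of k] by linarith
qed

context site_percolation
begin

lemma crossing_in_events [simp]: "hcrossing x0 y0 L \<in> events" "vcrossing x0 y0 L \<in> events"
  using determined_by_sets[OF _ hcrossing_determined] determined_by_sets[OF _ vcrossing_determined] by simp_all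

lemma prob_hcrossing: "P (hcrossing x0 y0 L) = P (hcrossing 0 0 L)"
proof -
  have "Collect (\<eta> \<circ> (+) (x0, y0)) \<inter> {0..2 * L} \<times> {0..L - 1} =
      (+) (x0, y0) -` (Collect \<eta> \<inter> {x0..x0 + 2 * L} \<times> {y0..y0 + L - 1})" for \<eta> by auto
  note eq = this
  let ?J = "\<lambda>\<eta>. joined (Collect \<eta> \<inter> {x0..x0 + 2 * L} \<times> {y0..y0 + L - 1})"
  have "\<eta> \<circ> (+) (x0, y0) \<in> hcrossing 0 0 L \<longleftrightarrow> (\<exists>a b. ?J \<eta> (x0, y0 + a) (x0 + 2 * L, y0 + b))" for \<eta>
    unfolding hcrossing_def mem_Collect_eq add_0 eq joined_vimage[OF lattice_automorphism_translation] by simp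
  moreover have "(\<exists>a b. ?J \<eta> (x0, y0 + a) (x0 + 2 * L, y0 + b)) \<longleftrightarrow> (\<exists>a b. ?J \<eta> (x0, a) (x0 + 2 * L, b))" for \<eta>
  proof
    assume "\<exists>a b. ?J \<eta> (x0, a) (x0 + 2 * L, b)"
    then obtain a b where "?J \<eta> (x0, y0 + (a - y0)) (x0 + 2 * L, y0 + (b - y0))" by auto
    then show "\<exists>a b. ?J \<eta> (x0, y0 + a) (x0 + 2 * L, y0 + b)" by blast
  qed blast
  ultimately have "\<eta> \<circ> (+) (x0, y0) \<in> hcrossing 0 0 L \<longleftrightarrow> \<eta> \<in> hcrossing x0 y0 L" for \<eta>
    by (simp only: hcrossing_def mem_Collect_eq)
  then have "{\<eta>. \<eta> \<circ> (+) (x0, y0) \<in> hcrossing 0 0 L} = hcrossing x0 y0 L" by simp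
  then show ?thesis using reindex(2)[of "(+) (x0, y0)" "hcrossing 0 0 L"] by simp
qed

lemma prob_vcrossing: "P (vcrossing x0 y0 L) = P (hcrossing 0 0 L)"
proof -
  have "Collect (\<eta> \<circ> prod.swap) \<inter> {y0..y0 + 2 * L} \<times> {x0..x0 + L - 1} =
      prod.swap -` (Collect \<eta> \<inter> {x0..x0 + L - 1} \<times> {y0..y0 + 2 * L})" for \<eta> by auto
  note eq = this
  have "\<eta> \<circ> prod.swap \<in> hcrossing y0 x0 L \<longleftrightarrow> \<eta> \<in> vcrossing x0 y0 L" for \<eta>
    unfolding hcrossing_def vcrossing_def mem_Collect_eq eq joined_vimage[OF lattice_automorphisms(3)] by simp
  then have "{\<eta>. \<eta> \<circ> prod.swap \<in> hcrossing y0 x0 L} = vcrossing x0 y0 L" by simp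
  then show ?thesis using reindex(2)[of prod.swap "hcrossing y0 x0 L"] prob_hcrossing by (simp add: bij_swap)
qed

lemma prob_Int_ge:
  assumes "A \<in> events" "B \<in> events" "1 - a \<le> P A" "1 - b \<le> P B"
  shows "1 - (a + b) \<le> P (A \<inter> B)"
proof -
  have "P (A \<union> B) = P A + P B - P (A \<inter> B)"
    using assms by (simp add: percolation.finite_measure_Union' percolation.finite_measure_Diff' Int_commute)
  then show ?thesis using percolation.prob_le_1[of p "A \<union> B"] assms by linarith
qed

lemma prob_INT_ge:
  fixes A :: "nat \<Rightarrow> configuration set"
  assumes "\<And>i. i < k \<Longrightarrow> A i \<in> events" "\<And>i. i < k \<Longrightarrow> 1 - a \<le> P (A i)"
  shows "1 - real k * a \<le> P (\<Inter>i<k. A i) \<and> (\<Inter>i<k. A i) \<in> events"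
  using assms
proof (induction k)
  case 0
  then show ?case using percolation.prob_space[of p] sets.top[of "percolation_measure p"] by simp
next
  case (Suc k)
  have "(\<Inter>i<Suc k. A i) = A k \<inter> (\<Inter>i<k. A i)" by (auto simp: lessThan_Suc)
  then show ?case using Suc prob_Int_ge[of "A k" "\<Inter>i<k. A i" a "real k * a"] by (auto simp: algebra_simps)
qed

lemma link_events_in_events [simp]: "window_event \<alpha> n N \<in> events" "corner_event \<alpha> n N \<in> events"
  unfolding window_event_def corner_event_def
  using determined_by_sets[OF finite_square determined_by_restriction] by blast+

text \<open>Reflections carry the two likely arms to all windows and corners, and local uniqueness
  merges the arms into one cluster. The errors count two arms, respectively four, plus one for
  uniqueness.\<close>

lemma link_probabilities:
  assumes N: "0 \<le> N" and \<alpha>: "0 \<le> \<alpha>" "\<alpha> \<le> N" and lu: "1 - e \<le> P (locally_unique n N)"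
    and lo: "1 - e \<le> P (arm_event n N ({N} \<times> {0..\<alpha>}))" and hi: "1 - e \<le> P (arm_event n N ({N} \<times> {\<alpha>..N}))"
  shows "1 - 3 * e \<le> P (window_event \<alpha> n N)" "1 - 5 * e \<le> P (corner_event \<alpha> n N)"
proof -
  let ?A = "arm_event n N"
  have sphere: "(N, a) \<in> sphere_sites N" "(- N, a) \<in> sphere_sites N" if "\<bar>a\<bar> \<le> N" for a
    using that N by (auto simp: sphere_sites_def mem_square)
  have rx: "1 - e \<le> P (?A ({- N} \<times> I))" if "1 - e \<le> P (?A ({N} \<times> I))" for I
  proof -
    have "reflect_x ` ({N} \<times> I) = {- N} \<times> I" by (force simp: reflect_x_def)
    then show ?thesis using arm_event_symmetric[OF lattice_automorphisms(1), of n N "{N} \<times> I"] that by simp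
  qed
  have "reflect_y ` ({N} \<times> {\<alpha>..N}) = {N} \<times> {- N..- \<alpha>}"
    by (auto simp: reflect_y_def image_iff intro!: bexI[of _ "- _"])
  then have lo': "1 - e \<le> P (?A ({N} \<times> {- N..- \<alpha>}))"
    using arm_event_symmetric[OF lattice_automorphisms(2), of n N "{N} \<times> {\<alpha>..N}"] hi by simp
  have "1 - (e + (e + e)) \<le> P (?A ({N} \<times> {0..\<alpha>}) \<inter> (?A ({- N} \<times> {0..\<alpha>}) \<inter> locally_unique n N))"
    by (intro prob_Int_ge sets.Int lo rx[OF lo] lu) simp_all
  also have "\<dots> \<le> P (window_event \<alpha> n N)"
  proof (rule percolation.finite_measure_mono)
    show "?A ({N} \<times> {0..\<alpha>}) \<inter> (?A ({- N} \<times> {0..\<alpha>}) \<inter> locally_unique n N) \<subseteq> window_event \<alpha> n N"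
    proof
      fix \<eta> assume \<eta>: "\<eta> \<in> ?A ({N} \<times> {0..\<alpha>}) \<inter> (?A ({- N} \<times> {0..\<alpha>}) \<inter> locally_unique n N)"
      let ?S = "Collect \<eta> \<inter> square N"
      obtain x a where x: "x \<in> square n" "a \<in> {0..\<alpha>}" "joined ?S x (N, a)" using \<eta> by (auto simp: arm_event_def arm_def)
      obtain y b where y: "y \<in> square n" "b \<in> {0..\<alpha>}" "joined ?S y (- N, b)" using \<eta> by (auto simp: arm_event_def arm_def)
      have "(N, a) \<in> sphere_sites N" "(- N, b) \<in> sphere_sites N" using sphere x(2) y(2) \<alpha> by auto
      then have "joined ?S x y" using \<eta> x y unfolding locally_unique_def by blast
      then have "joined ?S x (- N, b)" using y(3) joined_trans by blast
      then show "\<eta> \<in> window_event \<alpha> n N" using x y(2) unfolding window_event_def window_link_def by blast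
    qed
  qed simp
  finally show "1 - 3 * e \<le> P (window_event \<alpha> n N)" by simp
  let ?I = "?A ({N} \<times> {\<alpha>..N}) \<inter> (?A ({N} \<times> {- N..- \<alpha>}) \<inter> (?A ({- N} \<times> {\<alpha>..N}) \<inter> (?A ({- N} \<times> {- N..- \<alpha>}) \<inter> locally_unique n N)))"
  have "1 - (e + (e + (e + (e + e)))) \<le> P ?I"
    by (intro prob_Int_ge sets.Int lo' hi rx[OF lo'] rx[OF hi] lu) simp_all
  also have "\<dots> \<le> P (corner_event \<alpha> n N)"
  proof (rule percolation.finite_measure_mono)
    show "?I \<subseteq> corner_event \<alpha> n N"
    proof
      fix \<eta> assume \<eta>: "\<eta> \<in> ?I"
      let ?S = "Collect \<eta> \<inter> square N"
      have lu: "joined ?S x y" if "joined ?S x u" "joined ?S y v" "x \<in> square n" "y \<in> square n" "u \<in> sphere_sites N" "v \<in> sphere_sites N" for x y u v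
        using \<eta> that unfolding locally_unique_def by blast
      obtain x a where x: "x \<in> square n" "a \<in> {\<alpha>..N}" "joined ?S x (N, a)" using \<eta> by (auto simp: arm_event_def arm_def)
      have *: "joined ?S x v" if "y \<in> square n" "joined ?S y v" "v \<in> sphere_sites N" for y v
        using lu[OF x(3) that(2) x(1) that(1) _ that(3)] sphere(1)[of a] x(2) \<alpha> that(2) joined_trans by auto
      obtain y a' where y: "y \<in> square n" "a' \<in> {- N..- \<alpha>}" "joined ?S y (N, a')" using \<eta> by (auto simp: arm_event_def arm_def)
      obtain z b where z: "z \<in> square n" "b \<in> {\<alpha>..N}" "joined ?S z (- N, b)" using \<eta> by (auto simp: arm_event_def arm_def)
      obtain t b' where t: "t \<in> square n" "b' \<in> {- N..- \<alpha>}" "joined ?S t (- N, b')" using \<eta> by (auto simp: arm_event_def arm_def)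
      have "joined ?S x (N, a')" "joined ?S x (- N, b)" "joined ?S x (- N, b')"
        using *[OF y(1,3)] *[OF z(1,3)] *[OF t(1,3)] sphere[of a'] sphere[of b] sphere[of b'] y(2) z(2) t(2) \<alpha> by auto
      moreover have "\<alpha> \<le> a" "a' \<le> - \<alpha>" "\<alpha> \<le> b" "b' \<le> - \<alpha>" using x y z t by auto
      ultimately show "\<eta> \<in> corner_event \<alpha> n N" using x(1,3) unfolding corner_event_def corner_link_def mem_Collect_eq by blast
    qed
  qed simp
  finally show "1 - 5 * e \<le> P (corner_event \<alpha> n N)" by simp
qed

lemma infinite_cluster_0_1: "P {\<eta>. \<exists>x. infinite_site \<eta> x} = 0 \<or> P {\<eta>. \<exists>x. infinite_site \<eta> x} = 1"
proof (rule translation_invariant_0_1)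
  show "{\<eta>. \<exists>x. infinite_site \<eta> x} \<in> events" by (rule event_Collect) measurable
  show "\<eta> \<circ> (+) v \<in> {\<eta>. \<exists>x. infinite_site \<eta> x}" if inf: "\<eta> \<in> {\<eta>. \<exists>x. infinite_site \<eta> x}" for v \<eta>
  proof -
    obtain x where "infinite_site \<eta> x" using inf by blast
    then have "infinite_site (\<eta> \<circ> (+) v) (x - v)" unfolding infinite_site_translation by simp
    then show ?thesis by blast
  qed
qed

text \<open>A box that meets an infinite cluster has arms to all larger spheres at once, so one
  \<open>n\<close> serves every \<open>N\<close>.\<close>

lemma arms_likely:
  assumes one: "P {\<eta>. \<exists>x. infinite_site \<eta> x} = 1" and e: "0 < e"
  shows "\<exists>n\<ge>0. \<forall>N\<ge>n. 1 - e \<le> P (arm_event n N (sphere_sites N))"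
proof -
  define A where "A n = {\<eta>. \<exists>x\<in>square (int n). infinite_site \<eta> x}" for n
  have A: "A n \<in> events" for n unfolding A_def by (rule event_Collect) measurable
  have "(\<lambda>n. P (A n)) \<longlonglongrightarrow> P (\<Union>n. A n)"
  proof (rule percolation.finite_Lim_measure_incseq)
    show "incseq A"
    proof (rule incseq_SucI, rule subsetI)
      fix n \<eta> assume "\<eta> \<in> A n"
      moreover have "square (int n) \<subseteq> square (int (Suc n))" by (rule square_mono) simp
      ultimately show "\<eta> \<in> A (Suc n)" unfolding A_def by blast
    qed
  qed (use A in auto)
  moreover have "(\<Union>n. A n) = {\<eta>. \<exists>x. infinite_site \<eta> x}"
  proof
    show "{\<eta>. \<exists>x. infinite_site \<eta> x} \<subseteq> (\<Union>n. A n)"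
    proof
      fix \<eta> assume "\<eta> \<in> {\<eta>. \<exists>x. infinite_site \<eta> x}"
      then obtain x where x: "infinite_site \<eta> x" by blast
      obtain m where "{x} \<subseteq> square m" "0 \<le> m" using finite_subset_square[of "{x}"] by auto
      then have "\<eta> \<in> A (nat m)" using x unfolding A_def by auto
      then show "\<eta> \<in> (\<Union>n. A n)" by blast
    qed
  qed (auto simp: A_def)
  ultimately have "\<forall>\<^sub>F n in sequentially. 1 - e < P (A n)" using one e by (simp add: order_tendsto_iff)
  then obtain n where n: "1 - e < P (A n)" using eventually_happens trivial_limit_sequentially by blast
  have "1 - e \<le> P (arm_event (int n) N (sphere_sites N))" if N: "N \<ge> int n" for N
  proof -
    have "A n \<subseteq> arm_event (int n) N (sphere_sites N)"
    proof
      fix \<eta> assume "\<eta> \<in> A n"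
      then obtain x where x: "x \<in> square (int n)" "infinite_site \<eta> x" unfolding A_def by blast
      then have "x \<in> square N" using square_mono[OF N] by blast
      from infinite_cluster_reaches_sphere[OF x(2)[unfolded infinite_site_def] this]
      show "\<eta> \<in> arm_event (int n) N (sphere_sites N)" using x(1) unfolding arm_event_def arm_def by blast
    qed
    then have "P (A n) \<le> P (arm_event (int n) N (sphere_sites N))" by (intro percolation.finite_measure_mono) auto
    then show ?thesis using n by simp
  qed
  then show ?thesis by (intro exI[of _ "int n"]) auto
qed

theorem long_crossing_likely:
  assumes p: "0 < p" and inf: "P {\<eta>. \<exists>x. infinite_site \<eta> x} \<noteq> 0"
  shows "\<exists>L\<ge>1. P (hcrossing 0 0 L) > 1 - 1 / 100"
proof -
  \<comment> \<open>The chain uses 15 window links and 14 corner links, with total error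
    \<open>15 * 3 * e + 14 * 5 * e = 115 * e\<close>, which is below 1/100.\<close>
  define e :: real where "e = 1 / 20000"
  have one: "P {\<eta>. \<exists>x. infinite_site \<eta> x} = 1" using infinite_cluster_0_1 inf by blast
  have e: "0 < e" "e < 1" by (simp_all add: e_def)
  obtain n where n: "0 \<le> n" "\<And>N. N \<ge> n \<Longrightarrow> 1 - e ^ 16 \<le> P (arm_event n N (sphere_sites N))"
    using arms_likely[OF one, of "e ^ 16"] e by auto
  obtain N1 where N1: "\<And>N. N \<ge> N1 \<Longrightarrow> 1 - e \<le> P (locally_unique n N)"
    using locally_unique_tendsto[OF p e(1) n(1)] by blast
  define N0 where "N0 = max n N1"
  have "\<exists>\<alpha>. 0 \<le> \<alpha> \<and> \<alpha> \<le> N \<and> 1 - 3 * e \<le> P (window_event \<alpha> n N) \<and> 1 - 5 * e \<le> P (corner_event \<alpha> n N)" if N: "N \<ge> N0" for N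
  proof -
    have N': "0 \<le> N" "n \<le> N" "N1 \<le> N" using N n(1) by (auto simp: N0_def)
    obtain \<alpha> where "0 \<le> \<alpha>" "\<alpha> \<le> N" "1 - e \<le> P (arm_event n N ({N} \<times> {0..\<alpha>}))" "1 - e \<le> P (arm_event n N ({N} \<times> {\<alpha>..N}))"
      using arm_window[OF N'(1) e n(2)[OF N'(2)]] by blast
    then show ?thesis using link_probabilities[OF N'(1) _ _ N1[OF N'(3)]] by blast
  qed
  then obtain \<alpha> where \<alpha>: "\<And>N. N \<ge> N0 \<Longrightarrow> 0 \<le> \<alpha> N \<and> \<alpha> N \<le> N \<and> 1 - 3 * e \<le> P (window_event (\<alpha> N) n N) \<and> 1 - 5 * e \<le> P (corner_event (\<alpha> N) n N)"
    by metis
  obtain M where M: "M \<ge> N0" "2 \<le> M" "\<alpha> (3 * M div 2) \<le> 2 * \<alpha> M"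
    using slow_scale[of N0 \<alpha>] \<alpha> by blast
  define N where "N = 3 * M div 2"
  have MN: "M \<le> N" "N \<le> 2 * M" "2 * N \<le> 3 * M" "3 * M - 1 \<le> 2 * N" using M(2) by (auto simp: N_def)
  define D where "D = 2 * (N - M)"
  \<comment> \<open>The number of rows of the strip \<open>{- N..2 * N}\<close> that contains the
    chain.\<close>
  define L where "L = 3 * N + 1"
  let ?Z = "\<lambda>i :: nat. {\<eta>. \<eta> \<circ> (+) (int i * D, 0) \<in> window_event (\<alpha> N) n N}"
  let ?X = "\<lambda>i :: nat. {\<eta>. \<eta> \<circ> (+) (int i * D + N - M, \<alpha> N div 2) \<in> corner_event (\<alpha> M) n M}"
  have Z: "?Z i \<in> events" "1 - 3 * e \<le> P (?Z i)" for i
    using reindex[of "(+) (int i * D, 0)" "window_event (\<alpha> N) n N"] \<alpha>[of N] MN M(1) by auto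
  have X: "?X i \<in> events" "1 - 5 * e \<le> P (?X i)" for i
    using reindex[of "(+) (int i * D + N - M, \<alpha> N div 2)" "corner_event (\<alpha> M) n M"] \<alpha>[OF M(1)] by auto
  have "1 - (real 15 * (3 * e) + real 14 * (5 * e)) \<le> P ((\<Inter>i<15. ?Z i) \<inter> (\<Inter>i<14. ?X i))"
    using prob_INT_ge[of 15 ?Z, OF Z] prob_INT_ge[of 14 ?X, OF X] by (intro prob_Int_ge) auto
  also have "\<dots> \<le> P (hcrossing (14 * D + N - 2 * L) (- N) L)"
  proof (rule percolation.finite_measure_mono)
    show "(\<Inter>i<15. ?Z i) \<inter> (\<Inter>i<14. ?X i) \<subseteq> hcrossing (14 * D + N - 2 * L) (- N) L"
    proof
      fix \<eta> assume \<eta>: "\<eta> \<in> (\<Inter>i<15. ?Z i) \<inter> (\<Inter>i<14. ?X i)"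
      have "\<exists>a b. joined (Collect \<eta> \<inter> {- N..int 14 * (2 * (N - M)) + N} \<times> {- N..2 * N}) (- N, a) (int 14 * (2 * (N - M)) + N, b)"
      proof (rule chain_of_links)
        show "\<eta> \<circ> (+) (int i * (2 * (N - M)), 0) \<in> window_event (\<alpha> N) n N" if "i \<le> 14" for i
          using \<eta> that by (auto simp: D_def)
        show "\<eta> \<circ> (+) (int i * (2 * (N - M)) + N - M, \<alpha> N div 2) \<in> corner_event (\<alpha> M) n M" if "i < 14" for i
          using \<eta> that by (auto simp: D_def)
      qed (use MN M \<alpha>[of N] in \<open>auto simp: N_def[symmetric]\<close>)
      then obtain a b where ab: "joined (Collect \<eta> \<inter> {- N..14 * D + N} \<times> {- N..2 * N}) (- N, a) (14 * D + N, b)"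
        unfolding D_def by auto
      define x0 where "x0 = 14 * D + N - 2 * L"
      \<comment> \<open>Fourteen steps suffice: \<open>D \<ge> M - 1\<close>, and
        \<open>14 * (M - 1) \<ge> 6 * M + 2\<close> for \<open>M \<ge> 2\<close>, with equality at
        2. As \<open>2 * N \<le> 3 * M\<close>, the length \<open>14 * D + 2 * N\<close> is at least
        \<open>6 * N + 2 = 2 * L\<close>; the excess is cut off on the left.\<close>
      have x0: "- N \<le> x0" "x0 \<le> 14 * D + N" "x0 + 2 * L = 14 * D + N" using MN M(2) by (auto simp: x0_def D_def L_def)
      obtain u where u: "fst u = x0" "joined (Collect \<eta> \<inter> {- N..14 * D + N} \<times> {- N..2 * N} \<inter> {z. x0 \<le> fst z}) u (14 * D + N, b)"
        using joined_truncate[where g = fst and a = x0, OF nearest_neighbours_coordinates(1) ab] x0 by auto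
      have "joined (Collect \<eta> \<inter> {x0..x0 + 2 * L} \<times> {- N..- N + L - 1}) u (14 * D + N, b)"
        by (rule joined_mono[OF u(2)]) (use x0(3) in \<open>auto simp: L_def\<close>)
      moreover have "u = (x0, snd u)" using u(1) by (simp add: prod_eq_iff)
      ultimately show "\<eta> \<in> hcrossing (14 * D + N - 2 * L) (- N) L"
        unfolding hcrossing_def x0_def[symmetric] x0(3) mem_Collect_eq by metis
    qed
  qed simp
  also have "\<dots> = P (hcrossing 0 0 L)" by (rule prob_hcrossing)
  finally have "P (hcrossing 0 0 L) > 1 - 1 / 100" by (simp add: e_def)
  moreover have "L \<ge> 1" using M(2) MN by (simp add: L_def)
  ultimately show ?thesis by blast
qed

end

section \<open>Finite-size criterion\<close>

text \<open>\<open>crossing\<close> only makes the carrier sets meet. Applied to the clusters of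
  \<open>u\<close> and \<open>u'\<close> within these sets, it connects the paths
  themselves.\<close>

lemma crossing_clusters:
  assumes H: "joined H u v" "\<And>s. s \<in> H \<Longrightarrow> c \<le> snd s \<and> snd s \<le> d" "fst u \<le> a" "b \<le> fst v"
    and V: "joined V u' v'" "\<And>s. s \<in> V \<Longrightarrow> a \<le> fst s \<and> fst s \<le> b" "snd u' \<le> c" "d \<le> snd v'"
    and sub: "H \<subseteq> U" "V \<subseteq> U"
  shows "joined U u u'"
proof (rule joined_cluster_meet[OF _ sub])
  show "cluster H u \<inter> cluster V u' \<noteq> {}"
  proof (rule crossing)
    show "joined (cluster H u) u v" "joined (cluster V u') u' v'"
      using joined_via_cluster[OF H(1) order_refl] joined_via_cluster[OF V(1) order_refl] .
    show "c \<le> snd s \<and> snd s \<le> d" if "s \<in> cluster H u" for s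
      using H(2) subsetD[OF cluster_subset that] .
    show "a \<le> fst s \<and> fst s \<le> b" if "s \<in> cluster V u'" for s
      using V(2) subsetD[OF cluster_subset that] .
  qed (use H V in auto)
qed

definition strip_crossing :: "int \<Rightarrow> int \<Rightarrow> configuration set" where
  "strip_crossing y0 L = {\<eta>. \<exists>a b. joined (Collect \<eta> \<inter> {0..4 * L} \<times> {y0..y0 + L - 1}) (0, a) (4 * L, b)}"

lemma strip_crossing_determined: "determined_by ({0..4 * L} \<times> {y0..y0 + L - 1}) (strip_crossing y0 L)"
  unfolding strip_crossing_def by (rule determined_by_restriction)

text \<open>Consecutive horizontal crossings overlap in a block of \<open>L\<close> columns, where a
  vertical crossing connects them. The vertical crossings are longer than the strip is high, so that
  all five events have the same probability.\<close>

lemma strip_crossing_from_crossings: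
  assumes L: "1 \<le> L" and h: "\<eta> \<in> hcrossing 0 y0 L" "\<eta> \<in> hcrossing L y0 L" "\<eta> \<in> hcrossing (2 * L) y0 L"
    and v: "\<eta> \<in> vcrossing L y0 L" "\<eta> \<in> vcrossing (2 * L) y0 L"
  shows "\<eta> \<in> strip_crossing y0 L"
proof -
  let ?S = "Collect \<eta> \<inter> {0..4 * L} \<times> {y0..y0 + L - 1}"
  let ?H = "\<lambda>x0. Collect \<eta> \<inter> {x0..x0 + 2 * L} \<times> {y0..y0 + L - 1}"
  let ?V = "\<lambda>x0. Collect \<eta> \<inter> {x0..x0 + L - 1} \<times> {y0..y0 + L - 1}"
  have short: "\<exists>u w. snd u = y0 \<and> snd w = y0 + L - 1 \<and> joined (?V x0) u w" if v: "\<eta> \<in> vcrossing x0 y0 L" for x0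
  proof -
    obtain a b where ab: "joined (Collect \<eta> \<inter> {x0..x0 + L - 1} \<times> {y0..y0 + 2 * L}) (a, y0) (b, y0 + 2 * L)"
      using v unfolding vcrossing_def by blast
    \<comment> \<open>Only the part from the bottom up to the top row of the strip is kept; the
      height function is the negative of \<open>snd\<close> because \<open>joined_truncate\<close>
      keeps what lies above a level.\<close>
    obtain w where w: "snd w = y0 + L - 1" "joined (Collect \<eta> \<inter> {x0..x0 + L - 1} \<times> {y0..y0 + 2 * L} \<inter> {z. 1 - y0 - L \<le> - snd z}) w (a, y0)"
    proof -
      have "\<exists>w. - snd w = 1 - y0 - L \<and> joined (Collect \<eta> \<inter> {x0..x0 + L - 1} \<times> {y0..y0 + 2 * L} \<inter> {z. 1 - y0 - L \<le> - snd z}) w (a, y0)"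
        using L by (intro joined_truncate[OF nearest_neighbours_coordinates(2) joined_sym[OF ab]]) auto
      then obtain w where "- snd w = 1 - y0 - L" "joined (Collect \<eta> \<inter> {x0..x0 + L - 1} \<times> {y0..y0 + 2 * L} \<inter> {z. 1 - y0 - L \<le> - snd z}) w (a, y0)"
        by blast
      then show thesis by (intro that[of w]) auto
    qed
    have "joined (?V x0) (a, y0) w" by (rule joined_mono[OF joined_sym[OF w(2)]]) auto
    then show ?thesis using w(1) by (intro exI[of _ "(a, y0)"] exI[of _ w]) simp
  qed
  have glue: "joined ?S u u'"
    if H: "joined (?H x0) u v" "fst u = x0" "fst v = x0 + 2 * L" and V: "joined (?V x1) u' v'" "snd u' = y0" "snd v' = y0 + L - 1"
      and x: "0 \<le> x0" "x0 \<le> x1" "x1 + L - 1 \<le> x0 + 2 * L" "x0 \<le> 2 * L" for x0 x1 u v u' v'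
    by (rule crossing_clusters[OF H(1) _ _ _ V(1), where a = x1 and b = "x1 + L - 1" and c = y0 and d = "y0 + L - 1"])
       (use H V x L in auto)
  obtain a0 b0 where 0: "joined (?H 0) (0, a0) (0 + 2 * L, b0)" using h(1) unfolding hcrossing_def by blast
  obtain a1 b1 where 1: "joined (?H L) (L, a1) (L + 2 * L, b1)" using h(2) unfolding hcrossing_def by blast
  obtain a2 b2 where 2: "joined (?H (2 * L)) (2 * L, a2) (2 * L + 2 * L, b2)" using h(3) unfolding hcrossing_def by blast
  obtain u1 w1 where v1: "joined (?V L) u1 w1" "snd u1 = y0" "snd w1 = y0 + L - 1" using short[OF v(1)] by blast
  obtain u2 w2 where v2: "joined (?V (2 * L)) u2 w2" "snd u2 = y0" "snd w2 = y0 + L - 1" using short[OF v(2)] by blast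
  have "joined ?S (0, a0) u1" by (rule glue[OF 0 _ _ v1]) (use L in auto)
  moreover have "joined ?S (L, a1) u1" by (rule glue[OF 1 _ _ v1]) (use L in auto)
  moreover have "joined ?S (L, a1) u2" by (rule glue[OF 1 _ _ v2]) (use L in auto)
  moreover have "joined ?S (2 * L, a2) u2" by (rule glue[OF 2 _ _ v2]) (use L in auto)
  ultimately have "joined ?S (0, a0) (2 * L, a2)" by (meson joined_sym joined_trans)
  moreover have "joined ?S (2 * L, a2) (2 * L + 2 * L, b2)" by (rule joined_mono[OF 2]) (use L in auto)
  then have "joined ?S (2 * L, a2) (4 * L, b2)" by simp
  ultimately show ?thesis unfolding strip_crossing_def using joined_trans by blast
qed

text \<open>Rectangles anchored at the origin alternate in direction while doubling in size.
  Successive crossings intersect, so all of them lie in one cluster, and their far ends are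
  unbounded.\<close>

lemma infinite_cluster_from_crossings:
  assumes L: "1 \<le> L"
    and c: "\<And>k :: nat. \<eta> \<in> (if even k then hcrossing 0 0 (2 ^ k * L) else vcrossing 0 0 (2 ^ k * L))"
  shows "\<exists>x. infinite (cluster (Collect \<eta>) x)"
proof -
  define l where "l k = 2 ^ k * L" for k :: nat
  have l: "1 \<le> l k" "l (Suc k) = 2 * l k" "int k \<le> l k" for k
  proof -
    have "(1::int) \<le> 2 ^ k" by simp
    then show "1 \<le> l k" using mult_mono[of 1 "2 ^ k" 1 L] L by (simp add: l_def)
    have "int k < 2 ^ k" using less_exp[of k] by (metis of_nat_less_iff of_nat_numeral of_nat_power)
    then show "int k \<le> l k" using mult_mono[of "int k" "2 ^ k" 1 L] L by (simp add: l_def)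
  qed (simp add: l_def)
  let ?R = "\<lambda>k. if even k then {0..2 * l k} \<times> {0..l k - 1} else {0..l k - 1} \<times> {0..2 * l k}"
  have "\<exists>u v. joined (Collect \<eta> \<inter> ?R k) u v \<and> (if even k then fst u = 0 \<and> fst v = 2 * l k else snd u = 0 \<and> snd v = 2 * l k)" for k
  proof (cases "even k")
    case True
    then obtain a b where "joined (Collect \<eta> \<inter> ?R k) (0, a) (2 * l k, b)"
      using c[of k] by (auto simp: hcrossing_def l_def)
    then show ?thesis using True by (intro exI[of _ "(0, a)"] exI[of _ "(2 * l k, b)"]) simp
  next
    case False
    then obtain a b where "joined (Collect \<eta> \<inter> ?R k) (a, 0) (b, 2 * l k)"
      using c[of k] by (auto simp: vcrossing_def l_def)
    then show ?thesis using False by (intro exI[of _ "(a, 0)"] exI[of _ "(b, 2 * l k)"]) simp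
  qed
  then obtain u v where uv: "\<And>k. joined (Collect \<eta> \<inter> ?R k) (u k) (v k)"
    "\<And>k. if even k then fst (u k) = 0 \<and> fst (v k) = 2 * l k else snd (u k) = 0 \<and> snd (v k) = 2 * l k"
    by metis
  \<comment> \<open>The next rectangle is \<open>2 * l k\<close> sites thick, starting at coordinate
    0, so the crossing that ends at \<open>2 * l k\<close> just passes it. Hence the bounds
    \<open>2 * l k - 1\<close>.\<close>
  have step: "joined (Collect \<eta>) (u k) (u (Suc k))" for k
  proof (cases "even k")
    case True
    show ?thesis
      by (rule crossing_clusters[OF uv(1)[of k] _ _ _ uv(1)[of "Suc k"], where a = 0 and b = "2 * l k - 1" and c = 0 and d = "l k - 1"])
         (use True uv(2)[of k] uv(2)[of "Suc k"] l[of k] in auto)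
  next
    case False
    have "joined (Collect \<eta>) (u (Suc k)) (u k)"
      by (rule crossing_clusters[OF uv(1)[of "Suc k"] _ _ _ uv(1)[of k], where a = 0 and b = "l k - 1" and c = 0 and d = "2 * l k - 1"])
         (use False uv(2)[of k] uv(2)[of "Suc k"] l[of k] in auto)
    then show ?thesis by (rule joined_sym)
  qed
  have all: "joined (Collect \<eta>) (u 0) (u k)" for k
  proof (induction k)
    case 0
    show ?case using joined_in[OF uv(1)[of 0]] by (intro joined_refl) auto
  next
    case (Suc k)
    then show ?case using step joined_trans by blast
  qed
  have "infinite (cluster (Collect \<eta>) (u 0))"
  proof
    assume "finite (cluster (Collect \<eta>) (u 0))"
    then obtain m where m: "cluster (Collect \<eta>) (u 0) \<subseteq> square m" "0 \<le> m" by (rule finite_subset_square)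
    let ?k = "nat m"
    have "joined (Collect \<eta>) (u ?k) (v ?k)" by (rule joined_mono[OF uv(1)]) simp
    from joined_trans[OF all this] have "v ?k \<in> square m" using m(1) by (auto simp: cluster_def)
    moreover have "m < 2 * l ?k" "0 < l ?k" using l(1)[of ?k] l(3)[of ?k] m(2) by simp_all
    ultimately show False using uv(2)[of ?k] by (simp add: mem_square split: if_splits)
  qed
  then show ?thesis by blast
qed

section \<open>Translation to \<open>clusters\<close> and \<open>origin_percolates\<close>\<close>

lemma infinite_cluster_iff: "(\<exists>C\<in>clusters \<eta>. infinite C) \<longleftrightarrow> (\<exists>x. infinite_site \<eta> x)"
proof -
  have "infinite_site \<eta> x \<longleftrightarrow> \<eta> x \<and> infinite ((occupied_edges \<eta>)\<^sup>* `` {x})" for x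
    by (cases "\<eta> x") (simp_all add: infinite_site_def cluster_def joined_def Image_def)
  then show ?thesis by (auto simp: clusters_def)
qed

lemma origin_percolates_iff: "origin_percolates \<eta> \<longleftrightarrow> infinite_site \<eta> (0, 0)"
proof -
  have cl: "\<eta> x \<Longrightarrow> (occupied_edges \<eta>)\<^sup>* `` {x} = cluster (Collect \<eta>) x" for x
    by (simp add: cluster_def joined_def Image_def)
  have "origin_percolates \<eta> \<longleftrightarrow> (\<exists>x. \<eta> x \<and> (0, 0) \<in> cluster (Collect \<eta>) x \<and> infinite (cluster (Collect \<eta>) x))"
    unfolding origin_percolates_def clusters_def using cl by auto
  also have "\<dots> \<longleftrightarrow> infinite_site \<eta> (0, 0)"
  proof
    assume "\<exists>x. \<eta> x \<and> (0, 0) \<in> cluster (Collect \<eta>) x \<and> infinite (cluster (Collect \<eta>) x)"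
    then obtain x where x: "joined (Collect \<eta>) x (0, 0)" "infinite (cluster (Collect \<eta>) x)" by (auto simp: cluster_def)
    have "cluster (Collect \<eta>) x = cluster (Collect \<eta>) (0, 0)"
      unfolding cluster_def using x(1) joined_trans joined_sym by blast
    then show "infinite_site \<eta> (0, 0)" using x(2) by (simp add: infinite_site_def)
  next
    assume i: "infinite_site \<eta> (0, 0)"
    then have "(0, 0) \<in> Collect \<eta>" unfolding infinite_site_def by (rule infinite_cluster_in)
    then show "\<exists>x. \<eta> x \<and> (0, 0) \<in> cluster (Collect \<eta>) x \<and> infinite (cluster (Collect \<eta>) x)"
      using i joined_refl[of "(0, 0)" "Collect \<eta>"] by (intro exI[of _ "(0, 0)"]) (simp add: infinite_site_def cluster_def)
  qed
  finally show ?thesis .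
qed

context site_percolation
begin

lemma strip_crossing_in_events [simp]: "strip_crossing y0 L \<in> events"
  using determined_by_sets[OF _ strip_crossing_determined] by simp

text \<open>The doubled rectangle contains two disjoint strips, whose crossings fail independently.\<close>

lemma crossing_doubling:
  assumes L: "1 \<le> L" and q: "1 - q \<le> P (hcrossing 0 0 L)"
  shows "1 - 25 * q\<^sup>2 \<le> P (hcrossing 0 0 (2 * L))"
proof -
  have strip: "1 - 5 * q \<le> P (strip_crossing y0 L)" for y0
  proof -
    have h: "1 - q \<le> P (hcrossing x0 y0 L)" "1 - q \<le> P (vcrossing x0 y0 L)" for x0
      using q prob_hcrossing[of x0 y0 L] prob_vcrossing[of x0 y0 L] by simp_all
    let ?E = "hcrossing 0 y0 L \<inter> (hcrossing L y0 L \<inter> (hcrossing (2 * L) y0 L \<inter> (vcrossing L y0 L \<inter> vcrossing (2 * L) y0 L)))"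
    \<comment> \<open>Three horizontal and two vertical crossings, each failing with probability at
      most \<open>q\<close>; two independent strips turn \<open>5 * q\<close> into its
      square.\<close>
    have "1 - (q + (q + (q + (q + q)))) \<le> P ?E"
      by (intro prob_Int_ge sets.Int h) simp_all
    also have "\<dots> \<le> P (strip_crossing y0 L)"
      by (intro percolation.finite_measure_mono) (use strip_crossing_from_crossings[OF L] in auto)
    finally show ?thesis by simp
  qed
  let ?A = "strip_crossing 0 L" and ?B = "strip_crossing L L"
  have q0: "0 \<le> q" using q percolation.prob_le_1[of p "hcrossing 0 0 L"] by linarith
  have "P (- ?A \<inter> - ?B) = P (- ?A) * P (- ?B)"
  proof (rule indep_determined)
    show "determined_by ({0..4 * L} \<times> {0..0 + L - 1}) (- ?A)" "determined_by ({0..4 * L} \<times> {L..L + L - 1}) (- ?B)"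
      by (intro determined_by_Compl strip_crossing_determined)+
    show "- ?B \<in> events" using sets.compl_sets[OF strip_crossing_in_events[of L L]] by (simp add: Compl_eq_Diff_UNIV)
  qed auto
  also have "\<dots> \<le> (5 * q) * (5 * q)"
    using strip[of 0] strip[of L] q0 by (intro mult_mono) (auto simp: prob_Compl measure_nonneg intro: order_trans)
  finally have "1 - 25 * q\<^sup>2 \<le> P (?A \<union> ?B)"
    using prob_Compl[OF sets.Un[OF strip_crossing_in_events strip_crossing_in_events], of 0 L L L] by (simp add: power2_eq_square)
  also have "\<dots> \<le> P (hcrossing 0 0 (2 * L))"
  proof (rule percolation.finite_measure_mono)
    have "strip_crossing y0 L \<subseteq> hcrossing 0 0 (2 * L)" if "y0 = 0 \<or> y0 = L" for y0
    proof
      fix \<eta> assume "\<eta> \<in> strip_crossing y0 L"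
      then obtain a b where ab: "joined (Collect \<eta> \<inter> {0..4 * L} \<times> {y0..y0 + L - 1}) (0, a) (4 * L, b)"
        unfolding strip_crossing_def by blast
      have "joined (Collect \<eta> \<inter> {0..0 + 2 * (2 * L)} \<times> {0..0 + 2 * L - 1}) (0, a) (0 + 2 * (2 * L), b)"
      proof -
        have "joined (Collect \<eta> \<inter> {0..4 * L} \<times> {0..2 * L - 1}) (0, a) (4 * L, b)"
          by (rule joined_mono[OF ab]) (use that L in auto)
        then show ?thesis by simp
      qed
      then show "\<eta> \<in> hcrossing 0 0 (2 * L)" unfolding hcrossing_def by blast
    qed
    then show "?A \<union> ?B \<subseteq> hcrossing 0 0 (2 * L)" by blast
  qed simp
  finally show ?thesis .
qed

text \<open>As long as \<open>q\<close> is at most 1/100, 25 q^2 is at most q / 4, so each doubling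
  divides the bound on the failure probability by 4 and keeps it in this range.\<close>

lemma crossing_iterate:
  assumes L: "1 \<le> L" and h: "1 - 1 / 100 \<le> P (hcrossing 0 0 L)"
  shows "1 - 1 / 100 * (1 / 4) ^ k \<le> P (hcrossing 0 0 (2 ^ k * L))"
proof (induction k)
  case 0
  show ?case using h by simp
next
  case (Suc k)
  let ?q = "1 / 100 * (1 / 4) ^ k :: real"
  have q: "0 \<le> ?q" "?q \<le> 1 / 100" by (simp_all add: power_le_one)
  have "1 \<le> 2 ^ k * L" using mult_mono[of 1 "2 ^ k" 1 L] L by simp
  from crossing_doubling[OF this Suc]
  have "1 - 25 * ?q\<^sup>2 \<le> P (hcrossing 0 0 (2 ^ Suc k * L))" by (simp add: mult.assoc)
  moreover have "25 * ?q\<^sup>2 \<le> 1 / 4 * ?q"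
    using mult_left_mono[OF q(2) q(1)] by (simp add: power2_eq_square)
  ultimately show ?case by simp
qed

text \<open>The failure probabilities of the nested crossings sum to at most 1/75, so all crossings
  occur together with positive probability.\<close>

theorem finite_size_criterion:
  assumes L: "1 \<le> L" and h: "1 - 1 / 100 \<le> P (hcrossing 0 0 L)"
  shows "P {\<eta>. \<exists>x. infinite_site \<eta> x} \<noteq> 0"
proof -
  define E where "E k = (if even k then hcrossing 0 0 (2 ^ k * L) else vcrossing 0 0 (2 ^ k * L))" for k :: nat
  have E: "E k \<in> events" for k by (simp add: E_def)
  have cE: "- E k \<in> events" for k using sets.compl_sets[OF E[of k]] by (simp add: Compl_eq_Diff_UNIV)
  have fail: "P (- E k) \<le> 1 / 100 * (1 / 4) ^ k" for k
  proof -
    have "P (E k) = P (hcrossing 0 0 (2 ^ k * L))" by (simp add: E_def prob_vcrossing)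
    then show ?thesis using crossing_iterate[OF L h, of k] prob_Compl[OF E[of k]] by simp
  qed
  have geo: "(\<lambda>k. 1 / 100 * (1 / 4) ^ k) sums (1 / 100 * (1 / (1 - 1 / 4 :: real)))"
    by (intro sums_mult geometric_sums) simp
  have summable: "summable (\<lambda>k. P (- E k))"
    by (rule summable_comparison_test'[OF sums_summable[OF geo]]) (use fail in \<open>simp add: measure_nonneg\<close>)
  have "P (\<Union>k. - E k) \<le> (\<Sum>k. P (- E k))"
    by (rule percolation.finite_measure_subadditive_countably) (use cE summable in auto)
  also have "\<dots> \<le> (\<Sum>k. 1 / 100 * (1 / 4) ^ k)"
    by (rule suminf_le[OF fail summable sums_summable[OF geo]])
  also have "\<dots> = 1 / 100 * (1 / (1 - 1 / 4))" using sums_unique[OF geo] by simp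
  finally have "P (\<Union>k. - E k) < 1" by simp
  moreover have "P (- (\<Union>k. - E k)) = 1 - P (\<Union>k. - E k)"
    using cE by (intro prob_Compl) blast
  moreover have "P (- (\<Union>k. - E k)) \<le> P {\<eta>. \<exists>x. infinite_site \<eta> x}"
  proof (rule percolation.finite_measure_mono)
    show "- (\<Union>k. - E k) \<subseteq> {\<eta>. \<exists>x. infinite_site \<eta> x}"
      unfolding infinite_site_def using infinite_cluster_from_crossings[OF L] by (auto simp: E_def)
    show "{\<eta>. \<exists>x. infinite_site \<eta> x} \<in> events" by (rule event_Collect) measurable
  qed
  ultimately show ?thesis by linarith
qed

text \<open>By translation invariance no site percolates almost surely, and there are countably many
  sites.\<close>

lemma no_infinite_cluster:
  assumes "P {\<eta>. origin_percolates \<eta>} = 0"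
  shows "P {\<eta>. \<exists>x. infinite_site \<eta> x} = 0"
proof -
  have ev: "{\<eta>. infinite_site \<eta> x} \<in> events" for x by (rule event_Collect) measurable
  have "P {\<eta>. infinite_site \<eta> x} = 0" for x
  proof -
    have "{\<eta>. \<eta> \<circ> (+) x \<in> {\<eta>. infinite_site \<eta> (0, 0)}} = {\<eta>. infinite_site \<eta> x}"
      by (simp add: infinite_site_translation zero_prod_def[symmetric])
    then show ?thesis using reindex(2)[of "(+) x", OF _ ev[of "(0, 0)"]] assms by (simp add: origin_percolates_iff)
  qed
  then have "P (\<Union>n. {\<eta>. infinite_site \<eta> (from_nat n)}) = 0" by (intro null_UN ev)
  moreover have "(\<Union>n. {\<eta>. infinite_site \<eta> (from_nat n)}) = {\<eta>. \<exists>x. infinite_site \<eta> x}"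
    by auto (metis from_nat_to_nat)
  ultimately show ?thesis by simp
qed

end

section \<open>The critical parameter\<close>

lemma zero_no_percolation: "measure (percolation_measure 0) {\<eta>. origin_percolates \<eta>} = 0"
proof -
  interpret site_percolation 0 by unfold_locales auto
  have ev: "{\<eta>. \<eta> (0, 0)} \<in> sets (percolation_measure 0)"
    by (rule event_Collect[OF occupied_measurable])
  have "measure (percolation_measure 0) {\<eta>. \<eta> (0, 0)} = 0" using resample[OF ev, of "(0, 0)"] by simp
  moreover have "{\<eta>. origin_percolates \<eta>} \<subseteq> {\<eta>. \<eta> (0, 0)}"
    unfolding origin_percolates_iff infinite_site_def using infinite_cluster_in by fastforce
  ultimately show ?thesis
    using percolation.finite_measure_mono[OF _ ev] measure_nonneg[of "percolation_measure 0"] by (metis order_antisym)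
qed

theorem proposition5p1:
  shows "AE \<omega> in percolation_measure p_c. \<not> (\<exists>C\<in>clusters \<omega>. infinite C)"
proof -
  define \<Theta> where "\<Theta> = {p \<in> {0..1}. measure (percolation_measure p) {\<omega>. origin_percolates \<omega>} = 0}"
  have pc: "p_c = Sup \<Theta>" by (simp add: p_c_def \<Theta>_def)
  have "0 \<in> \<Theta>" using zero_no_percolation by (simp add: \<Theta>_def)
  have bdd: "bdd_above \<Theta>" by (rule bdd_aboveI[of _ 1]) (simp add: \<Theta>_def)
  have pc01: "0 \<le> p_c" "p_c \<le> 1"
  proof -
    show "0 \<le> p_c" unfolding pc by (rule cSup_upper[OF \<open>0 \<in> \<Theta>\<close> bdd])
    show "p_c \<le> 1" unfolding pc
    proof (rule cSup_least)
      show "\<Theta> \<noteq> {}" using \<open>0 \<in> \<Theta>\<close> by blast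
    qed (simp add: \<Theta>_def)
  qed
  have none: "measure (percolation_measure p) {\<eta>. \<exists>x. infinite_site \<eta> x} = 0" if "p \<in> \<Theta>" for p
  proof -
    interpret site_percolation p using that by unfold_locales (auto simp: \<Theta>_def)
    show ?thesis using that by (intro no_infinite_cluster) (simp add: \<Theta>_def)
  qed
  interpret site_percolation p_c using pc01 by unfold_locales
  have "P {\<eta>. \<exists>x. infinite_site \<eta> x} = 0"
  proof (rule ccontr)
    assume inf: "\<not> ?thesis"
    \<comment> \<open>Uniqueness, and with it \<open>long_crossing_likely\<close>, is available for
      positive parameters only.\<close>
    then have "p_c \<noteq> 0" using none[OF \<open>0 \<in> \<Theta>\<close>] by metis
    then obtain L where L: "L \<ge> 1" "P (hcrossing 0 0 L) > 1 - 1 / 100"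
      using long_crossing_likely inf pc01 by auto
    \<comment> \<open>For the fixed \<open>L\<close>, the strict bound at \<open>p_c\<close>
      persists at nearby parameters, and the criterion then applies to them.\<close>
    have "continuous_on {0..1} (\<lambda>p. measure (percolation_measure p) (hcrossing 0 0 L))"
      by (rule continuous_on_prob[OF _ hcrossing_determined]) simp
    then have "((\<lambda>p. measure (percolation_measure p) (hcrossing 0 0 L)) \<longlongrightarrow> P (hcrossing 0 0 L)) (at p_c within {0..1})"
      using pc01 by (simp add: continuous_on_def)
    then have "\<forall>\<^sub>F p in at p_c within {0..1}. 1 - 1 / 100 < measure (percolation_measure p) (hcrossing 0 0 L)"
      using L(2) by (rule order_tendstoD(1))
    then obtain d where d: "d > 0" "\<And>p. p \<in> {0..1} \<Longrightarrow> p \<noteq> p_c \<Longrightarrow> dist p p_c < d \<Longrightarrow> 1 - 1 / 100 < measure (percolation_measure p) (hcrossing 0 0 L)"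
      by (auto simp: eventually_at)
    \<comment> \<open>A supremum has members of \<open>\<Theta>\<close> arbitrarily close below it.
      The member found may be \<open>p_c\<close> itself, where the bound holds by the choice of
      \<open>L\<close>.\<close>
    obtain p where p: "p \<in> \<Theta>" "p_c - d < p"
      using less_cSup_iff[OF _ bdd, of "p_c - d"] \<open>0 \<in> \<Theta>\<close> d(1) unfolding pc by auto
    have "p \<le> p_c" unfolding pc by (rule cSup_upper[OF p(1) bdd])
    then have likely: "1 - 1 / 100 < measure (percolation_measure p) (hcrossing 0 0 L)"
      using d(2)[of p] p L(2) by (cases "p = p_c") (auto simp: \<Theta>_def dist_real_def)
    interpret q: site_percolation p using p(1) by unfold_locales (auto simp: \<Theta>_def)
    show False using likely q.finite_size_criterion[OF L(1)] none[OF p(1)] by simp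
  qed
  moreover have "{\<eta>. \<exists>x. infinite_site \<eta> x} \<in> events" by (rule event_Collect) measurable
  ultimately have "{\<eta>. \<exists>x. infinite_site \<eta> x} \<in> null_sets (percolation_measure p_c)"
    by (simp add: null_sets_def percolation.emeasure_eq_measure)
  then show ?thesis by (rule AE_I') (auto simp: infinite_cluster_iff)
qed

end
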